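(* Let $X$ be a metric space, and let $n \ge 0$ be an integer. Then the following properties are equivalent: (1) $\dim_{\rm N} X \le n$, i.e. there exists a constant $c_1 > 0$ such that for all $s > 0$, $X$ has a $c_1 s$-bounded covering with $s$-multiplicity at most $n+1$. (2) There exists a constant $c_2 > 0$ such that for all $s > 0$, there exists a $1$-Lipschitz map $f \colon X \to Y$ into some piecewise euclidean simplicial complex $Y$ of dimension $\le n$ such that every finite subcomplex of $Y$ is isometric to a subcomplex of some regular euclidean simplex of edge length $s$, and $\operatorname{diam} f^{-1}(\operatorname{st}(y,Y)) \le c_2 s$ for every vertex $y$ of $Y$. (3) There exists a constant $c_3 > 0$ such that for all $s > 0$, there exists a $1$-Lipschitz map $g \colon X \to Z$ into some piecewise euclidean polyhedral complex $Z$ of dimension $\le n$ such that every open ball of radius $s$ in $Z$ is contained in the open star $\operatorname{st}(z,Z_1)$ of some vertex $z$ of the first barycentric subdivision $Z_1$ of $Z$, and $\operatorname{diam} g^{-1}(\operatorname{st}(z,Z_1)) \le c_3 s$ for every vertex $z$ of $Z_1$. (4) There exists a constant $c_4 > 0$ such that for all $s > 0$, $X$ admits a $c_4 s$-bounded covering of the form $\mathcal{B} = \bigcup_{k=0}^n \mathcal{B}_k$ where each family $\mathcal{B}_k$ has $s$-multiplicity at most $1$.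
   Context: A family $(B_i)_{i\in I}$ of subsets of a metric space $X=(X,d)$ is called $D$-bounded ($D \ge 0$) if $\operatorname{diam} B_i := \sup\{d(x,x') : x,x'\in B_i\} \le D$ for all $i$. For $s>0$, the $s$-multiplicity of the family is the infimum of all integers $n \ge 0$ such that every subset of $X$ with diameter $\le s$ meets at most $n$ members of the family. The Nagata dimension $\dim_{\rm N} X$ of a metric space $X$ is the infimum of all integers $n$ with the following property: there exists a constant $c>0$ such that for all $s>0$, $X$ has a $cs$-bounded covering with $s$-multiplicity at most $n+1$ (the value is $\infty$ if there is no such $n$). A convex euclidean polyhedral cell $C$ is a compact metric space isometric to the convex hull of a positive finite number of points in some euclidean space; faces, edges, vertices, the interior $\operatorname{int} C$ (the relative interior; for a single point it is the point itself), and the dimension of $C$ are defined in the obvious way. An $m$-dimensional convex euclidean polyhedral cell with exactly $m+1$ vertices is called a euclidean simplex. A piecewise euclidean polyhedral complex $Z=(Z,\mathcal{C})$ is a metric space $Z$ together with a covering $\mathcal{C} \subset 2^Z$ of $Z$ such that each $C \in \mathcal{C}$, equipped with the metric induced from $Z$, is a convex euclidean polyhedral cell, every face of $C$ is in $\mathcal{C}$, and any two elements of $\mathcal{C}$ either are disjoint or intersect in a common face. The metric on $Z$ is not required to be intrinsic. For $z \in Z$, the open star $\operatorname{st}(z,Z)$ is the union of all $\operatorname{int} C$ such that $z \in C \in \mathcal{C}$. The dimension of $Z$ is the supremum of the dimensions of its cells. If each cell is a euclidean simplex, $Z$ is called a piecewise euclidean simplicial complex. The first barycentric subdivision $Z_1=(Z,\mathcal{C}_1)$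 of $Z$ is the same metric space with cells subdivided barycentrically; it is a piecewise euclidean simplicial complex whose vertices are the barycenters of the cells of $Z$. A subcomplex of a regular euclidean simplex carries the metric induced from the simplex. *)

theory Defs
  imports "HOL-Analysis.Analysis" "HOL-Analysis.Finite_Function_Topology"
begin

section \<open>Nagata dimension\<close>

text \<open>Metric spaces are given by a carrier and a distance function as in the locale
  \<^locale>\<open>Metric_space\<close>, so that they may be empty and subsets can be regarded as metric spaces.\<close>

text \<open>The diameter takes values in \<open>[0,\<infinity>]\<close>; the empty set has diameter 0.\<close>

definition ediam :: "('a \<Rightarrow> 'a \<Rightarrow> real) \<Rightarrow> 'a set \<Rightarrow> ennreal" where
  "ediam d B = (SUP (x, x') \<in> B \<times> B. ennreal (d x x'))"

definition bounded_family :: "('a \<Rightarrow> 'a \<Rightarrow> real) \<Rightarrow> real \<Rightarrow> 'i set \<Rightarrow> ('i \<Rightarrow> 'a set) \<Rightarrow> bool" where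
  "bounded_family d D I B \<longleftrightarrow> (\<forall>i\<in>I. ediam d (B i) \<le> ennreal D)"

definition multiplicity_at_scale ::
  "'a set \<Rightarrow> ('a \<Rightarrow> 'a \<Rightarrow> real) \<Rightarrow> real \<Rightarrow> 'i set \<Rightarrow> ('i \<Rightarrow> 'a set) \<Rightarrow> enat" where
  "multiplicity_at_scale X d s I B =
     Inf {enat n | n. \<forall>S\<subseteq>X. ediam d S \<le> ennreal s \<longrightarrow>
                       finite {i\<in>I. B i \<inter> S \<noteq> {}} \<and> card {i\<in>I. B i \<inter> S \<noteq> {}} \<le> n}"

definition covering :: "'a set \<Rightarrow> 'a set set \<Rightarrow> bool" where
  "covering X \<B> \<longleftrightarrow> \<Union>\<B> = X"

text \<open>Coverings are sets of subsets, indexed by themselves. Passing from an indexed covering to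
  the set of its members preserves boundedness and does not increase the multiplicity, so this
  does not affect which coverings exist.\<close>

definition nagata_property :: "'a set \<Rightarrow> ('a \<Rightarrow> 'a \<Rightarrow> real) \<Rightarrow> int \<Rightarrow> bool" where
  "nagata_property X d n \<longleftrightarrow>
     (\<exists>c>0. \<forall>s>0. \<exists>\<B>. covering X \<B> \<and> bounded_family d (c * s) \<B> (\<lambda>B. B) \<and>
        ereal_of_enat (multiplicity_at_scale X d s \<B> (\<lambda>B. B)) \<le> ereal (real_of_int (n + 1)))"

definition nagata_dim :: "'a set \<Rightarrow> ('a \<Rightarrow> 'a \<Rightarrow> real) \<Rightarrow> ereal" where
  "nagata_dim X d = Inf {ereal (real_of_int n) | n. nagata_property X d n}"


section \<open>A common home for all euclidean spaces\<close>

text \<open>The finitely supported functions on an index set, with the standard inner product.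
  Every finite subset of \<^typ>\<open>nat\<close>-indexed such functions lies in some \<open>\<real>\<^sup>k\<close>
  and each \<open>\<real>\<^sup>k\<close> embeds, so ``the convex hull of finitely many points in some
  euclidean space'' can be expressed in one type without bounding the dimension.
  (The type \<open>'i \<Rightarrow>\<^sub>0 real\<close> cannot be used directly, as the library equips it with the
  \<open>l\<^sup>1\<close> metric.)\<close>

typedef 'i eucl = "UNIV :: ('i \<Rightarrow>\<^sub>0 real) set"
  morphisms coords Eucl ..

setup_lifting type_definition_eucl

instantiation eucl :: (type) real_vector
begin
lift_definition zero_eucl :: "'a eucl" is 0 .
lift_definition plus_eucl :: "'a eucl \<Rightarrow> 'a eucl \<Rightarrow> 'a eucl" is "(+)" .
lift_definition minus_eucl :: "'a eucl \<Rightarrow> 'a eucl \<Rightarrow> 'a eucl" is "(-)" .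
lift_definition uminus_eucl :: "'a eucl \<Rightarrow> 'a eucl" is uminus .
lift_definition scaleR_eucl :: "real \<Rightarrow> 'a eucl \<Rightarrow> 'a eucl" is scaleR .
instance
  by standard (transfer; simp add: algebra_simps)+
end

lemma lookup_scaleR_poly_mapping:
  "Poly_Mapping.lookup (r *\<^sub>R x) i = r * Poly_Mapping.lookup x i"
  for x :: "'i \<Rightarrow>\<^sub>0 real"
proof -
  have "finite {i. r *\<^sub>R Poly_Mapping.lookup x i \<noteq> 0}"
    by (rule finite_subset[OF _ finite_keys[of x]]) (auto simp: in_keys_iff)
  then show ?thesis
    by (simp add: scaleR_poly_mapping_def Abs_poly_mapping_inverse)
qed

instantiation eucl :: (type) real_inner
begin

definition inner_eucl :: "'a eucl \<Rightarrow> 'a eucl \<Rightarrow> real" where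
  "inner_eucl x y = (\<Sum>i\<in>Poly_Mapping.keys (coords x).
     Poly_Mapping.lookup (coords x) i * Poly_Mapping.lookup (coords y) i)"

definition norm_eucl :: "'a eucl \<Rightarrow> real" where
  "norm_eucl x = sqrt (inner x x)"

definition dist_eucl :: "'a eucl \<Rightarrow> 'a eucl \<Rightarrow> real" where
  "dist_eucl x y = norm (x - y)"

definition sgn_eucl :: "'a eucl \<Rightarrow> 'a eucl" where
  "sgn_eucl x = scaleR (inverse (norm x)) x"

definition uniformity_eucl :: "('a eucl \<times> 'a eucl) filter" where
  "uniformity_eucl = (INF e\<in>{0 <..}. principal {(x, y). dist x y < e})"

definition open_eucl :: "'a eucl set \<Rightarrow> bool" where
  "open_eucl U \<longleftrightarrow> (\<forall>x\<in>U. eventually (\<lambda>(x', y). x' = x \<longrightarrow> y \<in> U) uniformity)"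

lemma inner_eucl_superset:
  assumes "finite K" "Poly_Mapping.keys (coords x) \<subseteq> K"
  shows "inner x y = (\<Sum>i\<in>K. Poly_Mapping.lookup (coords x) i * Poly_Mapping.lookup (coords y) i)"
  unfolding inner_eucl_def
  by (rule sum.mono_neutral_left) (use assms in \<open>auto simp: in_keys_iff\<close>)

instance
proof
  fix x y z :: "'a eucl" and r :: real
  let ?K = "Poly_Mapping.keys (coords x) \<union> Poly_Mapping.keys (coords y)
    \<union> Poly_Mapping.keys (coords (x + y)) \<union> Poly_Mapping.keys (coords (r *\<^sub>R x))"
  have K: "inner u v = (\<Sum>i\<in>?K. Poly_Mapping.lookup (coords u) i * Poly_Mapping.lookup (coords v) i)"
    if "Poly_Mapping.keys (coords u) \<subseteq> ?K" for u v
    by (rule inner_eucl_superset) (use that in auto)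
  have Kx: "inner x v = (\<Sum>i\<in>?K. Poly_Mapping.lookup (coords x) i * Poly_Mapping.lookup (coords v) i)" for v
    by (rule K) blast
  have Ky: "inner y v = (\<Sum>i\<in>?K. Poly_Mapping.lookup (coords y) i * Poly_Mapping.lookup (coords v) i)" for v
    by (rule K) blast
  have Kxy: "inner (x + y) v = (\<Sum>i\<in>?K. Poly_Mapping.lookup (coords (x + y)) i * Poly_Mapping.lookup (coords v) i)" for v
    by (rule K) blast
  have Kr: "inner (r *\<^sub>R x) v = (\<Sum>i\<in>?K. Poly_Mapping.lookup (coords (r *\<^sub>R x)) i * Poly_Mapping.lookup (coords v) i)" for v
    by (rule K) blast
  show "inner x y = inner y x"
    unfolding Kx Ky by (simp only: mult.commute)
  show "inner (x + y) z = inner x z + inner y z"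
    unfolding Kx Ky Kxy sum.distrib[symmetric]
    by (rule sum.cong[OF refl]) (simp add: plus_eucl.rep_eq lookup_add distrib_right)
  show "inner (r *\<^sub>R x) y = r * inner x y"
    unfolding Kx Kr sum_distrib_left
    by (rule sum.cong[OF refl]) (simp add: scaleR_eucl.rep_eq lookup_scaleR_poly_mapping)
  show "0 \<le> inner x x"
    unfolding inner_eucl_def by (rule sum_nonneg) simp
  have "inner x x = 0 \<longleftrightarrow> (\<forall>i\<in>Poly_Mapping.keys (coords x). Poly_Mapping.lookup (coords x) i = 0)"
    unfolding inner_eucl_def by (subst sum_nonneg_eq_0_iff) auto
  also have "\<dots> \<longleftrightarrow> coords x = 0"
    by (metis in_keys_iff lookup_zero poly_mapping_eqI)
  finally show "inner x x = 0 \<longleftrightarrow> x = 0"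
    using coords_inject[of x 0] by (simp only: zero_eucl.rep_eq)
qed (simp_all only: norm_eucl_def dist_eucl_def sgn_eucl_def uniformity_eucl_def open_eucl_def
       divide_inverse)

end


section \<open>Convex euclidean polyhedral cells\<close>

text \<open>A chart of a cell is an isometry onto a polytope. Such isometries are unique up to
  isometries between polytopes, which are affine; hence the notions below, which are pulled back
  along charts, do not depend on the chart.\<close>

definition cell_chart :: "('z \<Rightarrow> 'z \<Rightarrow> real) \<Rightarrow> 'z set \<Rightarrow> ('z \<Rightarrow> nat eucl) \<Rightarrow> bool" where
  "cell_chart d C \<phi> \<longleftrightarrow>
     (\<forall>x\<in>C. \<forall>y\<in>C. dist (\<phi> x) (\<phi> y) = d x y) \<and>
     (\<exists>P. finite P \<and> P \<noteq> {} \<and> \<phi> ` C = convex hull P)"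

definition convex_cell :: "('z \<Rightarrow> 'z \<Rightarrow> real) \<Rightarrow> 'z set \<Rightarrow> bool" where
  "convex_cell d C \<longleftrightarrow> Metric_space C d \<and> (\<exists>\<phi>. cell_chart d C \<phi>)"

text \<open>Faces are nonempty; a cell is a face of itself.\<close>

definition cell_face :: "('z \<Rightarrow> 'z \<Rightarrow> real) \<Rightarrow> 'z set \<Rightarrow> 'z set \<Rightarrow> bool" where
  "cell_face d F C \<longleftrightarrow>
     F \<noteq> {} \<and> F \<subseteq> C \<and> (\<exists>\<phi>. cell_chart d C \<phi> \<and> (\<phi> ` F) face_of (\<phi> ` C))"

definition cell_vertices :: "('z \<Rightarrow> 'z \<Rightarrow> real) \<Rightarrow> 'z set \<Rightarrow> 'z set" where
  "cell_vertices d C = {v. cell_face d {v} C}"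

definition cell_int :: "('z \<Rightarrow> 'z \<Rightarrow> real) \<Rightarrow> 'z set \<Rightarrow> 'z set" where
  "cell_int d C = {x\<in>C. \<exists>\<phi>. cell_chart d C \<phi> \<and> \<phi> x \<in> rel_interior (\<phi> ` C)}"

text \<open>The dimension of the direction space of the affine hull
  (\<^const>\<open>aff_dim\<close> is restricted to the class \<^class>\<open>euclidean_space\<close>).\<close>

definition cell_dim :: "('z \<Rightarrow> 'z \<Rightarrow> real) \<Rightarrow> 'z set \<Rightarrow> nat" where
  "cell_dim d C =
     (THE m. \<exists>\<phi>. cell_chart d C \<phi> \<and> m = dim {\<phi> x - \<phi> y | x y. x \<in> C \<and> y \<in> C})"

definition euclidean_simplex :: "('z \<Rightarrow> 'z \<Rightarrow> real) \<Rightarrow> 'z set \<Rightarrow> bool" where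
  "euclidean_simplex d C \<longleftrightarrow> convex_cell d C \<and> card (cell_vertices d C) = cell_dim d C + 1"

text \<open>The barycenter of a cell is the arithmetic mean of its vertices.\<close>

definition barycenter :: "('z \<Rightarrow> 'z \<Rightarrow> real) \<Rightarrow> 'z set \<Rightarrow> 'z" where
  "barycenter d C =
     (THE b. b \<in> C \<and> (\<exists>\<phi>. cell_chart d C \<phi> \<and>
        \<phi> b = (1 / real (card (cell_vertices d C))) *\<^sub>R (\<Sum>v\<in>cell_vertices d C. \<phi> v)))"

definition cell_hull :: "('z \<Rightarrow> 'z \<Rightarrow> real) \<Rightarrow> 'z set \<Rightarrow> 'z set \<Rightarrow> 'z set" where
  "cell_hull d C S = {x\<in>C. \<exists>\<phi>. cell_chart d C \<phi> \<and> \<phi> x \<in> convex hull (\<phi> ` S)}"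


section \<open>Piecewise euclidean complexes\<close>

definition polyhedral_complex :: "'z set \<Rightarrow> ('z \<Rightarrow> 'z \<Rightarrow> real) \<Rightarrow> 'z set set \<Rightarrow> bool" where
  "polyhedral_complex Z d \<C> \<longleftrightarrow>
     Metric_space Z d \<and> \<Union>\<C> = Z \<and>
     (\<forall>C\<in>\<C>. convex_cell d C) \<and>
     (\<forall>C\<in>\<C>. \<forall>F. cell_face d F C \<longrightarrow> F \<in> \<C>) \<and>
     (\<forall>C\<in>\<C>. \<forall>D\<in>\<C>. C \<inter> D = {} \<or> (cell_face d (C \<inter> D) C \<and> cell_face d (C \<inter> D) D))"

definition simplicial_complex :: "'z set \<Rightarrow> ('z \<Rightarrow> 'z \<Rightarrow> real) \<Rightarrow> 'z set set \<Rightarrow> bool" where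
  "simplicial_complex Z d \<C> \<longleftrightarrow>
     polyhedral_complex Z d \<C> \<and> (\<forall>C\<in>\<C>. euclidean_simplex d C)"

definition complex_dim :: "('z \<Rightarrow> 'z \<Rightarrow> real) \<Rightarrow> 'z set set \<Rightarrow> enat" where
  "complex_dim d \<C> = (SUP C\<in>\<C>. enat (cell_dim d C))"

definition complex_vertices :: "('z \<Rightarrow> 'z \<Rightarrow> real) \<Rightarrow> 'z set set \<Rightarrow> 'z set" where
  "complex_vertices d \<C> = (\<Union>C\<in>\<C>. cell_vertices d C)"

definition open_star :: "('z \<Rightarrow> 'z \<Rightarrow> real) \<Rightarrow> 'z set set \<Rightarrow> 'z \<Rightarrow> 'z set" where
  "open_star d \<C> z = \<Union>{cell_int d C | C. C \<in> \<C> \<and> z \<in> C}"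

text \<open>The cells of the subdivision are spanned by the barycenters of flags of cells, where
  \<open>C\<close> is the largest member of the flag.\<close>

definition barycentric_subdivision ::
  "('z \<Rightarrow> 'z \<Rightarrow> real) \<Rightarrow> 'z set set \<Rightarrow> 'z set set" where
  "barycentric_subdivision d \<C> =
     {cell_hull d C (barycenter d ` \<F>) | C \<F>.
        C \<in> \<C> \<and> C \<in> \<F> \<and> subset.chain {F. cell_face d F C} \<F>}"

definition subcomplex :: "('z \<Rightarrow> 'z \<Rightarrow> real) \<Rightarrow> 'z set set \<Rightarrow> 'z set set \<Rightarrow> bool" where
  "subcomplex d \<C> \<D> \<longleftrightarrow> \<D> \<subseteq> \<C> \<and> (\<forall>C\<in>\<D>. \<forall>F. cell_face d F C \<longrightarrow> F \<in> \<D>)"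

definition regular_simplex :: "real \<Rightarrow> nat eucl set \<Rightarrow> bool" where
  "regular_simplex s \<Delta> \<longleftrightarrow> euclidean_simplex dist \<Delta> \<and>
     (\<forall>v\<in>cell_vertices dist \<Delta>. \<forall>w\<in>cell_vertices dist \<Delta>. v \<noteq> w \<longrightarrow> dist v w = s)"

definition isometric_spaces ::
  "'y set \<Rightarrow> ('y \<Rightarrow> 'y \<Rightarrow> real) \<Rightarrow> 'z set \<Rightarrow> ('z \<Rightarrow> 'z \<Rightarrow> real) \<Rightarrow> bool" where
  "isometric_spaces Y d Z d' \<longleftrightarrow>
     (\<exists>h. bij_betw h Y Z \<and> (\<forall>x\<in>Y. \<forall>y\<in>Y. d' (h x) (h y) = d x y))"

definition finite_subcomplexes_regular ::
  "real \<Rightarrow> ('z \<Rightarrow> 'z \<Rightarrow> real) \<Rightarrow> 'z set set \<Rightarrow> bool" where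
  "finite_subcomplexes_regular s d \<C> \<longleftrightarrow>
     (\<forall>\<D>. subcomplex d \<C> \<D> \<and> finite \<D> \<longrightarrow>
        (\<exists>\<Delta> \<E>. regular_simplex s \<Delta> \<and> subcomplex dist {F. cell_face dist F \<Delta>} \<E> \<and>
               isometric_spaces (\<Union>\<D>) d (\<Union>\<E>) dist))"


section \<open>Characterizations of Nagata dimension\<close>

definition nonexpanding ::
  "'a set \<Rightarrow> ('a \<Rightarrow> 'a \<Rightarrow> real) \<Rightarrow> 'y set \<Rightarrow> ('y \<Rightarrow> 'y \<Rightarrow> real) \<Rightarrow> ('a \<Rightarrow> 'y) \<Rightarrow> bool" where
  "nonexpanding X d Y d' f \<longleftrightarrow>
     f ` X \<subseteq> Y \<and> (\<forall>x\<in>X. \<forall>x'\<in>X. d' (f x) (f x') \<le> d x x')"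

text \<open>The type arguments of the next two predicates are the types in which the carriers of the
  target complexes live, as these cannot be quantified inside a formula. For \<open>X :: 'a set\<close> the
  type \<open>'a set eucl\<close> is large enough: replacing a target complex by the subcomplex of those cells
  whose interior meets the image, together with their faces, preserves all conditions and leaves
  at most \<open>max |X| |\<real>|\<close> points.\<close>

definition maps_to_simplicial_complexes ::
  "'y itself \<Rightarrow> 'a set \<Rightarrow> ('a \<Rightarrow> 'a \<Rightarrow> real) \<Rightarrow> nat \<Rightarrow> bool" where
  "maps_to_simplicial_complexes _ X d n \<longleftrightarrow>
     (\<exists>c>0. \<forall>s>0. \<exists>(Y :: 'y set) dY \<C> f.
        simplicial_complex Y dY \<C> \<and> complex_dim dY \<C> \<le> enat n \<and>
        finite_subcomplexes_regular s dY \<C> \<and>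
        nonexpanding X d Y dY f \<and>
        (\<forall>y\<in>complex_vertices dY \<C>. ediam d (f -` open_star dY \<C> y \<inter> X) \<le> ennreal (c * s)))"

definition maps_to_polyhedral_complexes ::
  "'z itself \<Rightarrow> 'a set \<Rightarrow> ('a \<Rightarrow> 'a \<Rightarrow> real) \<Rightarrow> nat \<Rightarrow> bool" where
  "maps_to_polyhedral_complexes _ X d n \<longleftrightarrow>
     (\<exists>c>0. \<forall>s>0. \<exists>(Z :: 'z set) dZ \<C> g.
        polyhedral_complex Z dZ \<C> \<and> complex_dim dZ \<C> \<le> enat n \<and>
        (let \<C>\<^sub>1 = barycentric_subdivision dZ \<C> in
           (\<forall>p\<in>Z. \<exists>z\<in>complex_vertices dZ \<C>\<^sub>1. Metric_space.mball Z dZ p s \<subseteq> open_star dZ \<C>\<^sub>1 z) \<and>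
           (\<forall>z\<in>complex_vertices dZ \<C>\<^sub>1. ediam d (g -` open_star dZ \<C>\<^sub>1 z \<inter> X) \<le> ennreal (c * s))) \<and>
        nonexpanding X d Z dZ g)"

definition separated_coverings :: "'a set \<Rightarrow> ('a \<Rightarrow> 'a \<Rightarrow> real) \<Rightarrow> nat \<Rightarrow> bool" where
  "separated_coverings X d n \<longleftrightarrow>
     (\<exists>c>0. \<forall>s>0. \<exists>\<B> \<B>\<^sub>k. covering X \<B> \<and> bounded_family d (c * s) \<B> (\<lambda>B. B) \<and>
        \<B> = (\<Union>k\<in>{0..n}. \<B>\<^sub>k k) \<and>
        (\<forall>k\<in>{0..n}. multiplicity_at_scale X d s (\<B>\<^sub>k k) (\<lambda>B. B) \<le> 1))"

end

theory Submission
  imports Defs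
begin

text \<open>
  From coverings to maps: let \<open>\<B>\<close> be a covering by sets of diameter at most \<open>c r\<close> with
  \<open>r\<close>-multiplicity at most \<open>n + 1\<close>. The functions \<open>max 0 (r/2 - d(x,B))\<close> are 1-Lipschitz, at most
  \<open>n + 1\<close> of them are nonzero at a given point, and their sum is at least \<open>r/2\<close>. Normalising them gives
  barycentric coordinates of a point in the \<open>n\<close>-skeleton of a regular simplex whose vertices are
  indexed by sets of points, and the resulting map is 1-Lipschitz once the size \<open>R\<close> of the simplex is a suitable
  multiple of \<open>r\<close> (\<open>covering_imp_map_to_skeleton\<close>). A point is sent into the open star of the vertex
  \<open>B\<close> only if it is \<open>r/2\<close>-close to \<open>B\<close>, so preimages of stars are small. The same target serves as
  polyhedral complex: among the at most \<open>n + 1\<close> nonzero coordinates of a point, which add up to \<open>R\<close>,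
  some two consecutive values (with 0 included) differ by \<open>R / (n + 1)\<^sup>2\<close> or more (\<open>value_gap\<close>).
  If \<open>W\<close> is the set of vertices above such a gap, the gap survives at all points close by, and a point
  whose coordinates on \<open>W\<close> exceed the others lies in the open star of the barycenter of the face spanned
  by \<open>W\<close> (\<open>star_of_level_set\<close>). Hence the stars of the barycentric subdivision have a Lebesgue number
  proportional to \<open>R\<close>.

  From maps to coverings: given a map \<open>g\<close> and a family of open stars with Lebesgue number
  exceeding \<open>s\<close>, let \<open>B\<^sub>z\<close> consist of the points whose image has its ball inside the star of
  \<open>z\<close>. If \<open>x \<in> B\<^sub>z\<close> and \<open>d(x,x') \<le> s\<close>, then \<open>g x'\<close> is in the star of \<open>z\<close>; so the \<open>s\<close>-multiplicity of the
  sets \<open>B\<^sub>z\<close> is bounded by the multiplicity of the stars at a single point. For the barycentric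
  subdivision of a polyhedral complex, \<open>z\<close> is the barycenter of a cell, and the sets are sorted by the
  dimension of that cell. A point lies strictly inside at most one flag of cells
  (\<open>in_flag_unique\<close>), it is in the star of the barycenter of \<open>F\<close> only if \<open>F\<close> belongs to this flag, and a
  flag has at most one member of each dimension; so the stars of one colour are disjoint. For a simplicial
  complex whose finite subcomplexes are those of regular simplices, a point is in at most \<open>n + 1\<close>
  vertex stars, and the Lebesgue number is obtained by realising two simplices isometrically in one
  euclidean space, where the distance controls the difference of barycentric coordinates
  (\<open>lebesgue_number\<close>).

  All notions for cells are defined through charts. They can be computed in any isometric embedding into
  an inner product space because inner products of difference vectors are determined by distances, and
  thus so are all affine relations between points (\<open>isometric_on_affine_combination\<close>). This covers
  a change of chart, the embedding of two simplices into a common euclidean space, and the identity map of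
  the skeleton.
\<close>

section \<open>Convex geometry without a dimension bound\<close>

lemma sum_image_reindexed:
  fixes f :: "'i \<Rightarrow> 'b::real_vector"
  assumes I: "finite I"
  obtains a where "sum a I = sum u (f ` I)" "(\<Sum>i\<in>I. a i *\<^sub>R f i) = (\<Sum>v\<in>f ` I. u v *\<^sub>R v)"
    "\<And>i. i \<in> I \<Longrightarrow> a i = 0 \<or> a i = u (f i)"
proof -
  obtain J where J: "J \<subseteq> I" "f ` I = f ` J" "inj_on f J" by (metis order_refl subset_image_inj)
  let ?a = "\<lambda>i. if i \<in> J then u (f i) else 0"
  have "sum ?a I = (\<Sum>i\<in>J. u (f i))" "(\<Sum>i\<in>I. ?a i *\<^sub>R f i) = (\<Sum>i\<in>J. u (f i) *\<^sub>R f i)"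
    using I J(1) by (intro sum.mono_neutral_cong_right; simp)+
  then show thesis
    by (intro that[of ?a]) (simp_all add: J(2) sum.reindex[OF J(3)])
qed

lemma convex_hull_image_finite:
  fixes f :: "'i \<Rightarrow> 'b::real_vector"
  assumes "finite I"
  shows "convex hull (f ` I) = {\<Sum>i\<in>I. a i *\<^sub>R f i | a. (\<forall>i\<in>I. 0 \<le> a i) \<and> sum a I = 1}"
    (is "_ = ?R")
proof
  show "convex hull (f ` I) \<subseteq> ?R"
  proof
    fix y assume "y \<in> convex hull (f ` I)"
    then obtain u where u: "\<forall>v\<in>f ` I. 0 \<le> u v" "sum u (f ` I) = 1" "(\<Sum>v\<in>f ` I. u v *\<^sub>R v) = y"
      unfolding convex_hull_finite[OF finite_imageI[OF assms]] by blast
    obtain a where a: "sum a I = sum u (f ` I)" "(\<Sum>i\<in>I. a i *\<^sub>R f i) = (\<Sum>v\<in>f ` I. u v *\<^sub>R v)"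
      "\<And>i. i \<in> I \<Longrightarrow> a i = 0 \<or> a i = u (f i)"
      by (rule sum_image_reindexed[OF assms, where u = u and f = f]) (rule that)
    have "0 \<le> a i" if "i \<in> I" for i using a(3)[OF that] u(1) that by auto
    then show "y \<in> ?R" using a(1,2) u(2,3) by (intro CollectI exI[of _ a]) simp
  qed
  show "?R \<subseteq> convex hull (f ` I)"
    using assms by (auto intro!: convex_sum[OF _ convex_convex_hull] intro: hull_inc)
qed

lemma affine_hull_image_finite:
  fixes f :: "'i \<Rightarrow> 'b::real_vector"
  assumes "finite I" "y \<in> affine hull (f ` I)"
  obtains a where "sum a I = 1" "y = (\<Sum>i\<in>I. a i *\<^sub>R f i)"
proof -
  obtain u where "sum u (f ` I) = 1" "(\<Sum>v\<in>f ` I. u v *\<^sub>R v) = y"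
    using assms(2) unfolding affine_hull_finite[OF finite_imageI[OF assms(1)]] by blast
  then show thesis using sum_image_reindexed[OF assms(1), of u f] that by metis
qed

lemma convex_combination_split:
  fixes x :: "'i \<Rightarrow> 'b::real_vector"
  assumes "finite I" "j \<in> I" "\<And>i. i \<in> I \<Longrightarrow> 0 \<le> a i" "sum a I = 1" "a j \<noteq> 1"
    and "convex S" "\<And>i. i \<in> I \<Longrightarrow> i \<noteq> j \<Longrightarrow> x i \<in> S"
  obtains y where "y \<in> S" "(\<Sum>i\<in>I - {j}. a i *\<^sub>R x i) = (1 - a j) *\<^sub>R y"
    "(\<Sum>i\<in>I. a i *\<^sub>R x i) = a j *\<^sub>R x j + (1 - a j) *\<^sub>R y" "a j < 1"
proof -
  define b where "b i = a i / (1 - a j)" for i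
  have rest: "sum a (I - {j}) = 1 - a j"
    using assms by (simp add: sum_diff1)
  moreover have "0 \<le> sum a (I - {j})" using assms by (intro sum_nonneg) auto
  ultimately have lt: "a j < 1" using assms by linarith
  have "sum b (I - {j}) = 1"
    using rest lt by (simp add: b_def flip: sum_divide_distrib)
  then have 1: "(\<Sum>i\<in>I - {j}. b i *\<^sub>R x i) \<in> S"
    using assms lt by (intro convex_sum) (auto simp: b_def)
  have 2: "(\<Sum>i\<in>I - {j}. a i *\<^sub>R x i) = (1 - a j) *\<^sub>R (\<Sum>i\<in>I - {j}. b i *\<^sub>R x i)"
    using lt by (simp add: b_def scaleR_sum_right)
  show thesis
    by (rule that[OF 1 2 _ lt]) (use assms in \<open>simp add: 2[symmetric] sum.remove[of I j]\<close>)
qed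

text \<open>A face that contains a convex combination contains every point that occurs with positive weight, since
  the combination lies on a segment from that point to a combination of the others.\<close>

lemma face_of_convex_sum:
  fixes x :: "'i \<Rightarrow> 'b::real_vector"
  assumes F: "F face_of S" and "convex S" "finite I" "\<And>i. i \<in> I \<Longrightarrow> 0 \<le> a i" "sum a I = 1"
    and x: "\<And>i. i \<in> I \<Longrightarrow> x i \<in> S" and mem: "(\<Sum>i\<in>I. a i *\<^sub>R x i) \<in> F" and j: "j \<in> I" "a j > 0"
  shows "x j \<in> F"
proof (cases "a j = 1")
  case True
  have "sum a (I - {j}) = 0"
    using assms True by (simp add: sum_diff1)
  then have "\<forall>i\<in>I - {j}. a i = 0"
    using assms by (subst (asm) sum_nonneg_eq_0_iff) auto
  then have "(\<Sum>i\<in>I - {j}. a i *\<^sub>R x i) = 0" by (simp add: sum.neutral)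
  then have "(\<Sum>i\<in>I. a i *\<^sub>R x i) = x j"
    using assms True by (simp add: sum.remove[of I j])
  then show ?thesis using mem by simp
next
  case False
  obtain y where y: "y \<in> S" "(\<Sum>i\<in>I. a i *\<^sub>R x i) = a j *\<^sub>R x j + (1 - a j) *\<^sub>R y" "a j < 1"
    using convex_combination_split[of I j a S x] assms False by metis
  show ?thesis
  proof (cases "x j = y")
    case True
    then have "(\<Sum>i\<in>I. a i *\<^sub>R x i) = x j"
      using y by (simp flip: scaleR_add_left)
    then show ?thesis using mem by simp
  next
    case False
    then have "(\<Sum>i\<in>I. a i *\<^sub>R x i) \<in> open_segment (x j) y"
      unfolding in_segment using y j by (intro conjI exI[of _ "1 - a j"]) auto
    then show ?thesis using face_ofD[OF F] x j y mem by blast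
  qed
qed

lemma face_of_convex_hull_eq:
  fixes P :: "'b::real_vector set"
  assumes "finite P" "F face_of (convex hull P)"
  shows "F = convex hull (F \<inter> P)"
proof
  show "convex hull (F \<inter> P) \<subseteq> F"
    using assms by (intro hull_minimal) (auto simp: face_of_imp_convex)
  show "F \<subseteq> convex hull (F \<inter> P)"
  proof
    fix y assume y: "y \<in> F"
    then have "y \<in> convex hull ((\<lambda>x. x) ` P)"
      using face_of_imp_subset[OF assms(2)] by auto
    then obtain a where a: "y = (\<Sum>v\<in>P. a v *\<^sub>R v)" "\<forall>v\<in>P. 0 \<le> a v" "sum a P = 1"
      unfolding convex_hull_image_finite[OF assms(1)] by auto
    have pos: "v \<in> F" if "v \<in> P" "a v \<noteq> 0" for v
      using face_of_convex_sum[OF assms(2) _ assms(1), of a "\<lambda>v. v" v] a y that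
      by (force intro: hull_inc)
    have "y = (\<Sum>v\<in>F \<inter> P. a v *\<^sub>R v)"
      unfolding a(1) using pos assms(1) by (intro sum.mono_neutral_right) auto
    moreover have "sum a (F \<inter> P) = 1"
      unfolding a(3)[symmetric] using pos assms(1) by (intro sum.mono_neutral_left) auto
    ultimately show "y \<in> convex hull (F \<inter> P)"
      using a assms(1) by (simp, intro convex_sum) (auto intro: hull_inc)
  qed
qed

text \<open>Minkowski's theorem for polytopes: in a generating set of least cardinality no point is in the hull of the
  others, and this makes every generator extreme.\<close>

lemma convex_hull_extreme_points:
  fixes P :: "'b::real_vector set"
  assumes "finite P"
  shows "convex hull P = convex hull {x. x extreme_point_of (convex hull P)}"
proof -
  define Q where "Q = (ARG_MIN card Q. Q \<subseteq> P \<and> convex hull Q = convex hull P)"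
  have Q: "Q \<subseteq> P" "convex hull Q = convex hull P"
    using arg_min_natI[of "\<lambda>Q. Q \<subseteq> P \<and> convex hull Q = convex hull P" P card] by (auto simp: Q_def)
  have min: "card Q \<le> card Q'" if "Q' \<subseteq> P" "convex hull Q' = convex hull P" for Q'
    using arg_min_nat_le[of "\<lambda>Q. Q \<subseteq> P \<and> convex hull Q = convex hull P" Q' card] that
    by (auto simp: Q_def)
  have fin: "finite Q" using Q assms finite_subset by blast
  have "q extreme_point_of (convex hull Q)" if q: "q \<in> Q" for q
  proof -
    let ?Q = "Q - {q}"
    have ins: "Q = insert q ?Q" using q by auto
    have nin: "q \<notin> convex hull ?Q"
    proof
      assume "q \<in> convex hull ?Q"
      then have "convex hull Q = convex hull ?Q"
        by (metis ins hull_redundant)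
      then have "card Q \<le> card ?Q" using Q by (intro min) auto
      then show False using q fin by (metis card_Diff1_less not_le)
    qed
    show ?thesis
    proof (cases "?Q = {}")
      case True
      then have "Q = {q}" using q by auto
      then show ?thesis by simp
    next
      case False
      have hull: "convex hull Q = {(1 - u) *\<^sub>R q + u *\<^sub>R x |x u. 0 \<le> u \<and> u \<le> 1 \<and> x \<in> convex hull ?Q}"
        using convex_hull_insert_alt[of q ?Q] False ins by metis
      have "q \<notin> open_segment a b" if "a \<in> convex hull Q" "b \<in> convex hull Q" for a b
      proof
        assume "q \<in> open_segment a b"
        then obtain t where t: "a \<noteq> b" "0 < t" "t < 1" "q = (1 - t) *\<^sub>R a + t *\<^sub>R b"
          by (auto simp: in_segment)
        obtain x u where x: "a = (1 - u) *\<^sub>R q + u *\<^sub>R x" "0 \<le> u" "u \<le> 1" "x \<in> convex hull ?Q"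
          using \<open>a \<in> _\<close> unfolding hull by auto
        obtain y v where y: "b = (1 - v) *\<^sub>R q + v *\<^sub>R y" "0 \<le> v" "v \<le> 1" "y \<in> convex hull ?Q"
          using \<open>b \<in> _\<close> unfolding hull by auto
        let ?w = "(1 - t) * u + t * v"
        have "\<not> (u = 0 \<and> v = 0)" using t(1) x(1) y(1) by auto
        then have "u > 0 \<or> v > 0" using x(2) y(2) by linarith
        then have w: "?w > 0"
          using t(2,3) x(2) y(2) by (elim disjE) (simp_all add: add_pos_nonneg add_nonneg_pos)
        have "?w *\<^sub>R q = ((1 - t) * u) *\<^sub>R x + (t * v) *\<^sub>R y"
        proof -
          have "q = (1 - t) *\<^sub>R ((1 - u) *\<^sub>R q + u *\<^sub>R x) + t *\<^sub>R ((1 - v) *\<^sub>R q + v *\<^sub>R y)"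
            using t(4) x(1) y(1) by simp
          then show ?thesis by (simp add: algebra_simps)
        qed
        then have "(1 / ?w) *\<^sub>R (?w *\<^sub>R q) = (1 / ?w) *\<^sub>R (((1 - t) * u) *\<^sub>R x + (t * v) *\<^sub>R y)"
          by (rule arg_cong)
        then have "q = (((1 - t) * u) / ?w) *\<^sub>R x + ((t * v) / ?w) *\<^sub>R y"
          using w by (simp add: scaleR_add_right)
        moreover have "\<dots> \<in> convex hull ?Q"
          using x(2,4) y(2,4) t(2,3) w
          by (intro convexD[OF convex_convex_hull]) (simp_all flip: add_divide_distrib)
        ultimately show False using nin by simp
      qed
      then show ?thesis
        using q by (auto simp: extreme_point_of_def hull_inc)
    qed
  qed
  then have "Q = {x. x extreme_point_of (convex hull P)}"
    using extreme_point_of_convex_hull[of _ Q] Q by auto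
  then show ?thesis using Q by simp
qed

text \<open>From a point of the relative interior one can move a little further away from any other point.\<close>

lemma rel_interior_extends:
  fixes S :: "'b::real_normed_vector set"
  assumes "p \<in> rel_interior S" "a \<in> S"
  obtains b t where "b \<in> S" "0 < t" "t < 1" "p = (1 - t) *\<^sub>R a + t *\<^sub>R b"
proof -
  obtain e where e: "e > 0" "ball p e \<inter> affine hull S \<subseteq> S" and p: "p \<in> S"
    using assms by (auto simp: mem_rel_interior_ball)
  define r where "r = e / (2 * (norm (p - a) + 1))"
  have r: "r > 0" using e by (simp add: r_def add_nonneg_pos)
  define b where "b = (1 + r) *\<^sub>R p + (- r) *\<^sub>R a"
  have "b \<in> affine hull S"
    unfolding b_def by (rule mem_affine[OF affine_affine_hull]) (auto simp: assms p hull_inc)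
  moreover have "dist p b < e"
  proof -
    have "p - b = r *\<^sub>R (a - p)" by (simp add: b_def algebra_simps)
    then have "dist p b = r * norm (p - a)"
      using r by (simp add: dist_norm norm_minus_commute)
    also have "\<dots> < e"
    proof -
      have "norm (p - a) < 2 * (norm (p - a) + 1)"
        using norm_ge_zero[of "p - a"] unfolding distrib_left by linarith
      then have "e * norm (p - a) < e * (2 * (norm (p - a) + 1))" using e by simp
      then show ?thesis using norm_ge_zero[of "p - a"]
        by (simp add: r_def divide_simps add_nonneg_pos mult.commute)
    qed
    finally show ?thesis .
  qed
  ultimately have "b \<in> S" using e by auto
  moreover have "p = (1 - 1 / (1 + r)) *\<^sub>R a + (1 / (1 + r)) *\<^sub>R b"
  proof -
    have "(1 / (1 + r)) *\<^sub>R b = p - (r / (1 + r)) *\<^sub>R a"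
      using r by (simp add: b_def scaleR_diff_right)
    moreover have "1 - 1 / (1 + r) = r / (1 + r)" using r by (simp add: field_simps)
    ultimately show ?thesis by simp
  qed
  ultimately show thesis using r by (intro that[of b "1 / (1 + r)"]) auto
qed

text \<open>Extending the segment from the mean of all generators through \<open>p\<close> exhibits \<open>p\<close> as a combination of this
  mean and some other point; the mean contributes a positive weight to every generator.\<close>

lemma rel_interior_convex_hull_coeffs:
  fixes f :: "'i \<Rightarrow> 'b::real_normed_vector"
  assumes "finite I" "p \<in> rel_interior (convex hull (f ` I))"
  obtains a where "\<And>i. i \<in> I \<Longrightarrow> a i > 0" "sum a I = 1" "p = (\<Sum>i\<in>I. a i *\<^sub>R f i)"
proof -
  have "convex hull (f ` I) \<noteq> {}" using assms rel_interior_subset by blast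
  then have ne: "I \<noteq> {}" by auto
  let ?m = "1 / real (card I)"
  have m: "?m > 0" "(\<Sum>i\<in>I. ?m) = 1" using ne assms by (auto simp: card_gt_0_iff)
  have "(\<Sum>i\<in>I. ?m *\<^sub>R f i) \<in> convex hull (f ` I)"
    using m assms by (intro convex_sum) (auto intro: hull_inc)
  then obtain b t where b: "b \<in> convex hull (f ` I)" "0 < t" "t < 1"
      "p = (1 - t) *\<^sub>R (\<Sum>i\<in>I. ?m *\<^sub>R f i) + t *\<^sub>R b"
    using rel_interior_extends[OF assms(2)] by metis
  obtain c where c: "b = (\<Sum>i\<in>I. c i *\<^sub>R f i)" "\<forall>i\<in>I. 0 \<le> c i" "sum c I = 1"
    using b(1) unfolding convex_hull_image_finite[OF assms(1)] by auto
  show thesis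
  proof (rule that[of "\<lambda>i. (1 - t) * ?m + t * c i"])
    show "(1 - t) * ?m + t * c i > 0" if "i \<in> I" for i
      using that b c m by (intro add_pos_nonneg mult_pos_pos mult_nonneg_nonneg) auto
    show "(\<Sum>i\<in>I. (1 - t) * ?m + t * c i) = 1"
      unfolding sum.distrib sum_distrib_left[symmetric] m(2) c(3) by simp
    show "p = (\<Sum>i\<in>I. ((1 - t) * ?m + t * c i) *\<^sub>R f i)"
      unfolding b(4) c(1) by (simp add: scaleR_add_left sum.distrib scaleR_sum_right)
  qed
qed

text \<open>The converse needs coefficients that depend continuously on the point, which is what the Lipschitz bound
  provides: near \<open>p\<close> they stay nonnegative.\<close>

lemma rel_interior_of_stable_coefficients:
  fixes f :: "'i \<Rightarrow> 'b::real_normed_vector"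
  assumes I: "finite I" and a: "\<And>i. i \<in> I \<Longrightarrow> 0 < a i" "sum a I = 1" and p: "p = (\<Sum>i\<in>I. a i *\<^sub>R f i)"
    and K: "0 < K" and stable: "\<And>i c. i \<in> I \<Longrightarrow> sum c I = 1 \<Longrightarrow> \<bar>a i - c i\<bar> \<le> K * dist p (\<Sum>i\<in>I. c i *\<^sub>R f i)"
  shows "p \<in> rel_interior (convex hull (f ` I))"
  unfolding mem_rel_interior_ball
proof (intro conjI exI)
  have ne: "I \<noteq> {}" using a(2) by auto
  let ?m = "Min (a ` I)"
  have m: "0 < ?m" "\<And>i. i \<in> I \<Longrightarrow> ?m \<le> a i" using I ne a by auto
  show "p \<in> convex hull (f ` I)"
    unfolding p by (rule convex_sum[OF I convex_convex_hull a(2)]) (use a(1) in \<open>auto simp: less_imp_le hull_inc\<close>)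
  show "0 < ?m / K" using m(1) K by simp
  show "ball p (?m / K) \<inter> affine hull (convex hull (f ` I)) \<subseteq> convex hull (f ` I)"
  proof
    fix z assume z: "z \<in> ball p (?m / K) \<inter> affine hull (convex hull (f ` I))"
    then have "z \<in> affine hull (f ` I)" by (simp add: affine_hull_convex_hull)
    then obtain c where c: "sum c I = 1" "z = (\<Sum>i\<in>I. c i *\<^sub>R f i)"
      by (rule affine_hull_image_finite[OF I])
    have "K * dist p z < ?m" using z K by (simp add: pos_less_divide_eq mult.commute)
    then have "0 \<le> c i" if "i \<in> I" for i
      using stable[OF that c(1)] m(2)[OF that] unfolding c(2) by linarith
    then show "z \<in> convex hull (f ` I)"
      unfolding c(2) by (intro convex_sum[OF I convex_convex_hull c(1)]) (auto simp: hull_inc)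
  qed
qed

section \<open>Isometric embeddings into inner product spaces\<close>

definition isometric_on :: "('z \<Rightarrow> 'z \<Rightarrow> real) \<Rightarrow> 'z set \<Rightarrow> ('z \<Rightarrow> 'b::real_inner) \<Rightarrow> bool" where
  "isometric_on d C \<psi> \<longleftrightarrow> (\<forall>x\<in>C. \<forall>y\<in>C. dist (\<psi> x) (\<psi> y) = d x y)"

lemma isometric_on_subset: "isometric_on d C \<psi> \<Longrightarrow> F \<subseteq> C \<Longrightarrow> isometric_on d F \<psi>"
  by (auto simp: isometric_on_def)

lemma inner_eq_dists:
  fixes u v w :: "'b::real_inner"
  shows "inner (u - w) (v - w) = ((dist u w)\<^sup>2 + (dist v w)\<^sup>2 - (dist u v)\<^sup>2) / 2"
  by (simp add: dist_norm power2_norm_eq_inner inner_diff inner_commute algebra_simps)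

text \<open>The Gram matrix of difference vectors is determined by distances.\<close>

lemma isometric_on_norm_eq:
  fixes \<phi> :: "'z \<Rightarrow> 'b::real_inner" and \<psi> :: "'z \<Rightarrow> 'c::real_inner"
  assumes \<phi>: "isometric_on d C \<phi>" and \<psi>: "isometric_on d C \<psi>"
    and "p \<in> C" "\<And>i. i \<in> I \<Longrightarrow> x i \<in> C"
  shows "norm (\<Sum>i\<in>I. a i *\<^sub>R (\<phi> (x i) - \<phi> p)) = norm (\<Sum>i\<in>I. a i *\<^sub>R (\<psi> (x i) - \<psi> p))"
proof -
  have "inner (\<phi> (x i) - \<phi> p) (\<phi> (x j) - \<phi> p) = inner (\<psi> (x i) - \<psi> p) (\<psi> (x j) - \<psi> p)"
    if "i \<in> I" "j \<in> I" for i j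
    using assms that unfolding inner_eq_dists isometric_on_def by simp
  then show ?thesis
    by (simp add: norm_eq_sqrt_inner inner_sum_left inner_sum_right cong: sum.cong)
qed

lemma affine_combination_in:
  fixes y :: "'i \<Rightarrow> 'b::real_vector"
  assumes "affine S" "finite I" "sum a I = 1" "\<And>i. i \<in> I \<Longrightarrow> y i \<in> S"
  shows "(\<Sum>i\<in>I. a i *\<^sub>R y i) \<in> S"
proof -
  obtain i0 where i0: "i0 \<in> I" using assms(3) by fastforce
  let ?V = "(\<lambda>x. x - y i0) ` S"
  have "subspace ?V"
    using assms(1,4) i0 affine_diffs_subspace_subtract by blast
  then have "(\<Sum>i\<in>I. a i *\<^sub>R (y i - y i0)) \<in> ?V"
    using assms(4) by (intro subspace_sum subspace_scale) auto
  moreover have "(\<Sum>i\<in>I. a i *\<^sub>R (y i - y i0)) = (\<Sum>i\<in>I. a i *\<^sub>R y i) - y i0"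
    using assms(3) by (simp add: scaleR_diff_right sum_subtractf flip: scaleR_sum_left)
  ultimately show ?thesis by auto
qed

lemma isometric_on_affine_norm_eq:
  fixes \<phi> :: "'z \<Rightarrow> 'b::real_inner" and \<psi> :: "'z \<Rightarrow> 'c::real_inner"
  assumes "isometric_on d C \<phi>" "isometric_on d C \<psi>"
    and "p \<in> C" "\<And>i. i \<in> I \<Longrightarrow> x i \<in> C" "sum a I = 1"
  shows "norm (\<phi> p - (\<Sum>i\<in>I. a i *\<^sub>R \<phi> (x i))) = norm (\<psi> p - (\<Sum>i\<in>I. a i *\<^sub>R \<psi> (x i)))"
proof -
  have *: "(\<Sum>i\<in>I. a i *\<^sub>R (f (x i) - f p)) = (\<Sum>i\<in>I. a i *\<^sub>R f (x i)) - f p" for f :: "'z \<Rightarrow> 'd::real_inner"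
    using assms(5) by (simp add: scaleR_diff_right sum_subtractf flip: scaleR_sum_left)
  show ?thesis
    using isometric_on_norm_eq[OF assms(1-3), of I x a] assms(4) by (simp add: norm_minus_commute *)
qed

lemma isometric_on_affine_combination:
  fixes \<phi> :: "'z \<Rightarrow> 'b::real_inner" and \<psi> :: "'z \<Rightarrow> 'c::real_inner"
  assumes "isometric_on d C \<phi>" "isometric_on d C \<psi>"
    and "p \<in> C" "\<And>i. i \<in> I \<Longrightarrow> x i \<in> C" "sum a I = 1" "\<phi> p = (\<Sum>i\<in>I. a i *\<^sub>R \<phi> (x i))"
  shows "\<psi> p = (\<Sum>i\<in>I. a i *\<^sub>R \<psi> (x i))"
  using isometric_on_affine_norm_eq[OF assms(1-3), of I x a] assms(4-6) by simp

lemma isometric_on_convex_combination: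
  fixes \<phi> :: "'z \<Rightarrow> 'b::real_inner" and \<psi> :: "'z \<Rightarrow> 'c::real_inner"
  assumes "isometric_on d C \<phi>" "isometric_on d C \<psi>"
    and "p \<in> C" "a \<in> C" "b \<in> C" "\<phi> p = (1 - t) *\<^sub>R \<phi> a + t *\<^sub>R \<phi> b"
  shows "\<psi> p = (1 - t) *\<^sub>R \<psi> a + t *\<^sub>R \<psi> b"
  using isometric_on_affine_combination[OF assms(1,2,3), of UNIV "\<lambda>i. if i then a else b" "\<lambda>i. if i then 1 - t else t"]
    assms(4-6) by (simp add: UNIV_bool)

lemma isometric_on_eq_iff:
  assumes "isometric_on d C \<phi>" "isometric_on d C \<psi>" "x \<in> C" "y \<in> C"
  shows "\<phi> x = \<phi> y \<longleftrightarrow> \<psi> x = \<psi> y"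
  using assms unfolding isometric_on_def by (metis dist_eq_0_iff)

lemma isometric_on_open_segment:
  fixes \<phi> :: "'z \<Rightarrow> 'b::real_inner" and \<psi> :: "'z \<Rightarrow> 'c::real_inner"
  assumes "isometric_on d C \<phi>" "isometric_on d C \<psi>" "p \<in> C" "a \<in> C" "b \<in> C"
    and "\<phi> p \<in> open_segment (\<phi> a) (\<phi> b)"
  shows "\<psi> p \<in> open_segment (\<psi> a) (\<psi> b)"
  using assms isometric_on_convex_combination[OF assms(1-5)] isometric_on_eq_iff[OF assms(1,2,4,5)]
  unfolding in_segment by metis

text \<open>Linear dependence of difference vectors is a vanishing norm, hence visible in every embedding.\<close>

lemma isometric_on_independent:
  fixes \<phi> :: "'z \<Rightarrow> 'b::real_inner" and \<psi> :: "'z \<Rightarrow> 'c::real_inner"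
  assumes \<phi>: "isometric_on d C \<phi>" and \<psi>: "isometric_on d C \<psi>" and p: "p \<in> C" and A: "A \<subseteq> C"
    and inj: "inj_on (\<lambda>x. \<phi> x - \<phi> p) A" and ind: "independent ((\<lambda>x. \<phi> x - \<phi> p) ` A)"
  shows "inj_on (\<lambda>x. \<psi> x - \<psi> p) A" "independent ((\<lambda>x. \<psi> x - \<psi> p) ` A)"
proof -
  show inj': "inj_on (\<lambda>x. \<psi> x - \<psi> p) A"
  proof (rule inj_onI)
    fix x y assume xy: "x \<in> A" "y \<in> A" "\<psi> x - \<psi> p = \<psi> y - \<psi> p"
    have "x \<in> C" "y \<in> C" "\<psi> x = \<psi> y" using xy A by auto
    then have "\<phi> x - \<phi> p = \<phi> y - \<phi> p"
      using isometric_on_eq_iff[OF \<phi> \<psi>, of x y] by simp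
    then show "x = y" using inj_onD[OF inj, of x y] xy(1,2) by simp
  qed
  show "independent ((\<lambda>x. \<psi> x - \<psi> p) ` A)"
    unfolding independent_explicit_module
  proof (intro allI impI)
    fix T u v
    assume T: "finite T" "T \<subseteq> (\<lambda>x. \<psi> x - \<psi> p) ` A" "(\<Sum>v\<in>T. u v *\<^sub>R v) = 0" "v \<in> T"
    obtain I where I: "I \<subseteq> A" "T = (\<lambda>x. \<psi> x - \<psi> p) ` I"
      using T(2) by (elim subset_imageE) auto
    have injI: "inj_on (\<lambda>x. \<psi> x - \<psi> p) I" "inj_on (\<lambda>x. \<phi> x - \<phi> p) I"
      using inj_on_subset[OF inj' I(1)] inj_on_subset[OF inj I(1)] by simp_all
    have finI: "finite I" using T(1) finite_image_iff[OF injI(1)] I(2) by simp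
    obtain i where i: "i \<in> I" "v = \<psi> i - \<psi> p" using T(4) I by auto
    let ?a = "\<lambda>x. u (\<psi> x - \<psi> p)"
    have "(\<Sum>x\<in>I. ?a x *\<^sub>R (\<psi> x - \<psi> p)) = 0"
      using T(3) unfolding I(2) by (simp add: sum.reindex[OF injI(1)])
    moreover have "norm (\<Sum>x\<in>I. ?a x *\<^sub>R (\<phi> x - \<phi> p)) = norm (\<Sum>x\<in>I. ?a x *\<^sub>R (\<psi> x - \<psi> p))"
      using I(1) A by (intro isometric_on_norm_eq[OF \<phi> \<psi> p]) blast
    ultimately have "(\<Sum>x\<in>I. ?a x *\<^sub>R (\<phi> x - \<phi> p)) = 0" by simp
    moreover define w where "w = (\<lambda>v. ?a (the_inv_into I (\<lambda>x. \<phi> x - \<phi> p) v))"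
    ultimately have "(\<Sum>v\<in>(\<lambda>x. \<phi> x - \<phi> p) ` I. w v *\<^sub>R v) = 0"
      by (simp add: sum.reindex[OF injI(2)] the_inv_into_f_f[OF injI(2)])
    then have "w (\<phi> i - \<phi> p) = 0"
      using ind unfolding independent_explicit_module
      using finite_imageI[OF finI, of "\<lambda>x. \<phi> x - \<phi> p"] image_mono[OF I(1), of "\<lambda>x. \<phi> x - \<phi> p"] i(1) by blast
    then show "u v = 0"
      using i by (simp add: w_def the_inv_into_f_f[OF injI(2)])
  qed
qed

lemma dim_isometric_eq:
  fixes \<phi> :: "'z \<Rightarrow> 'b::real_inner" and \<psi> :: "'z \<Rightarrow> 'c::real_inner"
  assumes \<phi>: "isometric_on d C \<phi>" and \<psi>: "isometric_on d C \<psi>"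
  shows "dim {\<phi> x - \<phi> y | x y. x \<in> C \<and> y \<in> C} = dim {\<psi> x - \<psi> y | x y. x \<in> C \<and> y \<in> C}"
proof (cases "C = {}")
  case False
  then obtain p where p: "p \<in> C" by blast
  have pairs: "span {f x - f y | x y. x \<in> C \<and> y \<in> C} = span ((\<lambda>x. f x - f p) ` C)"
    for f :: "'z \<Rightarrow> 'd::real_inner"
  proof (rule span_eq[THEN iffD2], intro conjI)
    have "(f x - f p) - (f y - f p) \<in> span ((\<lambda>x. f x - f p) ` C)" if "x \<in> C" "y \<in> C" for x y
      using that by (intro span_diff span_base) auto
    then show "{f x - f y | x y. x \<in> C \<and> y \<in> C} \<subseteq> span ((\<lambda>x. f x - f p) ` C)" by auto
    show "(\<lambda>x. f x - f p) ` C \<subseteq> span {f x - f y | x y. x \<in> C \<and> y \<in> C}"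
      using p by (auto intro!: span_base)
  qed
  obtain B where B: "B \<subseteq> (\<lambda>x. \<phi> x - \<phi> p) ` C" "independent B" "(\<lambda>x. \<phi> x - \<phi> p) ` C \<subseteq> span B"
    using maximal_independent_subset by blast
  then obtain A where A: "A \<subseteq> C" "B = (\<lambda>x. \<phi> x - \<phi> p) ` A" "inj_on (\<lambda>x. \<phi> x - \<phi> p) A"
    by (metis subset_image_inj)
  note \<psi>A = isometric_on_independent[OF \<phi> \<psi> p A(1,3) B(2)[unfolded A(2)]]
  have spanA: "(\<lambda>x. \<psi> x - \<psi> p) ` C \<subseteq> span ((\<lambda>x. \<psi> x - \<psi> p) ` A)"
  proof (rule image_subsetI, rule ccontr)
    fix x assume x: "x \<in> C" and nin: "\<psi> x - \<psi> p \<notin> span ((\<lambda>x. \<psi> x - \<psi> p) ` A)"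
    have new: "\<psi> x - \<psi> p \<notin> (\<lambda>x. \<psi> x - \<psi> p) ` A"
      using nin by (rule contrapos_nn) (rule span_base)
    have xA: "x \<notin> A"
    proof
      assume "x \<in> A"
      then have "(\<lambda>x. \<psi> x - \<psi> p) x \<in> (\<lambda>x. \<psi> x - \<psi> p) ` A" by (rule imageI)
      then show False using new by simp
    qed
    have sub: "insert x A \<subseteq> C" using x A(1) by simp
    \<comment> \<open>A new independent vector on one side would give one on the other side, where \<open>A\<close> already spans.\<close>
    have inj: "inj_on (\<lambda>x. \<psi> x - \<psi> p) (insert x A)" using \<psi>A(1) new xA by (simp add: inj_on_insert)
    have "independent ((\<lambda>x. \<psi> x - \<psi> p) ` insert x A)"
      unfolding image_insert by (rule independent_insertI[OF nin \<psi>A(2)])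
    note \<phi>A = isometric_on_independent[OF \<psi> \<phi> p sub inj this]
    have "\<phi> x - \<phi> p \<notin> (\<lambda>x. \<phi> x - \<phi> p) ` A" using \<phi>A(1) xA by (simp add: inj_on_insert)
    then have "\<phi> x - \<phi> p \<notin> span B"
      using \<phi>A(2) unfolding image_insert A(2) by (simp add: independent_insert)
    then show False using subsetD[OF B(3) imageI[OF x]] by simp
  qed
  have "dim ((\<lambda>x. \<phi> x - \<phi> p) ` C) = card A"
    using real_vector.dim_unique[OF B(1) B(3) B(2)] A card_image by metis
  moreover have "dim ((\<lambda>x. \<psi> x - \<psi> p) ` C) = card A"
    using real_vector.dim_unique[OF image_mono[OF A(1)] spanA \<psi>A(2)] card_image[OF \<psi>A(1)] by metis
  ultimately show ?thesis
    using arg_cong[OF pairs[of \<phi>], of dim] arg_cong[OF pairs[of \<psi>], of dim] by simp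
qed (simp add: real_vector.dim_eq_card_independent[OF real_vector.independent_empty])


section \<open>The cell structure in an arbitrary isometric embedding\<close>

text \<open>A chart with values in an arbitrary inner product space. Besides the charts themselves, the identity map
  of a polytope that is given as a subset of such a space is an instance.\<close>

definition polytope_embedding :: "('z \<Rightarrow> 'z \<Rightarrow> real) \<Rightarrow> 'z set \<Rightarrow> ('z \<Rightarrow> 'b::real_inner) \<Rightarrow> bool" where
  "polytope_embedding d C \<psi> \<longleftrightarrow> isometric_on d C \<psi> \<and> (\<exists>P. finite P \<and> P \<noteq> {} \<and> \<psi> ` C = convex hull P)"

lemma cell_chart_iff: "cell_chart d C \<phi> \<longleftrightarrow> polytope_embedding d C \<phi>"
  by (simp add: cell_chart_def polytope_embedding_def isometric_on_def)

lemma polytope_embedding_isometric: "polytope_embedding d C \<psi> \<Longrightarrow> isometric_on d C \<psi>"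
  by (simp add: polytope_embedding_def)

lemma polytope_embedding_convex: "polytope_embedding d C \<psi> \<Longrightarrow> convex (\<psi> ` C)"
  by (auto simp: polytope_embedding_def)

lemma convex_cell_metric: "convex_cell d C \<Longrightarrow> Metric_space C d"
  by (simp add: convex_cell_def)

lemma convex_cell_chart:
  assumes "convex_cell d C" obtains \<phi> where "polytope_embedding d C \<phi>" "cell_chart d C \<phi>"
  using assms by (auto simp: convex_cell_def cell_chart_iff)

lemma isometric_on_inj:
  assumes "Metric_space C d" "isometric_on d C \<psi>"
  shows "inj_on \<psi> C"
proof (rule inj_onI)
  fix x y assume "x \<in> C" "y \<in> C" "\<psi> x = \<psi> y"
  then have "d x y = 0" using assms(2) unfolding isometric_on_def by (metis dist_self)
  then show "x = y" using assms(1) \<open>x \<in> C\<close> \<open>y \<in> C\<close> by (simp add: Metric_space.zero)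
qed

lemma convex_cell_nonempty: "convex_cell d C \<Longrightarrow> C \<noteq> {}"
  unfolding convex_cell_def cell_chart_def by (metis convex_hull_eq_empty image_empty)

lemma isometric_on_face_of:
  fixes \<phi> :: "'z \<Rightarrow> 'b::real_inner" and \<psi> :: "'z \<Rightarrow> 'c::real_inner"
  assumes \<phi>: "isometric_on d C \<phi>" and \<psi>: "isometric_on d C \<psi>"
    and F: "F \<subseteq> C" "\<phi> ` F face_of \<phi> ` C"
  shows "\<psi> ` F face_of \<psi> ` C"
  unfolding face_of_def
proof (intro conjI ballI impI)
  show "\<psi> ` F \<subseteq> \<psi> ` C" using F by auto
  show "convex (\<psi> ` F)"
    unfolding convex_alt
  proof (intro ballI allI impI)
    fix a' b' u assume "a' \<in> \<psi> ` F" "b' \<in> \<psi> ` F" and u: "0 \<le> u \<and> u \<le> (1::real)"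
    then obtain a b where ab: "a \<in> F" "b \<in> F" "a' = \<psi> a" "b' = \<psi> b" by auto
    have "(1 - u) *\<^sub>R \<phi> a + u *\<^sub>R \<phi> b \<in> \<phi> ` F"
      using ab u face_of_imp_convex[OF F(2)] unfolding convex_alt by blast
    then obtain x where "x \<in> F" "\<phi> x = (1 - u) *\<^sub>R \<phi> a + u *\<^sub>R \<phi> b" by auto
    then show "(1 - u) *\<^sub>R a' + u *\<^sub>R b' \<in> \<psi> ` F"
      using isometric_on_convex_combination[OF \<phi> \<psi>, of x a b u] ab F(1) by (metis image_eqI subsetD)
  qed
  fix a' b' x' assume "a' \<in> \<psi> ` C" "b' \<in> \<psi> ` C" "x' \<in> \<psi> ` F" and seg: "x' \<in> open_segment a' b'"
  then obtain a b x where x: "a \<in> C" "b \<in> C" "x \<in> F" "a' = \<psi> a" "b' = \<psi> b" "x' = \<psi> x" by auto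
  then have "\<phi> x \<in> open_segment (\<phi> a) (\<phi> b)"
    using isometric_on_open_segment[OF \<psi> \<phi>] seg F(1) by blast
  then have "\<phi> a \<in> \<phi> ` F" "\<phi> b \<in> \<phi> ` F"
    using face_ofD[OF F(2)] x by blast+
  then show "a' \<in> \<psi> ` F" "b' \<in> \<psi> ` F"
    using isometric_on_eq_iff[OF \<phi> \<psi>] x F(1) by (auto simp: image_iff subset_iff)
qed

text \<open>A point near \<open>\<psi> p\<close> in the affine hull of one image has a counterpart near \<open>\<phi> p\<close> in the affine hull of the
  other, with the same affine coefficients.\<close>

lemma isometric_on_rel_interior:
  fixes \<phi> :: "'z \<Rightarrow> 'b::real_inner" and \<psi> :: "'z \<Rightarrow> 'c::real_inner"
  assumes \<phi>: "isometric_on d C \<phi>" and \<psi>: "isometric_on d C \<psi>"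
    and p: "p \<in> C" "\<phi> p \<in> rel_interior (\<phi> ` C)"
  shows "\<psi> p \<in> rel_interior (\<psi> ` C)"
proof -
  obtain e where e: "e > 0" "ball (\<phi> p) e \<inter> affine hull (\<phi> ` C) \<subseteq> \<phi> ` C"
    using p by (auto simp: mem_rel_interior_ball)
  have "z \<in> \<psi> ` C" if z: "dist (\<psi> p) z < e" "z \<in> affine hull (\<psi> ` C)" for z
  proof -
    obtain S u where S: "finite S" "S \<subseteq> \<psi> ` C" "sum u S = 1" "(\<Sum>v\<in>S. u v *\<^sub>R v) = z"
      using z(2) unfolding affine_hull_explicit by auto
    obtain I where I: "I \<subseteq> C" "S = \<psi> ` I" "inj_on \<psi> I"
      using S(2) by (metis subset_image_inj)
    let ?a = "\<lambda>i. u (\<psi> i)"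
    have z': "z = (\<Sum>i\<in>I. ?a i *\<^sub>R \<psi> i)" "sum ?a I = 1"
      using S I(2) by (auto simp: sum.reindex[OF I(3)])
    have fin: "finite I" using S I finite_image_iff by blast
    let ?y = "\<Sum>i\<in>I. ?a i *\<^sub>R \<phi> i"
    have "?y \<in> affine hull (\<phi> ` C)"
      using I(1) fin z'(2) by (intro affine_combination_in[OF affine_affine_hull]) (auto intro: hull_inc)
    moreover have "dist (\<phi> p) ?y < e"
      using isometric_on_affine_norm_eq[OF \<phi> \<psi> p(1), of I "\<lambda>i. i" ?a] I(1) z' z(1)
      by (simp add: dist_norm subset_iff)
    ultimately have "?y \<in> \<phi> ` C" using e(2) by auto
    then obtain x where x: "x \<in> C" "\<phi> x = ?y" by (metis imageE)
    then have "\<psi> x = z"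
      using isometric_on_affine_combination[OF \<phi> \<psi> x(1), of I "\<lambda>i. i" ?a] I(1) z' by auto
    then show ?thesis using x(1) by blast
  qed
  then show ?thesis
    unfolding mem_rel_interior_ball using e(1) p(1) by (auto intro!: exI[of _ e])
qed

lemma isometric_on_convex_hull_image:
  fixes \<phi> :: "'z \<Rightarrow> 'b::real_inner" and \<psi> :: "'z \<Rightarrow> 'c::real_inner"
  assumes \<phi>: "isometric_on d C \<phi>" and \<psi>: "isometric_on d C \<psi>"
    and S: "finite S" "S \<subseteq> C" and p: "p \<in> C" "\<phi> p \<in> convex hull (\<phi> ` S)"
  shows "\<psi> p \<in> convex hull (\<psi> ` S)"
proof -
  obtain a where a: "\<phi> p = (\<Sum>i\<in>S. a i *\<^sub>R \<phi> i)" "\<forall>i\<in>S. 0 \<le> a i" "sum a S = 1"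
    using p(2) unfolding convex_hull_image_finite[OF S(1)] by auto
  have "\<psi> p = (\<Sum>i\<in>S. a i *\<^sub>R \<psi> i)"
    using isometric_on_affine_combination[OF \<phi> \<psi> p(1), of S "\<lambda>i. i" a] a S(2) by auto
  then show ?thesis
    using a unfolding convex_hull_image_finite[OF S(1)] by auto
qed

context
  fixes d :: "'z \<Rightarrow> 'z \<Rightarrow> real" and C :: "'z set" and \<psi> :: "'z \<Rightarrow> 'b::real_inner"
  assumes C: "convex_cell d C" and \<psi>: "polytope_embedding d C \<psi>"
begin

lemma polytope_embedding_inj: "inj_on \<psi> C"
  using isometric_on_inj[OF convex_cell_metric[OF C] polytope_embedding_isometric[OF \<psi>]] .

lemma cell_face_iff: "cell_face d F C \<longleftrightarrow> F \<noteq> {} \<and> F \<subseteq> C \<and> \<psi> ` F face_of \<psi> ` C"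
proof
  assume "cell_face d F C"
  then show "F \<noteq> {} \<and> F \<subseteq> C \<and> \<psi> ` F face_of \<psi> ` C"
    unfolding cell_face_def cell_chart_iff
    using isometric_on_face_of[OF polytope_embedding_isometric polytope_embedding_isometric[OF \<psi>]]
    by blast
next
  assume F: "F \<noteq> {} \<and> F \<subseteq> C \<and> \<psi> ` F face_of \<psi> ` C"
  obtain \<phi> where \<phi>: "polytope_embedding d C \<phi>" "cell_chart d C \<phi>" using convex_cell_chart[OF C] .
  then have "\<phi> ` F face_of \<phi> ` C"
    using isometric_on_face_of[OF polytope_embedding_isometric[OF \<psi>] polytope_embedding_isometric[OF \<phi>(1)]]
      F by blast
  then show "cell_face d F C" using F \<phi>(2) unfolding cell_face_def by blast
qed

lemma cell_vertices_iff: "v \<in> cell_vertices d C \<longleftrightarrow> v \<in> C \<and> \<psi> v extreme_point_of \<psi> ` C"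
  by (auto simp: cell_vertices_def cell_face_iff face_of_singleton)

lemma cell_vertices_image: "\<psi> ` cell_vertices d C = {x. x extreme_point_of \<psi> ` C}"
  by (auto simp: cell_vertices_iff image_iff) (metis cell_vertices_iff extreme_point_of_def imageE)

lemma finite_cell_vertices: "finite (cell_vertices d C)"
proof -
  obtain P where P: "finite P" "\<psi> ` C = convex hull P" using \<psi> by (auto simp: polytope_embedding_def)
  have "\<psi> ` cell_vertices d C \<subseteq> P"
    unfolding cell_vertices_image P(2) using extreme_points_of_convex_hull by blast
  moreover have "inj_on \<psi> (cell_vertices d C)"
    by (rule inj_on_subset[OF polytope_embedding_inj]) (auto simp: cell_vertices_iff)
  ultimately show ?thesis using P(1) by (metis finite_subset finite_image_iff)
qed

lemma cell_vertices_hull: "\<psi> ` C = convex hull (\<psi> ` cell_vertices d C)"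
proof -
  obtain P where P: "finite P" "\<psi> ` C = convex hull P" using \<psi> by (auto simp: polytope_embedding_def)
  show ?thesis unfolding cell_vertices_image P(2) by (rule convex_hull_extreme_points[OF P(1)])
qed

lemma cell_vertices_nonempty: "cell_vertices d C \<noteq> {}"
  using cell_vertices_hull convex_cell_nonempty[OF C] by auto

lemma cell_dim_eq: "cell_dim d C = dim {\<psi> x - \<psi> y | x y. x \<in> C \<and> y \<in> C}"
proof -
  obtain \<phi> where \<phi>: "cell_chart d C \<phi>" using convex_cell_chart[OF C] .
  show ?thesis
    unfolding cell_dim_def
  proof (rule the_equality)
    have eq: "dim {\<phi> x - \<phi> y | x y. x \<in> C \<and> y \<in> C} = dim {\<psi> x - \<psi> y | x y. x \<in> C \<and> y \<in> C}"
      if "cell_chart d C \<phi>" for \<phi>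
      using that unfolding cell_chart_iff
      by (intro dim_isometric_eq[OF polytope_embedding_isometric polytope_embedding_isometric[OF \<psi>]])
    show "\<exists>\<phi>. cell_chart d C \<phi> \<and> dim {\<psi> x - \<psi> y | x y. x \<in> C \<and> y \<in> C} = dim {\<phi> x - \<phi> y | x y. x \<in> C \<and> y \<in> C}"
      using eq[OF \<phi>] \<phi> by (intro exI[of _ \<phi>]) simp
    show "m = dim {\<psi> x - \<psi> y | x y. x \<in> C \<and> y \<in> C}"
      if "\<exists>\<phi>. cell_chart d C \<phi> \<and> m = dim {\<phi> x - \<phi> y | x y. x \<in> C \<and> y \<in> C}" for m
      using that eq by force
  qed
qed

lemma cell_int_iff: "x \<in> cell_int d C \<longleftrightarrow> x \<in> C \<and> \<psi> x \<in> rel_interior (\<psi> ` C)"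
proof -
  obtain \<phi> where \<phi>: "cell_chart d C \<phi>" using convex_cell_chart[OF C] .
  show ?thesis
    unfolding cell_int_def mem_Collect_eq
    using \<phi> isometric_on_rel_interior[OF polytope_embedding_isometric polytope_embedding_isometric[OF \<psi>]]
      isometric_on_rel_interior[OF polytope_embedding_isometric[OF \<psi>] polytope_embedding_isometric]
    unfolding cell_chart_iff by blast
qed

lemma cell_hull_iff:
  assumes "finite S" "S \<subseteq> C"
  shows "x \<in> cell_hull d C S \<longleftrightarrow> x \<in> C \<and> \<psi> x \<in> convex hull (\<psi> ` S)"
proof -
  obtain \<phi> where \<phi>: "cell_chart d C \<phi>" using convex_cell_chart[OF C] .
  show ?thesis
    unfolding cell_hull_def mem_Collect_eq
    using \<phi> isometric_on_convex_hull_image[OF polytope_embedding_isometric polytope_embedding_isometric[OF \<psi>] assms]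
      isometric_on_convex_hull_image[OF polytope_embedding_isometric[OF \<psi>] polytope_embedding_isometric assms]
    unfolding cell_chart_iff by blast
qed

lemma barycenter_eq:
  "barycenter d C \<in> C"
  "\<psi> (barycenter d C) = (\<Sum>v\<in>cell_vertices d C. (1 / real (card (cell_vertices d C))) *\<^sub>R \<psi> v)"
proof -
  let ?V = "cell_vertices d C" and ?m = "1 / real (card (cell_vertices d C))"
  have V: "?V \<subseteq> C" by (auto simp: cell_vertices_iff)
  have m: "(\<Sum>v\<in>?V. ?m) = 1"
    using finite_cell_vertices cell_vertices_nonempty by simp
  have "(\<Sum>v\<in>?V. ?m *\<^sub>R \<psi> v) \<in> \<psi> ` C"
    using m V by (intro convex_sum finite_cell_vertices polytope_embedding_convex[OF \<psi>]) auto
  then obtain b where b: "b \<in> C" "\<psi> b = (\<Sum>v\<in>?V. ?m *\<^sub>R \<psi> v)" by (metis imageE)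
  obtain \<phi> where \<phi>: "cell_chart d C \<phi>" using convex_cell_chart[OF C] .
  have "barycenter d C = b"
    unfolding barycenter_def scaleR_sum_right
  proof (rule the_equality)
    have "\<phi> b = (\<Sum>v\<in>?V. ?m *\<^sub>R \<phi> v)" if "cell_chart d C \<phi>" for \<phi>
      using isometric_on_affine_combination[OF polytope_embedding_isometric[OF \<psi>] polytope_embedding_isometric b(1),
          of \<phi> ?V "\<lambda>v. v" "\<lambda>_. ?m"] that b V m by (auto simp: cell_chart_iff)
    then show "b \<in> C \<and> (\<exists>\<phi>. cell_chart d C \<phi> \<and> \<phi> b = (\<Sum>v\<in>?V. ?m *\<^sub>R \<phi> v))"
      using \<phi> b by blast
    fix b' assume b': "b' \<in> C \<and> (\<exists>\<phi>. cell_chart d C \<phi> \<and> \<phi> b' = (\<Sum>v\<in>?V. ?m *\<^sub>R \<phi> v))"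
    then have "\<psi> b' = (\<Sum>v\<in>?V. ?m *\<^sub>R \<psi> v)"
      using isometric_on_affine_combination[OF polytope_embedding_isometric polytope_embedding_isometric[OF \<psi>],
          of _ b' ?V "\<lambda>v. v" "\<lambda>_. ?m"] V m by (auto simp: cell_chart_iff)
    then show "b' = b"
      using b b' polytope_embedding_inj by (metis inj_onD)
  qed
  then show "barycenter d C \<in> C" "\<psi> (barycenter d C) = (\<Sum>v\<in>?V. ?m *\<^sub>R \<psi> v)" using b by auto
qed

lemma polytope_embedding_face:
  assumes "cell_face d F C"
  shows "polytope_embedding d F \<psi>"
proof -
  obtain P where P: "finite P" "\<psi> ` C = convex hull P" using \<psi> by (auto simp: polytope_embedding_def)
  have F: "F \<noteq> {}" "F \<subseteq> C" "\<psi> ` F face_of convex hull P" using assms P by (auto simp: cell_face_iff)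
  have "\<psi> ` F = convex hull (\<psi> ` F \<inter> P)" by (rule face_of_convex_hull_eq[OF P(1) F(3)])
  moreover have "\<psi> ` F \<inter> P \<noteq> {}" using F(1) calculation by (metis convex_hull_eq_empty image_is_empty)
  ultimately show ?thesis
    unfolding polytope_embedding_def
    using isometric_on_subset[OF polytope_embedding_isometric[OF \<psi>] F(2)] P(1) by (metis finite_Int)
qed

lemma finite_cell_faces: "finite {F. cell_face d F C}"
proof -
  obtain P where P: "finite P" "\<psi> ` C = convex hull P" using \<psi> by (auto simp: polytope_embedding_def)
  have "(\<lambda>F. \<psi> ` F \<inter> P) ` {F. cell_face d F C} \<subseteq> Pow P" by auto
  then have "finite ((\<lambda>F. \<psi> ` F \<inter> P) ` {F. cell_face d F C})" using P(1) finite_subset by blast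
  moreover have "inj_on (\<lambda>F. \<psi> ` F \<inter> P) {F. cell_face d F C}"
  proof (rule inj_onI)
    fix F G assume "F \<in> {F. cell_face d F C}" "G \<in> {F. cell_face d F C}" "\<psi> ` F \<inter> P = \<psi> ` G \<inter> P"
    then have "\<psi> ` F = \<psi> ` G" "F \<subseteq> C" "G \<subseteq> C"
      using face_of_convex_hull_eq[OF P(1), of "\<psi> ` F"] face_of_convex_hull_eq[OF P(1), of "\<psi> ` G"] P(2)
      by (auto simp: cell_face_iff)
    then show "F = G" using polytope_embedding_inj by (metis inj_on_image_eq_iff)
  qed
  ultimately show ?thesis using finite_image_iff by blast
qed

end

lemma cell_face_subset: "cell_face d F C \<Longrightarrow> F \<subseteq> C" and cell_face_nonempty: "cell_face d F C \<Longrightarrow> F \<noteq> {}"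
  by (auto simp: cell_face_def)

lemma convex_cell_face:
  assumes "convex_cell d C" "cell_face d F C"
  shows "convex_cell d F"
proof -
  obtain \<phi> where \<phi>: "polytope_embedding d C \<phi>" "cell_chart d C \<phi>" using convex_cell_chart[OF assms(1)] .
  have "Metric_space F d"
    using Metric_space.subspace[OF convex_cell_metric[OF assms(1)] cell_face_subset[OF assms(2)]] .
  then show ?thesis
    using polytope_embedding_face[OF assms(1) \<phi>(1) assms(2)] by (auto simp: convex_cell_def cell_chart_iff)
qed

lemma cell_face_refl: "convex_cell d C \<Longrightarrow> cell_face d C C"
  by (metis cell_face_iff convex_cell_chart convex_cell_nonempty face_of_refl order_refl polytope_embedding_convex)

lemma cell_face_trans:
  assumes C: "convex_cell d C" and "cell_face d F C" "cell_face d G F"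
  shows "cell_face d G C"
proof -
  obtain \<phi> where \<phi>: "polytope_embedding d C \<phi>" "cell_chart d C \<phi>" using convex_cell_chart[OF C] .
  have "\<phi> ` G face_of \<phi> ` F" "\<phi> ` F face_of \<phi> ` C" "G \<noteq> {}" "G \<subseteq> F" "F \<subseteq> C"
    using cell_face_iff[OF C \<phi>(1)] assms
      cell_face_iff[OF convex_cell_face[OF C assms(2)] polytope_embedding_face[OF C \<phi>(1) assms(2)]] by auto
  then show ?thesis
    using cell_face_iff[OF C \<phi>(1), of G] face_of_trans by blast
qed

section \<open>Coverings and multiplicities\<close>

lemma ediam_le_iff:
  assumes "0 \<le> D" "\<And>x y. x \<in> B \<Longrightarrow> y \<in> B \<Longrightarrow> 0 \<le> d x y"
  shows "ediam d B \<le> ennreal D \<longleftrightarrow> (\<forall>x\<in>B. \<forall>y\<in>B. d x y \<le> D)"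
  using assms by (auto simp: ediam_def SUP_le_iff)

lemma ediam_mono: "A \<subseteq> B \<Longrightarrow> ediam d A \<le> ediam d B"
  unfolding ediam_def by (rule SUP_subset_mono) auto

text \<open>The infimum that defines the multiplicity is attained because it is taken over natural numbers.\<close>

lemma multiplicity_at_scale_le_iff:
  "multiplicity_at_scale X d s I B \<le> enat m \<longleftrightarrow>
     (\<forall>S\<subseteq>X. ediam d S \<le> ennreal s \<longrightarrow>
        finite {i\<in>I. B i \<inter> S \<noteq> {}} \<and> card {i\<in>I. B i \<inter> S \<noteq> {}} \<le> m)" (is "?L \<longleftrightarrow> ?Q m")
proof
  assume L: ?L
  let ?A = "{enat n | n. ?Q n}"
  have "?A \<noteq> {}"
  proof
    assume "?A = {}"
    then have "multiplicity_at_scale X d s I B = Inf {}" unfolding multiplicity_at_scale_def by (rule arg_cong)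
    then show False using L by (simp add: Inf_enat_def)
  qed
  then have "Inf ?A \<in> ?A"
    unfolding Inf_enat_def using LeastI_ex[of "\<lambda>x. x \<in> ?A"] by (metis (lifting) ex_in_conv)
  then obtain k where k: "multiplicity_at_scale X d s I B = enat k" "?Q k"
    unfolding multiplicity_at_scale_def by blast
  then have "k \<le> m" using L by simp
  then show "?Q m" using k(2) order_trans by blast
next
  assume "?Q m"
  then show ?L unfolding multiplicity_at_scale_def by (intro Inf_lower) blast
qed

lemma ereal_of_enat_le_nat_iff: "ereal_of_enat x \<le> ereal (real m) \<longleftrightarrow> x \<le> enat m"
  by (cases x) auto

lemma nagata_property_nat_iff:
  "nagata_property X d (int n) \<longleftrightarrow>
     (\<exists>c>0. \<forall>s>0. \<exists>\<B>. covering X \<B> \<and> bounded_family d (c * s) \<B> (\<lambda>B. B) \<and>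
        multiplicity_at_scale X d s \<B> (\<lambda>B. B) \<le> enat (n + 1))"
proof -
  have *: "real_of_int (int n + 1) = real (n + 1)" by simp
  show ?thesis unfolding nagata_property_def * ereal_of_enat_le_nat_iff by (rule refl)
qed

lemma nagata_property_mono:
  assumes "nagata_property X d k" "k \<le> l"
  shows "nagata_property X d l"
proof -
  have "ereal (real_of_int (k + 1)) \<le> ereal (real_of_int (l + 1))" using assms(2) by simp
  then show ?thesis using assms(1) unfolding nagata_property_def by (meson order_trans)
qed

lemma nagata_dim_le_iff: "nagata_dim X d \<le> ereal (real n) \<longleftrightarrow> nagata_property X d (int n)"
proof
  assume "nagata_property X d (int n)"
  then show "nagata_dim X d \<le> ereal (real n)"
    unfolding nagata_dim_def by (intro Inf_lower) (auto intro!: exI[of _ "int n"])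
next
  assume *: "nagata_dim X d \<le> ereal (real n)"
  show "nagata_property X d (int n)"
  proof (rule ccontr)
    assume not: "\<not> nagata_property X d (int n)"
    \<comment> \<open>The infimum ranges over integers, so a value above \<open>n\<close> is at least \<open>n + 1\<close>.\<close>
    have "ereal (real n + 1) \<le> nagata_dim X d"
      unfolding nagata_dim_def
    proof (rule Inf_greatest)
      fix y assume "y \<in> {ereal (real_of_int k) | k. nagata_property X d k}"
      then obtain k where k: "y = ereal (real_of_int k)" "nagata_property X d k" by auto
      then have "k > int n" using nagata_property_mono not by (metis not_le)
      then have "real n + 1 \<le> real_of_int k" by linarith
      then show "ereal (real n + 1) \<le> y" using k by simp
    qed
    then have "ereal (real n + 1) \<le> ereal (real n)" using * by (rule order_trans)
    then show False by simp
  qed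
qed

lemma separated_coverings_imp_nagata:
  assumes "separated_coverings X d n"
  shows "nagata_property X d (int n)"
proof -
  obtain c where c: "c > 0" and ex: "\<forall>s>0. \<exists>\<B> \<B>\<^sub>k. covering X \<B> \<and> bounded_family d (c * s) \<B> (\<lambda>B. B) \<and>
        \<B> = (\<Union>k\<in>{0..n}. \<B>\<^sub>k k) \<and>
        (\<forall>k\<in>{0..n}. multiplicity_at_scale X d s (\<B>\<^sub>k k) (\<lambda>B. B) \<le> 1)"
    using assms unfolding separated_coverings_def by blast
  show ?thesis
    unfolding nagata_property_nat_iff
  proof (rule exI[of _ c], intro conjI allI impI)
    fix s :: real assume "s > 0"
    then obtain \<B> \<B>\<^sub>k where B: "covering X \<B>" "bounded_family d (c * s) \<B> (\<lambda>B. B)"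
      "\<B> = (\<Union>k\<in>{0..n}. \<B>\<^sub>k k)" and m: "\<And>k. k \<in> {0..n} \<Longrightarrow> multiplicity_at_scale X d s (\<B>\<^sub>k k) (\<lambda>B. B) \<le> enat 1"
      using ex unfolding one_enat_def by blast
    have "finite {i \<in> \<B>. i \<inter> S \<noteq> {}} \<and> card {i \<in> \<B>. i \<inter> S \<noteq> {}} \<le> n + 1"
      if S: "S \<subseteq> X" "ediam d S \<le> ennreal s" for S
    proof -
      let ?A = "\<lambda>k. {i \<in> \<B>\<^sub>k k. i \<inter> S \<noteq> {}}"
      have k: "finite (?A k)" "card (?A k) \<le> 1" if "k \<in> {0..n}" for k
        using m[OF that] S unfolding multiplicity_at_scale_le_iff by blast+
      have eq: "{i \<in> \<B>. i \<inter> S \<noteq> {}} = (\<Union>k\<in>{0..n}. ?A k)" using B(3) by auto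
      have "card (\<Union>k\<in>{0..n}. ?A k) \<le> (\<Sum>k\<in>{0..n}. card (?A k))" by (rule card_UN_le) simp
      also have "\<dots> \<le> (\<Sum>k\<in>{0..n}. 1)" using k(2) by (rule sum_mono)
      finally show ?thesis unfolding eq using k(1) by (intro conjI finite_UN_I) auto
    qed
    then show "\<exists>\<B>. covering X \<B> \<and> bounded_family d (c * s) \<B> (\<lambda>B. B) \<and>
        multiplicity_at_scale X d s \<B> (\<lambda>B. B) \<le> enat (n + 1)"
      unfolding multiplicity_at_scale_le_iff using B by blast
  qed (rule c)
qed


section \<open>Barycentric flags in a polyhedral complex\<close>

lemma cell_int_face_eq:
  assumes C: "convex_cell d C" and p: "p \<in> cell_int d C" and F: "cell_face d F C" "p \<in> F"
  shows "F = C"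
proof -
  obtain \<phi> where \<phi>: "polytope_embedding d C \<phi>" "cell_chart d C \<phi>" using convex_cell_chart[OF C] .
  have "\<phi> p \<in> rel_interior (\<phi> ` C)" "p \<in> C" using p cell_int_iff[OF C \<phi>(1)] by auto
  moreover have "\<phi> ` F face_of \<phi> ` C" "F \<subseteq> C" using F cell_face_iff[OF C \<phi>(1)] by auto
  ultimately have "\<phi> ` C \<subseteq> \<phi> ` F"
    using subset_of_face_of[of "\<phi> ` F" "\<phi> ` C" "\<phi> ` C"] F(2) by blast
  then show ?thesis
    using \<open>F \<subseteq> C\<close> polytope_embedding_inj[OF C \<phi>(1)] by (metis image_mono inj_on_image_eq_iff order_refl subset_antisym)
qed

text \<open>All vertices occur in the barycenter with positive weight.\<close>

lemma barycenter_face_eq: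
  assumes C: "convex_cell d C" and F: "cell_face d F C" "barycenter d C \<in> F"
  shows "F = C"
proof -
  obtain \<phi> where \<phi>: "polytope_embedding d C \<phi>" "cell_chart d C \<phi>" using convex_cell_chart[OF C] .
  let ?V = "cell_vertices d C" and ?m = "1 / real (card (cell_vertices d C))"
  note fin = finite_cell_vertices[OF C \<phi>(1)] and ne = cell_vertices_nonempty[OF C \<phi>(1)]
  have f: "\<phi> ` F face_of \<phi> ` C" "F \<subseteq> C" using F cell_face_iff[OF C \<phi>(1)] by auto
  have "\<phi> v \<in> \<phi> ` F" if "v \<in> ?V" for v
  proof (rule face_of_convex_sum[OF f(1) polytope_embedding_convex[OF \<phi>(1)] fin])
    show "(\<Sum>v\<in>?V. ?m) = 1" using fin ne by simp
    show "(\<Sum>v\<in>?V. ?m *\<^sub>R \<phi> v) \<in> \<phi> ` F"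
      using F(2) barycenter_eq(2)[OF C \<phi>(1)] by (metis imageI)
    show "0 < ?m" using fin ne by (simp add: card_gt_0_iff)
  qed (use that cell_vertices_iff[OF C \<phi>(1)] in auto)
  then have "\<phi> ` C \<subseteq> \<phi> ` F"
    unfolding cell_vertices_hull[OF C \<phi>(1)] by (intro hull_minimal face_of_imp_convex[OF f(1)]) auto
  then show ?thesis
    using f(2) polytope_embedding_inj[OF C \<phi>(1)] by (metis image_mono inj_on_image_eq_iff order_refl subset_antisym)
qed

locale poly_complex =
  fixes Z :: "'z set" and d :: "'z \<Rightarrow> 'z \<Rightarrow> real" and \<C> :: "'z set set"
  assumes complex: "polyhedral_complex Z d \<C>"
begin

lemma metric: "Metric_space Z d"
  using complex unfolding polyhedral_complex_def by (elim conjE)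

lemma covers: "\<Union>\<C> = Z"
  using complex unfolding polyhedral_complex_def by (elim conjE)

lemma cell: "C \<in> \<C> \<Longrightarrow> convex_cell d C"
  using complex unfolding polyhedral_complex_def by (elim conjE) (erule bspec)

lemma face_mem: "C \<in> \<C> \<Longrightarrow> cell_face d F C \<Longrightarrow> F \<in> \<C>"
  using complex unfolding polyhedral_complex_def by meson

lemma Int_face: "C \<in> \<C> \<Longrightarrow> D \<in> \<C> \<Longrightarrow> C \<inter> D \<noteq> {} \<Longrightarrow> cell_face d (C \<inter> D) C \<and> cell_face d (C \<inter> D) D"
  using complex unfolding polyhedral_complex_def by meson

lemma subset_imp_face: "C \<in> \<C> \<Longrightarrow> D \<in> \<C> \<Longrightarrow> C \<subseteq> D \<Longrightarrow> cell_face d C D"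
  using Int_face[of C D] convex_cell_nonempty[OF cell] by (auto simp: Int_absorb2)

lemma bary_mem: "C \<in> \<C> \<Longrightarrow> barycenter d C \<in> C"
  using barycenter_eq(1) cell convex_cell_chart by metis

lemma bary_mem_imp_subset: "C \<in> \<C> \<Longrightarrow> D \<in> \<C> \<Longrightarrow> barycenter d C \<in> D \<Longrightarrow> C \<subseteq> D"
  using barycenter_face_eq[OF cell, of C "C \<inter> D"] Int_face[of C D] bary_mem[of C] by blast

text \<open>A point in the interior of \<open>C\<close> is in no proper face of \<open>C\<close>, in particular not in \<open>C \<inter> D\<close> if that is one.\<close>

lemma cell_int_imp_subset: "C \<in> \<C> \<Longrightarrow> D \<in> \<C> \<Longrightarrow> p \<in> cell_int d C \<Longrightarrow> p \<in> D \<Longrightarrow> C \<subseteq> D"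
  using cell_int_face_eq[OF cell, of C p "C \<inter> D"] Int_face[of C D] by (auto simp: cell_int_def)

lemma vertex_mem: "v \<in> complex_vertices d \<C> \<Longrightarrow> {v} \<in> \<C>"
  unfolding complex_vertices_def cell_vertices_def using face_mem by blast

lemma vertex_of_cell: "v \<in> complex_vertices d \<C> \<Longrightarrow> C \<in> \<C> \<Longrightarrow> v \<in> C \<Longrightarrow> v \<in> cell_vertices d C"
  unfolding cell_vertices_def using subset_imp_face[OF vertex_mem] by auto

definition flag_weights :: "('z \<Rightarrow> nat eucl) \<Rightarrow> 'z set set \<Rightarrow> 'z \<Rightarrow> ('z set \<Rightarrow> real) \<Rightarrow> bool" where
  "flag_weights \<phi> \<F> p a \<longleftrightarrow>
     (\<forall>F\<in>\<F>. 0 < a F) \<and> sum a \<F> = 1 \<and> \<phi> p = (\<Sum>F\<in>\<F>. a F *\<^sub>R \<phi> (barycenter d F))"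

text \<open>The point is interior to the simplex spanned by the barycenters of the flag. The chart is that of the largest
  member, which contains all the barycenters; by \<open>in_flagE\<close> every other chart of it serves as well.\<close>

definition in_flag :: "'z \<Rightarrow> 'z set set \<Rightarrow> bool" where
  "in_flag p \<F> \<longleftrightarrow> finite \<F> \<and> subset.chain \<C> \<F> \<and>
     (\<exists>D\<in>\<F>. (\<forall>F\<in>\<F>. F \<subseteq> D) \<and> p \<in> D \<and> (\<exists>\<phi> a. cell_chart d D \<phi> \<and> flag_weights \<phi> \<F> p a))"

lemma in_flagE:
  assumes "in_flag p \<F>"
  obtains D where "D \<in> \<F>" "D \<in> \<C>" "\<And>F. F \<in> \<F> \<Longrightarrow> F \<subseteq> D" "\<And>F. F \<in> \<F> \<Longrightarrow> F \<in> \<C>" "finite \<F>" "p \<in> D"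
    "\<And>\<phi>::'z \<Rightarrow> nat eucl. cell_chart d D \<phi> \<Longrightarrow> \<exists>a. flag_weights \<phi> \<F> p a"
proof -
  have F: "finite \<F>" "\<F> \<subseteq> \<C>" using assms by (simp_all add: in_flag_def subset.chain_def)
  obtain D where D0: "D \<in> \<F>" "(\<forall>F\<in>\<F>. F \<subseteq> D) \<and> p \<in> D \<and> (\<exists>\<phi> a. cell_chart d D \<phi> \<and> flag_weights \<phi> \<F> p a)"
    using assms unfolding in_flag_def by (elim conjE bexE) (rule that, simp_all)
  then obtain \<phi> a where D: "D \<in> \<F>" "\<forall>F\<in>\<F>. F \<subseteq> D" "p \<in> D" "cell_chart d D \<phi>"
    "\<forall>F\<in>\<F>. 0 < a F" "sum a \<F> = 1" "\<phi> p = (\<Sum>F\<in>\<F>. a F *\<^sub>R \<phi> (barycenter d F))"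
    unfolding flag_weights_def by (elim conjE exE) (rule that)
  have b: "barycenter d G \<in> D" if "G \<in> \<F>" for G using that D(2) F(2) bary_mem by blast
  have "\<psi> p = (\<Sum>F\<in>\<F>. a F *\<^sub>R \<psi> (barycenter d F))" if "cell_chart d D \<psi>" for \<psi>
    using that D(4) b unfolding cell_chart_iff
    by (intro isometric_on_affine_combination[OF polytope_embedding_isometric[of d D \<phi>]
          polytope_embedding_isometric[of d D \<psi>] D(3) _ D(6,7)])
  then show thesis
    using D F by (intro that[OF D(1) _ _ _ F(1) D(3)] exI[of _ a]) (auto simp: flag_weights_def)
qed

text \<open>The barycenter of the top member \<open>D\<close> has positive weight, so that \<open>p\<close> is in no proper face of \<open>D\<close>.\<close>

lemma in_flag_top_minimal:
  assumes p: "in_flag p \<F>" and D: "D \<in> \<F>" "\<And>F. F \<in> \<F> \<Longrightarrow> F \<subseteq> D" and E: "E \<in> \<C>" "p \<in> E"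
  shows "D \<subseteq> E"
proof -
  obtain D' where D': "D' \<in> \<F>" "D' \<in> \<C>" "\<And>F. F \<in> \<F> \<Longrightarrow> F \<subseteq> D'" "\<And>F. F \<in> \<F> \<Longrightarrow> F \<in> \<C>" "finite \<F>" "p \<in> D'"
    "\<And>\<phi>::'z \<Rightarrow> nat eucl. cell_chart d D' \<phi> \<Longrightarrow> \<exists>a. flag_weights \<phi> \<F> p a"
    by (rule in_flagE[OF p]) (rule that)
  have [simp]: "D' = D" using D D' by blast
  have C: "convex_cell d D" using D'(2) cell by simp
  obtain \<phi> where \<phi>: "polytope_embedding d D \<phi>" "cell_chart d D \<phi>" using convex_cell_chart[OF C] .
  obtain a where a: "\<forall>F\<in>\<F>. 0 < a F" "sum a \<F> = 1" "\<phi> p = (\<Sum>F\<in>\<F>. a F *\<^sub>R \<phi> (barycenter d F))"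
    using D'(7) \<phi>(2) unfolding flag_weights_def by auto
  have f: "cell_face d (D \<inter> E) D" using Int_face[of D E] D'(2,6) E by auto
  then have "\<phi> ` (D \<inter> E) face_of \<phi> ` D" using cell_face_iff[OF C \<phi>(1)] by blast
  then have "\<phi> (barycenter d D) \<in> \<phi> ` (D \<inter> E)"
  proof (rule face_of_convex_sum[OF _ polytope_embedding_convex[OF \<phi>(1)] D'(5) _ a(2)])
    show "(\<Sum>F\<in>\<F>. a F *\<^sub>R \<phi> (barycenter d F)) \<in> \<phi> ` (D \<inter> E)"
      using a(3) D'(6) E by (metis IntI \<open>D' = D\<close> imageI)
    show "0 \<le> a F" if "F \<in> \<F>" for F using a(1) that by (simp add: less_imp_le)
    show "\<phi> (barycenter d F) \<in> \<phi> ` D" if "F \<in> \<F>" for F using that bary_mem D(2) D'(4) by blast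
  qed (use a D in auto)
  then have "barycenter d D \<in> D \<inter> E"
    using polytope_embedding_inj[OF C \<phi>(1)] bary_mem[of D] D'(2) by (auto dest: inj_onD)
  then show ?thesis using barycenter_face_eq[OF C f] by blast
qed

text \<open>Projecting \<open>p\<close> from the barycenter of the top member yields a point of a proper face that lies inside the
  remaining flag. This is the induction step for uniqueness.\<close>

lemma flag_split:
  assumes D: "D \<in> \<C>" and \<phi>: "polytope_embedding d D (\<phi> :: 'z \<Rightarrow> nat eucl)"
    and H: "in_flag p \<H>" "D \<in> \<H>" "\<And>F. F \<in> \<H> \<Longrightarrow> F \<subseteq> D" "\<H> \<noteq> {D}"
    and h: "\<forall>F\<in>\<H>. 0 < h F" "sum h \<H> = 1" "\<phi> p = (\<Sum>F\<in>\<H>. h F *\<^sub>R \<phi> (barycenter d F))"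
  obtains q G where "q \<in> G" "G \<in> \<C>" "G \<subset> D" "\<phi> p = h D *\<^sub>R \<phi> (barycenter d D) + (1 - h D) *\<^sub>R \<phi> q"
    "h D < 1" "in_flag q (\<H> - {D})"
proof -
  let ?H = "\<H> - {D}" and ?G = "\<Union>(\<H> - {D})"
  have fin: "finite \<H>" and ch: "subset.chain \<C> \<H>" using H(1) by (simp_all add: in_flag_def)
  have ch': "subset.chain \<C> ?H" using ch by (auto simp: subset.chain_def)
  have ne: "?H \<noteq> {}" "finite ?H" using H(2,4) fin by auto
  have G: "?G \<in> ?H" using ne ch' by (intro Union_in_chain)
  have GC: "?G \<in> \<C>" using G ch' unfolding subset.chain_def by (meson subsetD)
  have Gsub: "?G \<subseteq> D" "?G \<noteq> D" using G H(3) by (blast, metis DiffD2 singletonI)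
  have face: "cell_face d ?G D" using subset_imp_face[OF GC D Gsub(1)] .
  have "sum h ?H > 0" using h(1) ne by (intro sum_pos) auto
  then have hD: "h D < 1" using h(2) fin H(2) by (simp add: sum_diff1)
  have cG: "polytope_embedding d ?G \<phi>" using polytope_embedding_face[OF cell[OF D] \<phi> face] .
  have rest: "sum h ?H = 1 - h D" using h(2) fin H(2) by (simp add: sum_diff1)
  define k where "k F = h F / (1 - h D)" for F
  have k1: "\<forall>F\<in>?H. 0 < k F" using h(1) hD by (simp add: k_def)
  have k2: "sum k ?H = 1" using rest hD by (simp add: k_def flip: sum_divide_distrib)
  have bG: "\<phi> (barycenter d F) \<in> \<phi> ` ?G" if "F \<in> ?H" for F
    using that ch' bary_mem[of F] unfolding subset.chain_def by blast
  have "(\<Sum>F\<in>?H. k F *\<^sub>R \<phi> (barycenter d F)) \<in> \<phi> ` ?G"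
    by (rule convex_sum[OF ne(2) polytope_embedding_convex[OF cG] k2 _ bG])
      (use k1 in \<open>auto simp: less_imp_le\<close>)
  then obtain q where q: "q \<in> ?G" "\<phi> q = (\<Sum>F\<in>?H. k F *\<^sub>R \<phi> (barycenter d F))"
    by (rule imageE, intro that) (assumption, erule sym)
  have "(1 - h D) *\<^sub>R \<phi> q = (\<Sum>F\<in>?H. h F *\<^sub>R \<phi> (barycenter d F))"
    using hD by (simp add: q(2) k_def scaleR_sum_right)
  then have "\<phi> p = h D *\<^sub>R \<phi> (barycenter d D) + (1 - h D) *\<^sub>R \<phi> q"
    using h(3) fin H(2) by (simp add: sum.remove[of \<H> D])
  moreover have "in_flag q ?H"
    unfolding in_flag_def flag_weights_def using ne(2) ch' G q k1 k2 cG[folded cell_chart_iff]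
    by (intro conjI bexI[of _ ?G] exI[of _ \<phi>] exI[of _ k]) auto
  moreover have "?G \<subset> D" using Gsub by (rule psubsetI)
  ultimately show thesis by (intro that[OF q(1) GC _ _ hD])
qed

text \<open>If \<open>u\<close> were larger than \<open>t\<close>, then \<open>q\<close> would be a convex combination of the barycenter of \<open>D\<close>, with positive
  weight, and \<open>r\<close>; the face containing \<open>q\<close> would then contain the barycenter.\<close>

lemma top_weight_le:
  assumes D: "D \<in> \<C>" and \<phi>: "polytope_embedding d D (\<phi> :: 'z \<Rightarrow> nat eucl)"
    and q: "q \<in> G" "G \<in> \<C>" "G \<subset> D" "\<phi> p = t *\<^sub>R \<phi> (barycenter d D) + (1 - t) *\<^sub>R \<phi> q"
    and r: "r \<in> D" "\<phi> p = u *\<^sub>R \<phi> (barycenter d D) + (1 - u) *\<^sub>R \<phi> r" "u \<le> 1"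
  shows "u \<le> t"
proof (rule ccontr)
  assume "\<not> u \<le> t"
  then have tu: "t < u" "1 - t > 0" using r(3) by auto
  \<comment> \<open>A combination of two points, indexed by truth values.\<close>
  let ?w = "\<lambda>i. if i then (u - t) / (1 - t) else (1 - u) / (1 - t)"
  let ?x = "\<lambda>i. if i then barycenter d D else r"
  have "t *\<^sub>R \<phi> (barycenter d D) + (1 - t) *\<^sub>R \<phi> q = u *\<^sub>R \<phi> (barycenter d D) + (1 - u) *\<^sub>R \<phi> r"
    using q(4) r(2) by simp
  then have "(1 - t) *\<^sub>R \<phi> q = (u - t) *\<^sub>R \<phi> (barycenter d D) + (1 - u) *\<^sub>R \<phi> r"
    by (simp add: algebra_simps)
  then have "(1 / (1 - t)) *\<^sub>R ((1 - t) *\<^sub>R \<phi> q) = (1 / (1 - t)) *\<^sub>R ((u - t) *\<^sub>R \<phi> (barycenter d D) + (1 - u) *\<^sub>R \<phi> r)"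
    by (rule arg_cong)
  then have eq: "\<phi> q = (\<Sum>i\<in>UNIV. ?w i *\<^sub>R \<phi> (?x i))"
    using tu by (simp add: UNIV_bool scaleR_add_right)
  have face: "cell_face d G D" using subset_imp_face[OF q(2) D] q(3) by (simp add: psubset_imp_subset)
  have f: "\<phi> ` G face_of \<phi> ` D" "G \<subseteq> D" using face cell_face_iff[OF cell[OF D] \<phi>] by simp_all
  have "\<phi> (?x True) \<in> \<phi> ` G"
  proof (rule face_of_convex_sum[OF f(1) polytope_embedding_convex[OF \<phi>],
        where I = UNIV and a = ?w and x = "\<lambda>i. \<phi> (?x i)" and j = True])
    show "sum ?w UNIV = 1" using tu by (simp add: UNIV_bool flip: add_divide_distrib)
    show "(\<Sum>i\<in>UNIV. ?w i *\<^sub>R \<phi> (?x i)) \<in> \<phi> ` G" unfolding eq[symmetric] using q(1) by (rule imageI)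
    show "0 \<le> ?w i" for i using tu r(3) by simp
    show "\<phi> (?x i) \<in> \<phi> ` D" for i using r(1) bary_mem[OF D] by simp
    show "0 < ?w True" using tu by simp
  qed auto
  then obtain g where g: "g \<in> G" "\<phi> (barycenter d D) = \<phi> g" by auto
  then have "barycenter d D = g"
    using inj_onD[OF polytope_embedding_inj[OF cell[OF D] \<phi>]] bary_mem[OF D] f(2) by blast
  then have "G = D" using barycenter_face_eq[OF cell[OF D] face] g(1) by simp
  then show False using q(3) by simp
qed

text \<open>The top member is the smallest cell containing \<open>p\<close>, its weight is determined by comparison in both
  directions, and hence so is the projected point; induction on the length of the flag does the rest.\<close>

lemma in_flag_unique: "in_flag p \<F> \<Longrightarrow> in_flag p \<G> \<Longrightarrow> \<F> = \<G>"
proof (induction "card \<F>" arbitrary: p \<F> \<G> rule: less_induct)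
  case less
  obtain D where D: "D \<in> \<F>" "D \<in> \<C>" "\<And>F. F \<in> \<F> \<Longrightarrow> F \<subseteq> D" "\<And>F. F \<in> \<F> \<Longrightarrow> F \<in> \<C>" "finite \<F>" "p \<in> D"
    "\<And>\<phi>::'z \<Rightarrow> nat eucl. cell_chart d D \<phi> \<Longrightarrow> \<exists>a. flag_weights \<phi> \<F> p a"
    by (rule in_flagE[OF less.prems(1)]) (rule that)
  obtain E where E: "E \<in> \<G>" "E \<in> \<C>" "\<And>F. F \<in> \<G> \<Longrightarrow> F \<subseteq> E" "\<And>F. F \<in> \<G> \<Longrightarrow> F \<in> \<C>" "finite \<G>" "p \<in> E"
    "\<And>\<phi>::'z \<Rightarrow> nat eucl. cell_chart d E \<phi> \<Longrightarrow> \<exists>a. flag_weights \<phi> \<G> p a"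
    by (rule in_flagE[OF less.prems(2)]) (rule that)
  have ED: "E = D"
    using in_flag_top_minimal[OF less.prems(1) D(1,3) E(2,6)] in_flag_top_minimal[OF less.prems(2) E(1,3) D(2,6)]
    by (rule subset_antisym[rotated])
  obtain \<phi> where \<phi>: "polytope_embedding d D \<phi>" "cell_chart d D \<phi>" using convex_cell_chart[OF cell[OF D(2)]] .
  obtain a where a: "\<forall>F\<in>\<F>. 0 < a F" "sum a \<F> = 1" "\<phi> p = (\<Sum>F\<in>\<F>. a F *\<^sub>R \<phi> (barycenter d F))"
    using D(7)[OF \<phi>(2)] unfolding flag_weights_def by (elim exE conjE)
  obtain b where b: "\<forall>F\<in>\<G>. 0 < b F" "sum b \<G> = 1" "\<phi> p = (\<Sum>F\<in>\<G>. b F *\<^sub>R \<phi> (barycenter d F))"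
    using E(7)[unfolded ED, OF \<phi>(2)] unfolding flag_weights_def by (elim exE conjE)
  have bD: "barycenter d D \<in> D" using bary_mem[OF D(2)] .
  have DG: "D \<in> \<G>" and Gle: "\<And>F. F \<in> \<G> \<Longrightarrow> F \<subseteq> D" using E(1,3) ED by auto
  note splitF = flag_split[OF D(2) \<phi>(1) less.prems(1) D(1,3) _ a]
  note splitG = flag_split[OF D(2) \<phi>(1) less.prems(2) DG Gle _ b]
  have single: "p = barycenter d D \<Longrightarrow> \<phi> p = 1 *\<^sub>R \<phi> (barycenter d D) + (1 - 1) *\<^sub>R \<phi> (barycenter d D)"
    by simp
  have pb: "p = barycenter d D" if "sum h {D} = 1" "\<phi> p = (\<Sum>F\<in>{D}. h F *\<^sub>R \<phi> (barycenter d F))" for h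
  proof -
    have "\<phi> p = \<phi> (barycenter d D)" using that by simp
    then show ?thesis
      using inj_onD[OF polytope_embedding_inj[OF cell[OF D(2)] \<phi>(1)]] D(6) bD by blast
  qed
  show ?case
  proof (cases "\<F> = {D}"; cases "\<G> = {D}")
    assume F: "\<F> \<noteq> {D}" and G: "\<G> = {D}"
    obtain q A where q: "q \<in> A" "A \<in> \<C>" "A \<subset> D" "\<phi> p = a D *\<^sub>R \<phi> (barycenter d D) + (1 - a D) *\<^sub>R \<phi> q"
      "a D < 1" "in_flag q (\<F> - {D})"
      by (rule splitF[OF _ F]) (assumption, rule that)
    have "1 \<le> a D"
      using top_weight_le[OF D(2) \<phi>(1) q(1-4) bD single[OF pb]] b(2,3) unfolding G by simp
    then show ?thesis using q(5) by simp
  next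
    assume F: "\<F> = {D}" and G: "\<G> \<noteq> {D}"
    obtain r B where r: "r \<in> B" "B \<in> \<C>" "B \<subset> D" "\<phi> p = b D *\<^sub>R \<phi> (barycenter d D) + (1 - b D) *\<^sub>R \<phi> r"
      "b D < 1" "in_flag r (\<G> - {D})"
      by (rule splitG[OF _ G]) (assumption, rule that)
    have "1 \<le> b D"
      using top_weight_le[OF D(2) \<phi>(1) r(1-4) bD single[OF pb]] a(2,3) unfolding F by simp
    then show ?thesis using r(5) by simp
  next
    assume F: "\<F> \<noteq> {D}" and G: "\<G> \<noteq> {D}"
    obtain q A where q: "q \<in> A" "A \<in> \<C>" "A \<subset> D" "\<phi> p = a D *\<^sub>R \<phi> (barycenter d D) + (1 - a D) *\<^sub>R \<phi> q"
      "a D < 1" "in_flag q (\<F> - {D})"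
      by (rule splitF[OF _ F]) (assumption, rule that)
    obtain r B where r: "r \<in> B" "B \<in> \<C>" "B \<subset> D" "\<phi> p = b D *\<^sub>R \<phi> (barycenter d D) + (1 - b D) *\<^sub>R \<phi> r"
      "b D < 1" "in_flag r (\<G> - {D})"
      by (rule splitG[OF _ G]) (assumption, rule that)
    have qD: "q \<in> D" and rD: "r \<in> D" using q(1,3) r(1,3) by auto
    have "a D = b D"
      using top_weight_le[OF D(2) \<phi>(1) q(1-4) rD r(4)] top_weight_le[OF D(2) \<phi>(1) r(1-4) qD q(4)] q(5) r(5)
      by simp
    then have "a D *\<^sub>R \<phi> (barycenter d D) + (1 - a D) *\<^sub>R \<phi> q = a D *\<^sub>R \<phi> (barycenter d D) + (1 - a D) *\<^sub>R \<phi> r"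
      using q(4) r(4) by (metis (no_types))
    then have "(1 - a D) *\<^sub>R \<phi> q = (1 - a D) *\<^sub>R \<phi> r" by (rule add_left_imp_eq)
    then have "\<phi> q = \<phi> r" using q(5) by simp
    then have "q = r" using inj_onD[OF polytope_embedding_inj[OF cell[OF D(2)] \<phi>(1)]] qD rD by blast
    then have "\<F> - {D} = \<G> - {D}"
      using less.hyps[of "\<F> - {D}" q "\<G> - {D}"] q(6) r(6) card_Diff1_less[OF D(5,1)] by simp
    then show ?thesis using D(1) DG by (metis insert_Diff)
  qed simp
qed

end

section \<open>The dimension of a proper face\<close>

text \<open>Positive combinations of differences from a convex set are multiples of single differences.\<close>

lemma span_differences:
  fixes K :: "'b::real_vector set"
  assumes K: "convex K" "k \<in> K" and v: "v \<in> span {x - y | x y. x \<in> K \<and> y \<in> K}"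
  obtains r x y where "0 \<le> r" "x \<in> K" "y \<in> K" "v = r *\<^sub>R (x - y)"
proof -
  let ?R = "{r *\<^sub>R (x - y) | r x y. 0 \<le> r \<and> x \<in> K \<and> y \<in> K}"
  have RI: "v \<in> ?R" if "v = r *\<^sub>R (x - y)" "0 \<le> r" "x \<in> K" "y \<in> K" for v r x y
    unfolding mem_Collect_eq using that by (intro exI[of _ r] exI[of _ x] exI[of _ y]) simp
  have "subspace ?R"
  proof (rule subspaceI)
    show "0 \<in> ?R" by (rule RI[of _ 0 k k]) (simp_all add: K(2))
    fix v w assume "v \<in> ?R" "w \<in> ?R"
    then obtain r x y r' x' y' where v: "v = r *\<^sub>R (x - y)" "0 \<le> r" "x \<in> K" "y \<in> K"
      and w: "w = r' *\<^sub>R (x' - y')" "0 \<le> r'" "x' \<in> K" "y' \<in> K" by blast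
    show "v + w \<in> ?R"
    proof (cases "r + r' = 0")
      case True
      then have "r = 0" "r' = 0" using v(2) w(2) by linarith+
      then show ?thesis by (intro RI[of _ 0 k k]) (simp_all add: v(1) w(1) K(2))
    next
      case False
      let ?t = "r / (r + r')" and ?u = "r' / (r + r')"
      have t: "0 \<le> ?t" "0 \<le> ?u" "?t + ?u = 1" using False v(2) w(2) by (simp_all flip: add_divide_distrib)
      have "v + w = (r + r') *\<^sub>R ((?t *\<^sub>R x + ?u *\<^sub>R x') - (?t *\<^sub>R y + ?u *\<^sub>R y'))"
        using False by (simp add: v(1) w(1) scaleR_diff_right scaleR_add_right)
      then show ?thesis
        by (rule RI[OF _ _ convexD[OF K(1) v(3) w(3) t] convexD[OF K(1) v(4) w(4) t]]) (use v(2) w(2) in simp)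
    qed
    fix c :: real
    show "c *\<^sub>R v \<in> ?R"
    proof (cases "0 \<le> c")
      case True
      then show ?thesis using v(2-4) by (intro RI[of _ "c * r" x y]) (simp_all add: v(1))
    next
      case False
      then show ?thesis using v(2-4)
        by (intro RI[of _ "- c * r" y x]) (simp_all add: v(1) scaleR_diff_right mult_nonpos_nonneg)
    qed
  qed
  moreover have "{x - y | x y. x \<in> K \<and> y \<in> K} \<subseteq> ?R"
  proof
    fix v assume "v \<in> {x - y | x y. x \<in> K \<and> y \<in> K}"
    then obtain x y where "v = x - y" "x \<in> K" "y \<in> K" by blast
    then show "v \<in> ?R" by (intro RI[of _ 1 x y]) simp_all
  qed
  ultimately have "v \<in> ?R" using v span_minimal[of "{x - y | x y. x \<in> K \<and> y \<in> K}" ?R] by (meson subsetD)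
  then obtain r x y where "v = r *\<^sub>R (x - y)" "0 \<le> r" "x \<in> K" "y \<in> K" by blast
  then show thesis by (intro that)
qed

text \<open>If \<open>g - f = r (x - y)\<close> with \<open>f\<close>, \<open>x\<close>, \<open>y\<close> in the face, then a weighted mean of \<open>g\<close> and \<open>y\<close> equals the same
  mean of \<open>f\<close> and \<open>x\<close>, which is in the face; hence so is \<open>g\<close>.\<close>

lemma face_of_eq_of_span:
  assumes S: "convex S" and F: "F face_of S" "F \<noteq> {}"
    and span: "{x - y | x y. x \<in> S \<and> y \<in> S} \<subseteq> span {x - y | x y. x \<in> F \<and> y \<in> F}"
  shows "F = S"
proof
  show "F \<subseteq> S" using F face_of_imp_subset by blast
  show "S \<subseteq> F"
  proof
    fix g assume g: "g \<in> S"
    obtain f where f: "f \<in> F" using F by blast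
    then have "g - f \<in> span {x - y | x y. x \<in> F \<and> y \<in> F}"
      using span g face_of_imp_subset[OF F(1)] by blast
    then obtain r x y where r: "0 \<le> r" "x \<in> F" "y \<in> F" "g - f = r *\<^sub>R (x - y)"
      by (rule span_differences[OF face_of_imp_convex[OF F(1)] f]) (rule that)
    let ?w = "\<lambda>i. if i then 1 / (1 + r) else r / (1 + r)"
    have w: "sum ?w UNIV = 1" using r by (simp add: UNIV_bool flip: add_divide_distrib)
    have "(\<Sum>i\<in>UNIV. ?w i *\<^sub>R (if i then f else x)) \<in> F"
      using r f w by (intro convex_sum face_of_imp_convex[OF F(1)]) auto
    moreover have "(\<Sum>i\<in>UNIV. ?w i *\<^sub>R (if i then f else x)) = (\<Sum>i\<in>UNIV. ?w i *\<^sub>R (if i then g else y))"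
    proof -
      have "g + r *\<^sub>R y = f + r *\<^sub>R x" using r(4) by (simp add: algebra_simps)
      then have "(1 / (1 + r)) *\<^sub>R (g + r *\<^sub>R y) = (1 / (1 + r)) *\<^sub>R (f + r *\<^sub>R x)" by simp
      then show ?thesis by (simp add: UNIV_bool scaleR_add_right add.commute)
    qed
    ultimately have mem: "(\<Sum>i\<in>UNIV. ?w i *\<^sub>R (if i then g else y)) \<in> F" by simp
    have "(if True then g else y) \<in> F"
      using face_of_imp_subset[OF F(1)] g r
      by (intro face_of_convex_sum[OF F(1) S finite _ w _ mem]) auto
    then show "g \<in> F" by simp
  qed
qed

lemma cell_dim_face_less:
  assumes C: "convex_cell d C" and F: "cell_face d F C" "F \<noteq> C"
  shows "cell_dim d F < cell_dim d C"
proof -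
  obtain \<phi> where \<phi>: "polytope_embedding d C \<phi>" "cell_chart d C \<phi>" using convex_cell_chart[OF C] .
  let ?D = "\<lambda>A. {\<phi> x - \<phi> y | x y. x \<in> A \<and> y \<in> A}"
  have D: "?D A = {x - y | x y. x \<in> \<phi> ` A \<and> y \<in> \<phi> ` A}" for A by blast
  have f: "F \<noteq> {}" "F \<subseteq> C" "\<phi> ` F face_of \<phi> ` C" using F cell_face_iff[OF C \<phi>(1)] by auto
  have dims: "cell_dim d C = dim (?D C)" "cell_dim d F = dim (?D F)"
    using cell_dim_eq[OF C \<phi>(1)] cell_dim_eq[OF convex_cell_face[OF C F(1)] polytope_embedding_face[OF C \<phi>(1) F(1)]] by auto
  have sub: "?D F \<subseteq> ?D C" using f(2) by blast
  obtain P where P: "finite P" "\<phi> ` C = convex hull P" using \<phi>(1) by (auto simp: polytope_embedding_def)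
  have "convex hull P \<subseteq> span P"
    by (rule hull_minimal) (auto intro: span_base subspace_imp_convex)
  then have "\<phi> x \<in> span P" if "x \<in> C" for x using that P(2) by blast
  then have DC: "?D C \<subseteq> span P" using span_diff by blast
  obtain B where B: "B \<subseteq> ?D F" "independent B" "?D F \<subseteq> span B"
    using maximal_independent_subset by blast
  obtain B' where B': "B \<subseteq> B'" "B' \<subseteq> ?D C" "independent B'" "?D C \<subseteq> span B'"
    by (rule maximal_independent_subset_extend[OF subset_trans[OF B(1) sub] B(2)]) (rule that)
  have fin: "finite B'"
    using independent_span_bound[OF P(1) B'(3) subset_trans[OF B'(2) DC]] by (rule conjunct1)
  have "B \<noteq> B'"
  proof
    assume "B = B'"
    then have "?D C \<subseteq> span B" using B'(4) by simp
    then have "?D C \<subseteq> span (?D F)" by (rule subset_trans[OF _ span_mono[OF B(1)]])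
    then have "\<phi> ` F = \<phi> ` C"
      using face_of_eq_of_span[OF polytope_embedding_convex[OF \<phi>(1)] f(3)] f(1) unfolding D by simp
    then show False
      using F(2) inj_on_image_eq_iff[OF polytope_embedding_inj[OF C \<phi>(1)] f(2) order_refl] by simp
  qed
  then have "card B < card B'" using psubset_card_mono[OF fin] B'(1) by blast
  then show ?thesis
    unfolding dims using real_vector.dim_unique[OF B(1,3,2) refl] real_vector.dim_unique[OF B'(2,4,3) refl] by simp
qed

section \<open>Open stars in the barycentric subdivision\<close>

context poly_complex
begin

lemma in_flag_of_combination:
  assumes C: "C \<in> \<C>" and \<phi>: "cell_chart d C \<phi>"
    and F: "finite \<F>" "\<F> \<noteq> {}" "subset.chain \<C> \<F>" "\<And>F. F \<in> \<F> \<Longrightarrow> F \<subseteq> C" and p: "p \<in> C"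
    and a: "\<And>F. F \<in> \<F> \<Longrightarrow> 0 < a F" "sum a \<F> = 1" "\<phi> p = (\<Sum>F\<in>\<F>. a F *\<^sub>R \<phi> (barycenter d F))"
  shows "in_flag p \<F>"
proof -
  let ?G = "\<Union>\<F>"
  have G: "?G \<in> \<F>" using F by (intro Union_in_chain)
  then have GC: "?G \<in> \<C>" and sub: "?G \<subseteq> C" using F(3,4) by (auto simp: subset.chain_def)
  have cG: "polytope_embedding d ?G \<phi>"
    using polytope_embedding_face[OF cell[OF C] _ subset_imp_face[OF GC C sub]] \<phi> by (simp add: cell_chart_iff)
  have bG: "\<phi> (barycenter d F) \<in> \<phi> ` ?G" if "F \<in> \<F>" for F
    using that F(3) bary_mem[of F] unfolding subset.chain_def by blast
  have "\<phi> p \<in> \<phi> ` ?G"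
    unfolding a(3) by (rule convex_sum[OF F(1) polytope_embedding_convex[OF cG] a(2) _ bG])
      (use a(1) in \<open>auto simp: less_imp_le\<close>)
  then have "p \<in> ?G"
    using inj_onD[OF isometric_on_inj[OF convex_cell_metric[OF cell[OF C]] polytope_embedding_isometric]] \<phi> p sub
    unfolding cell_chart_iff by (smt (verit) imageE subsetD)
  then show ?thesis
    unfolding in_flag_def flag_weights_def using F(1,3) G a cG[folded cell_chart_iff]
    by (intro conjI bexI[of _ ?G] exI[of _ \<phi>] exI[of _ a]) auto
qed

lemma subdivision_cellE:
  assumes "K \<in> barycentric_subdivision d \<C>"
  obtains C \<F> and \<phi> :: "'z \<Rightarrow> nat eucl" where "C \<in> \<C>" "cell_chart d C \<phi>" "finite \<F>" "\<F> \<noteq> {}" "subset.chain \<C> \<F>"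
    "\<And>F. F \<in> \<F> \<Longrightarrow> F \<subseteq> C" "K \<subseteq> C" "\<phi> ` K = convex hull ((\<lambda>F. \<phi> (barycenter d F)) ` \<F>)"
    "convex_cell d K" "polytope_embedding d K \<phi>"
proof -
  obtain C \<F> where C: "C \<in> \<C>" "C \<in> \<F>" "subset.chain {F. cell_face d F C} \<F>"
    and K: "K = cell_hull d C (barycenter d ` \<F>)"
    using assms unfolding barycentric_subdivision_def by blast
  obtain \<phi> where \<phi>: "polytope_embedding d C \<phi>" "cell_chart d C \<phi>" using convex_cell_chart[OF cell[OF C(1)]] .
  have faces: "\<F> \<subseteq> {F. cell_face d F C}" using C(3) by (simp add: subset.chain_def)
  then have fin: "finite \<F>" using finite_cell_faces[OF cell[OF C(1)] \<phi>(1)] finite_subset by blast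
  have sub: "F \<subseteq> C" if "F \<in> \<F>" for F using that faces cell_face_subset by blast
  have FC: "\<F> \<subseteq> \<C>" using faces face_mem[OF C(1)] by blast
  then have ch: "subset.chain \<C> \<F>" using C(3) by (simp add: subset.chain_def)
  have b: "barycenter d ` \<F> \<subseteq> C" using FC sub bary_mem by blast
  have Kiff: "x \<in> K \<longleftrightarrow> x \<in> C \<and> \<phi> x \<in> convex hull (\<phi> ` barycenter d ` \<F>)" for x
    unfolding K using cell_hull_iff[OF cell[OF C(1)] \<phi>(1) finite_imageI[OF fin] b] .
  have "convex hull (\<phi> ` barycenter d ` \<F>) \<subseteq> \<phi> ` C"
    using b by (intro hull_minimal polytope_embedding_convex[OF \<phi>(1)]) blast
  then have im: "\<phi> ` K = convex hull (\<phi> ` barycenter d ` \<F>)" using Kiff by blast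
  have KC: "K \<subseteq> C" using Kiff by blast
  have emb: "polytope_embedding d K \<phi>"
    unfolding polytope_embedding_def using isometric_on_subset[OF polytope_embedding_isometric[OF \<phi>(1)] KC] im fin C(2)
    by (metis empty_iff finite_imageI image_is_empty)
  then have "convex_cell d K"
    using Metric_space.subspace[OF convex_cell_metric[OF cell[OF C(1)]] KC] by (auto simp: convex_cell_def cell_chart_iff)
  then show thesis
    using that[OF C(1) \<phi>(2) fin _ ch sub KC _ _ emb] C(2) im by (auto simp: image_image)
qed

lemma subdivision_vertex:
  assumes "z \<in> complex_vertices d (barycentric_subdivision d \<C>)"
  obtains F where "F \<in> \<C>" "z = barycenter d F"
proof -
  obtain K where K: "K \<in> barycentric_subdivision d \<C>" "z \<in> cell_vertices d K"
    using assms unfolding complex_vertices_def by blast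
  obtain C \<F> and \<phi> :: "'z \<Rightarrow> nat eucl" where C: "C \<in> \<C>" "cell_chart d C \<phi>" "finite \<F>" "\<F> \<noteq> {}" "subset.chain \<C> \<F>"
    "\<And>F. F \<in> \<F> \<Longrightarrow> F \<subseteq> C" "K \<subseteq> C" "\<phi> ` K = convex hull ((\<lambda>F. \<phi> (barycenter d F)) ` \<F>)"
    "convex_cell d K" "polytope_embedding d K \<phi>"
    by (rule subdivision_cellE[OF K(1)]) (rule that)
  have "\<phi> z extreme_point_of (convex hull ((\<lambda>F. \<phi> (barycenter d F)) ` \<F>))" "z \<in> K"
    using K(2) cell_vertices_iff[OF C(9,10)] C(8) by auto
  then obtain F where F: "F \<in> \<F>" "\<phi> z = \<phi> (barycenter d F)" "z \<in> C"
    using extreme_point_of_convex_hull C(7) by blast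
  have FC: "F \<in> \<C>" using F C(5) by (auto simp: subset.chain_def)
  then have "barycenter d F \<in> C" using bary_mem C(6) F(1) by blast
  then have "z = barycenter d F"
    using inj_onD[OF isometric_on_inj[OF convex_cell_metric[OF cell[OF C(1)]] polytope_embedding_isometric] F(2)]
      C(2) F(3) by (simp add: cell_chart_iff)
  then show thesis using that FC by blast
qed

text \<open>A point of the star is interior to a simplex of the subdivision that contains the barycenter of \<open>F\<close>. The
  barycenter lies inside a subflag of the corresponding flag and also inside the flag \<open>{F}\<close>; by uniqueness the two coincide.\<close>

lemma subdivision_star_flag:
  assumes q: "q \<in> open_star d (barycentric_subdivision d \<C>) (barycenter d F)" and F: "F \<in> \<C>"
  obtains \<F> where "in_flag q \<F>" "F \<in> \<F>"
proof -
  obtain K where K: "K \<in> barycentric_subdivision d \<C>" "barycenter d F \<in> K" "q \<in> cell_int d K"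
    using q unfolding open_star_def by blast
  obtain C \<F> and \<phi> :: "'z \<Rightarrow> nat eucl" where C: "C \<in> \<C>" "cell_chart d C \<phi>" "finite \<F>" "\<F> \<noteq> {}" "subset.chain \<C> \<F>"
    "\<And>F. F \<in> \<F> \<Longrightarrow> F \<subseteq> C" "K \<subseteq> C" "\<phi> ` K = convex hull ((\<lambda>F. \<phi> (barycenter d F)) ` \<F>)"
    "convex_cell d K" "polytope_embedding d K \<phi>"
    by (rule subdivision_cellE[OF K(1)]) (rule that)
  have qK: "q \<in> K" "\<phi> q \<in> rel_interior (\<phi> ` K)" using K(3) cell_int_iff[OF C(9,10)] by auto
  obtain a where a: "\<And>G. G \<in> \<F> \<Longrightarrow> a G > 0" "sum a \<F> = 1" "\<phi> q = (\<Sum>G\<in>\<F>. a G *\<^sub>R \<phi> (barycenter d G))"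
    using rel_interior_convex_hull_coeffs[OF C(3) qK(2)[unfolded C(8)]] by blast
  have qF: "in_flag q \<F>"
    by (rule in_flag_of_combination[OF C(1,2,3,4,5,6) _ a]) (use qK C(7) in auto)
  have "\<phi> (barycenter d F) \<in> convex hull ((\<lambda>F. \<phi> (barycenter d F)) ` \<F>)"
    using K(2) C(8) by blast
  then obtain b where b: "\<forall>G\<in>\<F>. 0 \<le> b G" "sum b \<F> = 1" "\<phi> (barycenter d F) = (\<Sum>G\<in>\<F>. b G *\<^sub>R \<phi> (barycenter d G))"
    unfolding convex_hull_image_finite[OF C(3)] by auto
  let ?P = "{G\<in>\<F>. 0 < b G}"
  have P: "sum b ?P = 1" "\<phi> (barycenter d F) = (\<Sum>G\<in>?P. b G *\<^sub>R \<phi> (barycenter d G))"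
    unfolding b(2)[symmetric] b(3) using b(1) C(3)
    by (intro sum.mono_neutral_left sum.mono_neutral_right; force)+
  have bFC: "barycenter d F \<in> C" using K(2) C(7) by blast
  have "in_flag (barycenter d F) ?P"
  proof (rule in_flag_of_combination[OF C(1,2) _ _ _ _ bFC _ P])
    show "?P \<noteq> {}" using P(1) by (metis sum.empty zero_neq_one)
  qed (use C in \<open>auto simp: subset.chain_def\<close>)
  moreover have "in_flag (barycenter d F) {F}"
    by (rule in_flag_of_combination[OF C(1,2), of _ _ "\<lambda>_. 1"])
      (use F bary_mem_imp_subset[OF F C(1)] bFC in \<open>auto simp: subset.chain_def\<close>)
  ultimately have "?P = {F}" by (rule in_flag_unique)
  then show thesis using that[OF qF] by blast
qed

text \<open>Both cells are members of the flag around \<open>q\<close>, so they are nested, and a proper face has smaller dimension.\<close>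

lemma star_dim_disjoint:
  assumes "q \<in> open_star d (barycentric_subdivision d \<C>) (barycenter d F)" "F \<in> \<C>"
    and "q \<in> open_star d (barycentric_subdivision d \<C>) (barycenter d G)" "G \<in> \<C>"
    and "cell_dim d F = cell_dim d G"
  shows "F = G"
proof -
  obtain \<F> where F: "in_flag q \<F>" "F \<in> \<F>" using subdivision_star_flag[OF assms(1,2)] .
  obtain \<G> where G: "in_flag q \<G>" "G \<in> \<G>" using subdivision_star_flag[OF assms(3,4)] .
  have "\<F> = \<G>" using in_flag_unique[OF F(1) G(1)] .
  then have "F \<subseteq> G \<or> G \<subseteq> F" using F G by (auto simp: in_flag_def subset.chain_def)
  then show ?thesis
    using subset_imp_face cell_dim_face_less[OF cell] assms(2,4,5) by (metis less_irrefl)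
qed

end

section \<open>From maps into polyhedral complexes to coloured coverings\<close>

lemma maps_to_polyhedral_imp_separated:
  assumes X: "Metric_space X d" and "maps_to_polyhedral_complexes TYPE('z) X d n"
  shows "separated_coverings X d n"
proof -
  obtain c where c: "c > 0" and ex: "\<forall>s>0. \<exists>(Z :: 'z set) dZ \<C> g.
        polyhedral_complex Z dZ \<C> \<and> complex_dim dZ \<C> \<le> enat n \<and>
        (let \<C>\<^sub>1 = barycentric_subdivision dZ \<C> in
           (\<forall>p\<in>Z. \<exists>z\<in>complex_vertices dZ \<C>\<^sub>1. Metric_space.mball Z dZ p s \<subseteq> open_star dZ \<C>\<^sub>1 z) \<and>
           (\<forall>z\<in>complex_vertices dZ \<C>\<^sub>1. ediam d (g -` open_star dZ \<C>\<^sub>1 z \<inter> X) \<le> ennreal (c * s))) \<and>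
        nonexpanding X d Z dZ g"
    using assms(2) unfolding maps_to_polyhedral_complexes_def by blast
  show ?thesis
    unfolding separated_coverings_def
  proof (rule exI[of _ "2 * c"], intro conjI allI impI)
    fix s :: real assume s: "s > 0"
    \<comment> \<open>Stars contain open balls; doubling the scale makes them absorb points at distance exactly \<open>s\<close>.\<close>
    then have s2: "2 * s > 0" by simp
    obtain Z :: "'z set" and dZ \<C> g where H: "polyhedral_complex Z dZ \<C> \<and> complex_dim dZ \<C> \<le> enat n \<and>
        (let \<C>\<^sub>1 = barycentric_subdivision dZ \<C> in
           (\<forall>p\<in>Z. \<exists>z\<in>complex_vertices dZ \<C>\<^sub>1. Metric_space.mball Z dZ p (2 * s) \<subseteq> open_star dZ \<C>\<^sub>1 z) \<and>
           (\<forall>z\<in>complex_vertices dZ \<C>\<^sub>1. ediam d (g -` open_star dZ \<C>\<^sub>1 z \<inter> X) \<le> ennreal (c * (2 * s)))) \<and>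
        nonexpanding X d Z dZ g"
      using ex[rule_format, OF s2] by (elim exE)
    then have Z: "polyhedral_complex Z dZ \<C>" "complex_dim dZ \<C> \<le> enat n"
      and g: "g ` X \<subseteq> Z" "\<And>x x'. x \<in> X \<Longrightarrow> x' \<in> X \<Longrightarrow> dZ (g x) (g x') \<le> d x x'"
      unfolding nonexpanding_def by simp_all
    have leb: "\<And>p. p \<in> Z \<Longrightarrow> \<exists>z\<in>complex_vertices dZ (barycentric_subdivision dZ \<C>).
          Metric_space.mball Z dZ p (2 * s) \<subseteq> open_star dZ (barycentric_subdivision dZ \<C>) z"
      and diam: "\<And>z. z\<in>complex_vertices dZ (barycentric_subdivision dZ \<C>) \<Longrightarrow>
          ediam d (g -` open_star dZ (barycentric_subdivision dZ \<C>) z \<inter> X) \<le> ennreal (c * (2 * s))"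
      using H unfolding Let_def by simp_all
    interpret P: poly_complex Z dZ \<C> using Z(1) by unfold_locales
    interpret MZ: Metric_space Z dZ using P.metric .
    let ?S = "open_star dZ (barycentric_subdivision dZ \<C>)"
    let ?V = "complex_vertices dZ (barycentric_subdivision dZ \<C>)"
    define B where "B z = {x \<in> X. MZ.mball (g x) (2 * s) \<subseteq> ?S z}" for z
    define \<B> where "\<B> k = B ` {z \<in> ?V. \<exists>F\<in>\<C>. z = barycenter dZ F \<and> cell_dim dZ F = k}" for k
    have star: "g x' \<in> ?S z" if "x \<in> B z" "x' \<in> X" "d x x' \<le> s" for x x' z
    proof -
      have "x \<in> X" using that by (simp add: B_def)
      then have "g x' \<in> MZ.mball (g x) (2 * s)"
        using that(2,3) g(1) s g(2)[of x x'] by (auto simp: MZ.in_mball)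
      then show ?thesis using that(1) by (auto simp: B_def)
    qed
    have cov: "covering X (\<Union>k\<in>{0..n}. \<B> k)"
      unfolding covering_def
    proof
      show "\<Union> (\<Union>k\<in>{0..n}. \<B> k) \<subseteq> X" by (auto simp: \<B>_def B_def)
      show "X \<subseteq> \<Union> (\<Union>k\<in>{0..n}. \<B> k)"
      proof
        fix x assume x: "x \<in> X"
        then have "g x \<in> Z" using g by blast
        then obtain z where z: "z \<in> ?V" "MZ.mball (g x) (2 * s) \<subseteq> ?S z" using leb by blast
        obtain F where F: "F \<in> \<C>" "z = barycenter dZ F" using P.subdivision_vertex[OF z(1)] .
        have "enat (cell_dim dZ F) \<le> complex_dim dZ \<C>" unfolding complex_dim_def using F(1) by (rule SUP_upper)
        then have "cell_dim dZ F \<le> n" using Z(2) by (metis enat_ord_simps(1) order_trans)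
        moreover have "x \<in> B z" using x z by (simp add: B_def)
        ultimately show "x \<in> \<Union> (\<Union>k\<in>{0..n}. \<B> k)"
          using F z(1) by (auto simp: \<B>_def intro!: bexI[of _ "cell_dim dZ F"])
      qed
    qed
    have bdd: "bounded_family d (2 * c * s) (\<Union>k\<in>{0..n}. \<B> k) (\<lambda>B. B)"
      unfolding bounded_family_def
    proof
      fix A assume "A \<in> (\<Union>k\<in>{0..n}. \<B> k)"
      then obtain z where z: "z \<in> ?V" "A = B z" by (auto simp: \<B>_def)
      have "A \<subseteq> g -` ?S z \<inter> X"
        using star[of _ z] X s unfolding z(2) by (auto simp: B_def Metric_space.mdist_zero[OF X])
      then have "ediam d A \<le> ediam d (g -` ?S z \<inter> X)" by (rule ediam_mono)
      also have "\<dots> \<le> ennreal (c * (2 * s))" using diam[OF z(1)] .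
      finally show "ediam d A \<le> ennreal (2 * c * s)" by (simp add: mult_ac)
    qed
    have mult: "multiplicity_at_scale X d s (\<B> k) (\<lambda>B. B) \<le> 1" for k
      unfolding one_enat_def multiplicity_at_scale_le_iff
    proof (intro allI impI)
      fix S assume S: "S \<subseteq> X" "ediam d S \<le> ennreal s"
      then have dS: "d x y \<le> s" if "x \<in> S" "y \<in> S" for x y
        using that s Metric_space.nonneg[OF X] by (simp add: ediam_le_iff)
      let ?A = "{A \<in> \<B> k. A \<inter> S \<noteq> {}}"
      have "A = A'" if AA: "A \<in> ?A" "A' \<in> ?A" for A A'
      proof -
        obtain F where F: "F \<in> \<C>" "cell_dim dZ F = k" "A = B (barycenter dZ F)" using AA(1) unfolding \<B>_def by auto
        obtain F' where F': "F' \<in> \<C>" "cell_dim dZ F' = k" "A' = B (barycenter dZ F')" using AA(2) unfolding \<B>_def by auto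
        obtain x x' where x: "x \<in> A" "x \<in> S" "x' \<in> A'" "x' \<in> S" using AA by auto
        have "g x \<in> ?S (barycenter dZ F)" "g x \<in> ?S (barycenter dZ F')"
          using star[of x "barycenter dZ F" x] star[of x' "barycenter dZ F'" x] x F(3) F'(3) dS[of x x] dS[of x' x] S(1)
          by (simp_all add: subset_iff)
        then have "F = F'" using P.star_dim_disjoint[of "g x" F F'] F(1,2) F'(1,2) by simp
        then show ?thesis using F F' by simp
      qed
      then have "?A \<subseteq> {SOME A. A \<in> ?A}" by (metis (mono_tags, lifting) singletonI someI subsetI)
      then show "finite ?A \<and> card ?A \<le> 1"
        using card_mono[of "{SOME A. A \<in> ?A}" ?A] finite_subset[of ?A] by auto
    qed
    show "\<exists>\<B> \<B>\<^sub>k. covering X \<B> \<and> bounded_family d (2 * c * s) \<B> (\<lambda>B. B) \<and>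
        \<B> = (\<Union>k\<in>{0..n}. \<B>\<^sub>k k) \<and>
        (\<forall>k\<in>{0..n}. multiplicity_at_scale X d s (\<B>\<^sub>k k) (\<lambda>B. B) \<le> 1)"
      using cov bdd mult by blast
  qed (use c in simp)
qed

section \<open>Equidistant points\<close>

definition equidistant :: "real \<Rightarrow> 'i set \<Rightarrow> ('i \<Rightarrow> 'b::real_inner) \<Rightarrow> bool" where
  "equidistant s I f \<longleftrightarrow> (\<forall>i\<in>I. \<forall>j\<in>I. i \<noteq> j \<longrightarrow> dist (f i) (f j) = s)"

lemma equidistant_subset: "equidistant s I f \<Longrightarrow> J \<subseteq> I \<Longrightarrow> equidistant s J f"
  by (auto simp: equidistant_def)

text \<open>Expand the square with \<open>2 f\<^sub>i \<bullet> f\<^sub>j = |f\<^sub>i|\<^sup>2 + |f\<^sub>j|\<^sup>2 - s\<^sup>2\<close> for \<open>i \<noteq> j\<close>: as the coefficients add up to 0, only the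
  diagonal survives. Thus barycentric coordinates in a regular simplex are euclidean coordinates up to scaling.\<close>

lemma equidistant_norm:
  fixes f :: "'i \<Rightarrow> 'b::real_inner"
  assumes I: "finite I" and eq: "equidistant s I f" and a: "sum a I = 0"
  shows "(norm (\<Sum>i\<in>I. a i *\<^sub>R f i))\<^sup>2 = s\<^sup>2 / 2 * (\<Sum>i\<in>I. (a i)\<^sup>2)"
proof -
  have inn: "a i * (a j * inner (f i) (f j)) =
      (a i * (norm (f i))\<^sup>2) * a j / 2 + a i * (a j * (norm (f j))\<^sup>2) / 2 - s\<^sup>2 / 2 * (a i * a j)
        + s\<^sup>2 / 2 * (if j = i then (a i)\<^sup>2 else 0)"
    if "i \<in> I" "j \<in> I" for i j
  proof (cases "i = j")
    case True
    then show ?thesis by (simp add: power2_eq_square[of "a _"] algebra_simps flip: power2_norm_eq_inner)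
  next
    case False
    then have "s\<^sup>2 = (norm (f i - f j))\<^sup>2" using eq that by (simp add: equidistant_def dist_norm)
    also have "\<dots> = (norm (f i))\<^sup>2 + (norm (f j))\<^sup>2 - 2 * inner (f i) (f j)"
      by (simp add: power2_norm_eq_inner inner_diff inner_commute)
    finally have "s\<^sup>2 = (norm (f i))\<^sup>2 + (norm (f j))\<^sup>2 - 2 * inner (f i) (f j)" .
    then have g: "inner (f i) (f j) = ((norm (f i))\<^sup>2 + (norm (f j))\<^sup>2 - s\<^sup>2) / 2" by simp
    show ?thesis unfolding g using False by (simp add: field_simps)
  qed
  have "(norm (\<Sum>i\<in>I. a i *\<^sub>R f i))\<^sup>2 = (\<Sum>i\<in>I. \<Sum>j\<in>I. a i * (a j * inner (f i) (f j)))"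
    unfolding power2_norm_eq_inner inner_sum_left unfolding inner_sum_right by (intro sum.cong refl) simp
  also have "\<dots> = (\<Sum>i\<in>I. \<Sum>j\<in>I. (a i * (norm (f i))\<^sup>2) * a j / 2 + a i * (a j * (norm (f j))\<^sup>2) / 2
      - s\<^sup>2 / 2 * (a i * a j) + s\<^sup>2 / 2 * (if j = i then (a i)\<^sup>2 else 0))"
    by (intro sum.cong refl inn)
  also have "\<dots> = (\<Sum>i\<in>I. (a i * (norm (f i))\<^sup>2) * sum a I / 2 + a i * (\<Sum>j\<in>I. a j * (norm (f j))\<^sup>2) / 2
      - s\<^sup>2 / 2 * (a i * sum a I) + s\<^sup>2 / 2 * (a i)\<^sup>2)"
    by (intro sum.cong refl) (simp only: sum.distrib sum_subtractf sum_divide_distrib[symmetric] sum_distrib_left[symmetric], simp add: I)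
  also have "\<dots> = sum a I * (\<Sum>j\<in>I. a j * (norm (f j))\<^sup>2) / 2 + s\<^sup>2 / 2 * (\<Sum>i\<in>I. (a i)\<^sup>2)"
  proof -
    let ?K = "\<Sum>j\<in>I. a j * (norm (f j))\<^sup>2"
    have "(\<Sum>i\<in>I. a i * ?K / 2) = sum a I * ?K / 2" by (simp only: sum_distrib_right sum_divide_distrib)
    then show ?thesis by (simp only: sum.distrib sum_subtractf a) (simp add: sum_distrib_left)
  qed
  finally show ?thesis by (simp add: a)
qed

lemma equidistant_coeff_le:
  fixes f :: "'i \<Rightarrow> 'b::real_inner"
  assumes I: "finite I" "i \<in> I" and eq: "equidistant s I f" and a: "sum a I = sum b I"
    and p: "p = (\<Sum>i\<in>I. a i *\<^sub>R f i)" and q: "q = (\<Sum>i\<in>I. b i *\<^sub>R f i)"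
  shows "s\<^sup>2 / 2 * (a i - b i)\<^sup>2 \<le> (dist p q)\<^sup>2"
proof -
  have "p - q = (\<Sum>i\<in>I. (a i - b i) *\<^sub>R f i)"
    by (simp add: p q scaleR_diff_left sum_subtractf)
  then have "(dist p q)\<^sup>2 = s\<^sup>2 / 2 * (\<Sum>i\<in>I. (a i - b i)\<^sup>2)"
    using equidistant_norm[OF I(1) eq, of "\<lambda>i. a i - b i"] a by (simp add: dist_norm sum_subtractf)
  moreover have "(a i - b i)\<^sup>2 \<le> (\<Sum>i\<in>I. (a i - b i)\<^sup>2)"
    using I by (intro member_le_sum) auto
  ultimately show ?thesis by (simp add: mult_left_mono)
qed

lemma equidistant_coeff_eq:
  fixes f :: "'i \<Rightarrow> 'b::real_inner"
  assumes "finite I" "i \<in> I" "equidistant s I f" "sum a I = sum b I" "0 < s"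
    and "(\<Sum>i\<in>I. a i *\<^sub>R f i) = (\<Sum>i\<in>I. b i *\<^sub>R f i)"
  shows "a i = b i"
proof -
  have "s\<^sup>2 / 2 * (a i - b i)\<^sup>2 \<le> 0"
    using equidistant_coeff_le[OF assms(1-4) refl assms(6)] by simp
  then have "(a i - b i)\<^sup>2 \<le> 0" using assms(5) by (simp add: mult_le_0_iff)
  then show ?thesis by simp
qed

text \<open>By uniqueness of coefficients, a combination of points with nonnegative coefficients that vanishes outside
  \<open>J\<close> forces the coefficients of both points to vanish there.\<close>

lemma equidistant_face:
  fixes f :: "'i \<Rightarrow> 'b::real_inner"
  assumes I: "finite I" and eq: "equidistant s I f" and s: "0 < s" and J: "J \<subseteq> I"
  shows "convex hull (f ` J) face_of convex hull (f ` I)"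
  unfolding face_of_def
proof (intro conjI ballI impI)
  show "convex hull (f ` J) \<subseteq> convex hull (f ` I)" using J by (intro hull_mono image_mono)
  fix p q x assume p: "p \<in> convex hull (f ` I)" and q: "q \<in> convex hull (f ` I)"
    and x: "x \<in> convex hull (f ` J)" and seg: "x \<in> open_segment p q"
  have fJ: "finite J" using I J finite_subset by blast
  obtain a where a: "p = (\<Sum>i\<in>I. a i *\<^sub>R f i)" "\<forall>i\<in>I. 0 \<le> a i" "sum a I = 1"
    using p unfolding convex_hull_image_finite[OF I] by (elim CollectE exE conjE) (rule that)
  obtain b where b: "q = (\<Sum>i\<in>I. b i *\<^sub>R f i)" "\<forall>i\<in>I. 0 \<le> b i" "sum b I = 1"
    using q unfolding convex_hull_image_finite[OF I] by (elim CollectE exE conjE) (rule that)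
  obtain c where c: "x = (\<Sum>i\<in>J. c i *\<^sub>R f i)" "\<forall>i\<in>J. 0 \<le> c i" "sum c J = 1"
    using x unfolding convex_hull_image_finite[OF fJ] by (elim CollectE exE conjE) (rule that)
  obtain t where t: "0 < t" "t < 1" "x = (1 - t) *\<^sub>R p + t *\<^sub>R q" using seg by (auto simp: in_segment)
  let ?c = "\<lambda>i. if i \<in> J then c i else 0" and ?e = "\<lambda>i. (1 - t) * a i + t * b i"
  have c1: "sum ?c I = 1" using c(3) I J by (simp add: sum.If_cases Int_absorb1)
  have c2: "(\<Sum>i\<in>I. ?c i *\<^sub>R f i) = x"
    unfolding c(1) using I J by (intro sum.mono_neutral_cong_right) auto
  have e1: "sum ?e I = 1" using a(3) b(3) by (simp add: sum.distrib flip: sum_distrib_left)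
  have e2: "(\<Sum>i\<in>I. ?e i *\<^sub>R f i) = x"
    unfolding t(3) a(1) b(1) by (simp add: scaleR_add_left sum.distrib scaleR_sum_right)
  have zero: "a i = 0 \<and> b i = 0" if "i \<in> I - J" for i
  proof -
    have i: "i \<in> I" "i \<notin> J" using that by auto
    have "?e i = ?c i"
      by (rule equidistant_coeff_eq[OF I i(1) eq _ s]) (simp_all only: c1 c2 e1 e2)
    then have e0: "(1 - t) * a i + t * b i = 0" using i(2) by simp
    have "0 \<le> (1 - t) * a i" "0 \<le> t * b i" using a(2) b(2) t i by auto
    then have "(1 - t) * a i = 0" "t * b i = 0" using e0 by linarith+
    then show ?thesis using t by simp
  qed
  have "p = (\<Sum>i\<in>J. a i *\<^sub>R f i)" "sum a J = 1"
    unfolding a(1) a(3)[symmetric] using zero I J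
    by (intro sum.mono_neutral_right sum.mono_neutral_left; force)+
  then show "p \<in> convex hull (f ` J)"
    using a(2) J unfolding convex_hull_image_finite[OF fJ] by blast
  have "q = (\<Sum>i\<in>J. b i *\<^sub>R f i)" "sum b J = 1"
    unfolding b(1) b(3)[symmetric] using zero I J
    by (intro sum.mono_neutral_right sum.mono_neutral_left; force)+
  then show "q \<in> convex hull (f ` J)"
    using b(2) J unfolding convex_hull_image_finite[OF fJ] by blast
qed simp

lemma equidistant_rel_interior:
  fixes f :: "'i \<Rightarrow> 'b::real_inner"
  assumes I: "finite I" and eq: "equidistant s I f" and s: "0 < s"
    and a: "\<And>i. i \<in> I \<Longrightarrow> 0 < a i" "sum a I = 1" and p: "p = (\<Sum>i\<in>I. a i *\<^sub>R f i)"
  shows "p \<in> rel_interior (convex hull (f ` I))"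
proof (rule rel_interior_of_stable_coefficients[OF I a p])
  show "0 < 2 / s" using s by simp
  fix i and c :: "'i \<Rightarrow> real" assume i: "i \<in> I" and c: "sum c I = 1"
  let ?z = "\<Sum>i\<in>I. c i *\<^sub>R f i"
  have "(s / 2 * \<bar>a i - c i\<bar>)\<^sup>2 \<le> s\<^sup>2 / 2 * (a i - c i)\<^sup>2"
    using zero_le_power2[of "s * (a i - c i)"] by (simp add: power_mult_distrib power_divide)
  also have "\<dots> \<le> (dist p ?z)\<^sup>2" using equidistant_coeff_le[OF I i eq _ p refl, of c] a(2) c by simp
  finally have "s / 2 * \<bar>a i - c i\<bar> \<le> dist p ?z" by (rule power2_le_imp_le) simp
  then show "\<bar>a i - c i\<bar> \<le> 2 / s * dist p ?z" using s by (simp add: pos_le_divide_eq mult.commute)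
qed

section \<open>Complexes with regular finite subcomplexes\<close>

text \<open>A face containing both points would be convex, hence contain their midpoint.\<close>

lemma vertex_of_two_point_subcomplex:
  assumes \<Delta>: "convex_cell dist \<Delta>" and sub: "subcomplex dist {F. cell_face dist F \<Delta>} \<E>"
    and U: "\<Union>\<E> = {x, y :: nat eucl}"
  shows "x \<in> cell_vertices dist \<Delta>"
proof -
  obtain F where F: "F \<in> \<E>" "x \<in> F" using U by blast
  then have f: "cell_face dist F \<Delta>" "F \<subseteq> {x, y}" using sub U unfolding subcomplex_def by blast+
  obtain \<phi> where \<phi>: "polytope_embedding dist \<Delta> \<phi>" "cell_chart dist \<Delta> \<phi>" using convex_cell_chart[OF \<Delta>] .
  have "F = {x}"
  proof (rule ccontr)
    assume "F \<noteq> {x}"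
    then have y: "y \<in> F" "x \<noteq> y" using F(2) f(2) by auto
    have "x \<in> \<Delta>" "y \<in> \<Delta>" using F(2) y cell_face_subset[OF f(1)] by auto
    then have ne: "\<phi> x \<noteq> \<phi> y" using y(2) inj_onD[OF polytope_embedding_inj[OF \<Delta> \<phi>(1)]] by blast
    have "convex (\<phi> ` F)" using polytope_embedding_face[OF \<Delta> \<phi>(1) f(1)] by (rule polytope_embedding_convex)
    then have "(1/2) *\<^sub>R \<phi> x + (1/2) *\<^sub>R \<phi> y \<in> \<phi> ` F"
      using F(2) y(1) by (intro convexD) auto
    then have "midpoint (\<phi> x) (\<phi> y) \<in> \<phi> ` F"
      by (simp add: midpoint_def scaleR_add_right inverse_eq_divide)
    then have "midpoint (\<phi> x) (\<phi> y) = \<phi> x \<or> midpoint (\<phi> x) (\<phi> y) = \<phi> y" using f(2) by auto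
    then show False using ne by (simp add: midpoint_eq_endpoint)
  qed
  then show ?thesis using f(1) by (simp add: cell_vertices_def)
qed

locale regular_complex = poly_complex Z d \<C> for Z :: "'z set" and d and \<C> +
  fixes s :: real and n :: nat
  assumes simplices: "\<And>C. C \<in> \<C> \<Longrightarrow> euclidean_simplex d C"
    and dim: "complex_dim d \<C> \<le> enat n"
    and regular: "finite_subcomplexes_regular s d \<C>" and s: "0 < s"
begin

lemma vertices_subset: "C \<in> \<C> \<Longrightarrow> cell_vertices d C \<subseteq> complex_vertices d \<C>"
  unfolding complex_vertices_def by blast

lemma card_vertices: assumes "C \<in> \<C>" shows "finite (cell_vertices d C)" "card (cell_vertices d C) \<le> n + 1"
proof -
  have "enat (cell_dim d C) \<le> complex_dim d \<C>" unfolding complex_dim_def using assms by (rule SUP_upper)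
  then have "cell_dim d C \<le> n" using dim by (metis enat_ord_simps(1) order_trans)
  moreover have "card (cell_vertices d C) = cell_dim d C + 1"
    using simplices[OF assms] by (simp add: euclidean_simplex_def)
  ultimately show "finite (cell_vertices d C)" "card (cell_vertices d C) \<le> n + 1"
    using card.infinite by fastforce+
qed

text \<open>Two vertices form a finite subcomplex.\<close>

lemma vertex_dist:
  assumes v: "v \<in> complex_vertices d \<C>" and w: "w \<in> complex_vertices d \<C>" and ne: "v \<noteq> w"
  shows "d v w = s"
proof -
  let ?D = "{{v}, {w}}"
  have single: "F = {u}" if "cell_face d F {u}" for F u
    using cell_face_subset[OF that] cell_face_nonempty[OF that] by blast
  have "subcomplex d \<C> ?D"
    unfolding subcomplex_def using vertex_mem[OF v] vertex_mem[OF w] single by blast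
  then obtain \<Delta> \<E> where \<Delta>: "regular_simplex s \<Delta>" "subcomplex dist {F. cell_face dist F \<Delta>} \<E>"
    and iso: "isometric_spaces (\<Union>?D) d (\<Union>\<E>) dist"
    using regular unfolding finite_subcomplexes_regular_def by (meson finite.emptyI finite.insertI)
  have "\<Union>?D = {v, w}" by auto
  then obtain h where h: "bij_betw h {v, w} (\<Union>\<E>)" "\<forall>x\<in>{v, w}. \<forall>y\<in>{v, w}. dist (h x) (h y) = d x y"
    using iso unfolding isometric_spaces_def by (elim exE conjE) (rule that, simp_all only:)
  have U: "\<Union>\<E> = {h v, h w}" "\<Union>\<E> = {h w, h v}" "h v \<noteq> h w"
    using h(1) ne by (auto simp: bij_betw_def inj_on_def)
  have cell: "convex_cell dist \<Delta>" using \<Delta>(1) by (simp add: regular_simplex_def euclidean_simplex_def)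
  have "h v \<in> cell_vertices dist \<Delta>" "h w \<in> cell_vertices dist \<Delta>"
    using vertex_of_two_point_subcomplex[OF cell \<Delta>(2) U(1)] vertex_of_two_point_subcomplex[OF cell \<Delta>(2) U(2)] .
  then have "dist (h v) (h w) = s" using \<Delta>(1) U(3) unfolding regular_simplex_def by blast
  then show ?thesis using h(2) by simp
qed

text \<open>The faces of two cells form a finite subcomplex. Only the distances in its union matter; the
  isometry need not respect the cell structure.\<close>

lemma pair_embedding:
  assumes C: "C \<in> \<C>" and D: "D \<in> \<C>"
  obtains h :: "'z \<Rightarrow> nat eucl" where "isometric_on d (C \<union> D) h"
proof -
  let ?D = "{F. cell_face d F C} \<union> {F. cell_face d F D}"
  have "finite {F. cell_face d F A}" if "A \<in> \<C>" for A
    using convex_cell_chart[OF cell[OF that]] finite_cell_faces[OF cell[OF that]] by metis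
  then have fin: "finite ?D" using C D by simp
  have "subcomplex d \<C> ?D"
    unfolding subcomplex_def using face_mem[OF C] face_mem[OF D] cell_face_trans[OF cell[OF C]] cell_face_trans[OF cell[OF D]] by blast
  then obtain \<E> where iso: "isometric_spaces (\<Union>?D) d (\<Union>\<E>) (dist :: nat eucl \<Rightarrow> _)"
    using regular fin unfolding finite_subcomplexes_regular_def by meson
  have "C \<in> ?D" "D \<in> ?D" using cell_face_refl[OF cell] C D by auto
  then have "C \<union> D \<subseteq> \<Union>?D" by blast
  then show thesis
    using iso that unfolding isometric_spaces_def isometric_on_def by (meson subsetD)
qed

text \<open>A point is interior to at most one cell, and it is in the star of a vertex only if the vertex belongs to that cell.\<close>

lemma star_card:
  assumes "p \<in> Z"
  shows "finite {v \<in> complex_vertices d \<C>. p \<in> open_star d \<C> v} \<and>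
    card {v \<in> complex_vertices d \<C>. p \<in> open_star d \<C> v} \<le> n + 1" (is "finite ?S \<and> _")
proof (cases "?S = {}")
  case False
  then obtain v C where C: "C \<in> \<C>" "p \<in> cell_int d C" unfolding open_star_def by blast
  have "?S \<subseteq> cell_vertices d C"
  proof
    fix w assume "w \<in> ?S"
    then obtain D where w: "w \<in> complex_vertices d \<C>" and D: "D \<in> \<C>" "w \<in> D" "p \<in> cell_int d D"
      unfolding open_star_def by blast
    have pC: "p \<in> C" "p \<in> D" using C D by (auto simp: cell_int_def)
    have "D \<subseteq> C" using cell_int_imp_subset[OF D(1) C(1) D(3) pC(1)] .
    then show "w \<in> cell_vertices d C" using vertex_of_cell[OF w C(1)] D(2) by blast
  qed
  then show ?thesis
    using card_vertices[OF C(1)] card_mono finite_subset by (metis (no_types, lifting) order_trans)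
qed (simp only: finite.emptyI card.empty zero_le simp_thms)

text \<open>Every point is interior to the face spanned by the vertices with positive coordinates. Here regularity
  gives both that this is a face and that the point is in its relative interior.\<close>

lemma simplex_face:
  assumes D: "D \<in> \<C>" and q: "q \<in> D"
  obtains D' \<psi> b where "D' \<in> \<C>" "q \<in> cell_int d D'" "polytope_embedding d D' (\<psi> :: 'z \<Rightarrow> nat eucl)"
    "\<And>w. w \<in> cell_vertices d D' \<Longrightarrow> 0 \<le> b w" "sum b (cell_vertices d D') = 1"
    "\<psi> q = (\<Sum>w\<in>cell_vertices d D'. b w *\<^sub>R \<psi> w)"
proof -
  obtain \<psi> :: "'z \<Rightarrow> nat eucl" where \<psi>: "polytope_embedding d D \<psi>" "cell_chart d D \<psi>" using convex_cell_chart[OF cell[OF D]] .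
  let ?W = "cell_vertices d D"
  have fin: "finite ?W" using card_vertices(1)[OF D] .
  have WD: "?W \<subseteq> D" using cell_vertices_iff[OF cell[OF D] \<psi>(1)] by blast
  have eq: "equidistant s ?W \<psi>"
    unfolding equidistant_def
    using polytope_embedding_isometric[OF \<psi>(1)] WD vertex_dist vertices_subset[OF D]
    unfolding isometric_on_def by (metis subsetD)
  have "\<psi> q \<in> convex hull (\<psi> ` ?W)" using q cell_vertices_hull[OF cell[OF D] \<psi>(1)] by blast
  then obtain b where b: "\<psi> q = (\<Sum>w\<in>?W. b w *\<^sub>R \<psi> w)" "\<forall>w\<in>?W. 0 \<le> b w" "sum b ?W = 1"
    unfolding convex_hull_image_finite[OF fin] by (elim CollectE exE conjE) (rule that)
  let ?P = "{w\<in>?W. 0 < b w}"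
  have P: "\<psi> q = (\<Sum>w\<in>?P. b w *\<^sub>R \<psi> w)" "sum b ?P = 1"
    unfolding b(1) b(3)[symmetric] using b(2) fin
    by (intro sum.mono_neutral_right sum.mono_neutral_left; force)+
  have finP: "finite ?P" using fin by simp
  have ri: "\<psi> q \<in> rel_interior (convex hull (\<psi> ` ?P))"
    by (rule equidistant_rel_interior[OF finP equidistant_subset[OF eq] s _ P(2,1)]) auto
  define D' where "D' = {x \<in> D. \<psi> x \<in> convex hull (\<psi> ` ?P)}"
  have "convex hull (\<psi> ` ?P) \<subseteq> \<psi> ` D"
    unfolding cell_vertices_hull[OF cell[OF D] \<psi>(1)] by (intro hull_mono image_mono) auto
  then have im: "\<psi> ` D' = convex hull (\<psi> ` ?P)" unfolding D'_def by blast
  have "convex hull (\<psi> ` ?P) face_of \<psi> ` D"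
    unfolding cell_vertices_hull[OF cell[OF D] \<psi>(1)] by (rule equidistant_face[OF fin eq s]) auto
  moreover have qD': "q \<in> D'" using q ri rel_interior_subset unfolding D'_def by blast
  ultimately have face: "cell_face d D' D"
    unfolding cell_face_iff[OF cell[OF D] \<psi>(1)] im by (auto simp: D'_def)
  have D'C: "D' \<in> \<C>" using face_mem[OF D face] .
  have emb: "polytope_embedding d D' \<psi>" using polytope_embedding_face[OF cell[OF D] \<psi>(1) face] .
  have int: "q \<in> cell_int d D'" using cell_int_iff[OF cell[OF D'C] emb] qD' ri im by simp
  have "\<psi> q \<in> convex hull (\<psi> ` cell_vertices d D')"
    using qD' cell_vertices_hull[OF cell[OF D'C] emb] by blast
  then obtain b' where "\<psi> q = (\<Sum>w\<in>cell_vertices d D'. b' w *\<^sub>R \<psi> w)"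
    "\<forall>w\<in>cell_vertices d D'. 0 \<le> b' w" "sum b' (cell_vertices d D') = 1"
    unfolding convex_hull_image_finite[OF card_vertices(1)[OF D'C]] by blast
  then show thesis by (intro that[OF D'C int emb]) auto
qed

text \<open>Some barycentric coordinate of \<open>p\<close>, that of \<open>v\<close> say, is at least \<open>1 / (n + 1)\<close>. If \<open>q\<close> is interior to a
  simplex without the vertex \<open>v\<close>, an isometric picture of both simplices in one euclidean space shows that
  \<open>p\<close> and \<open>q\<close> are at distance at least \<open>s / (\<surd>2 (n + 1))\<close>.\<close>

lemma lebesgue_number:
  assumes p: "p \<in> Z"
  obtains v where "v \<in> complex_vertices d \<C>"
    "\<And>q. q \<in> Z \<Longrightarrow> d p q < s / (2 * (real n + 1)) \<Longrightarrow> q \<in> open_star d \<C> v"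
proof -
  obtain C0 where "C0 \<in> \<C>" "p \<in> C0" using p covers by blast
  then obtain C \<phi> a where C: "C \<in> \<C>" "p \<in> cell_int d C" "polytope_embedding d C (\<phi> :: 'z \<Rightarrow> nat eucl)"
    "\<And>v. v \<in> cell_vertices d C \<Longrightarrow> 0 \<le> a v" "sum a (cell_vertices d C) = 1"
    "\<phi> p = (\<Sum>v\<in>cell_vertices d C. a v *\<^sub>R \<phi> v)"
    by (rule simplex_face) (rule that)
  let ?V = "cell_vertices d C"
  have pC: "p \<in> C" using C(2) by (simp add: cell_int_def)
  obtain v where v: "v \<in> ?V" "1 \<le> a v * (real n + 1)"
  proof (rule ccontr)
    assume not: "\<not> thesis"
    have "a v < 1 / (real n + 1)" if "v \<in> ?V" for v
      using not that \<open>\<And>v. _ \<Longrightarrow> _ \<Longrightarrow> thesis\<close> by (force simp: field_simps)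
    moreover have "?V \<noteq> {}" using C(5) by auto
    ultimately have "sum a ?V < (\<Sum>v\<in>?V. 1 / (real n + 1))"
      using card_vertices(1)[OF C(1)] by (intro sum_strict_mono) auto
    also have "\<dots> = real (card ?V) / (real n + 1)" by simp
    also have "\<dots> \<le> 1" using card_vertices(2)[OF C(1)] by (simp add: field_simps)
    finally show False using C(5) by simp
  qed
  have vv: "v \<in> complex_vertices d \<C>" using v(1) vertices_subset[OF C(1)] by blast
  show thesis
  proof (rule that[OF vv])
    fix q assume q: "q \<in> Z" "d p q < s / (2 * (real n + 1))"
    obtain D0 where "D0 \<in> \<C>" "q \<in> D0" using q(1) covers by blast
    then obtain D \<psi> b where D: "D \<in> \<C>" "q \<in> cell_int d D" "polytope_embedding d D (\<psi> :: 'z \<Rightarrow> nat eucl)"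
      "\<And>v. v \<in> cell_vertices d D \<Longrightarrow> 0 \<le> b v" "sum b (cell_vertices d D) = 1"
      "\<psi> q = (\<Sum>v\<in>cell_vertices d D. b v *\<^sub>R \<psi> v)"
      by (rule simplex_face) (rule that)
    let ?W = "cell_vertices d D"
    have qD: "q \<in> D" using D(2) by (simp add: cell_int_def)
    have VC: "?V \<subseteq> C" and WD: "?W \<subseteq> D"
      using cell_vertices_iff[OF cell[OF C(1)] C(3)] cell_vertices_iff[OF cell[OF D(1)] D(3)] by blast+
    have "v \<in> D"
    proof (rule ccontr)
      assume "v \<notin> D"
      then have vW: "v \<notin> ?W" using WD by blast
      obtain h :: "'z \<Rightarrow> nat eucl" where h: "isometric_on d (C \<union> D) h" using pair_embedding[OF C(1) D(1)] .
      have hp: "h p = (\<Sum>v\<in>?V. a v *\<^sub>R h v)"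
        using VC by (intro isometric_on_affine_combination[OF polytope_embedding_isometric[OF C(3)] isometric_on_subset[OF h] pC _ C(5,6)]) auto
      have hq: "h q = (\<Sum>v\<in>?W. b v *\<^sub>R h v)"
        using WD by (intro isometric_on_affine_combination[OF polytope_embedding_isometric[OF D(3)] isometric_on_subset[OF h] qD _ D(5,6)]) auto
      let ?I = "?V \<union> ?W"
      let ?a = "\<lambda>i. if i \<in> ?V then a i else 0" and ?b = "\<lambda>i. if i \<in> ?W then b i else 0"
      have I: "finite ?I" using card_vertices(1) C(1) D(1) by simp
      have eq: "equidistant s ?I h"
        unfolding equidistant_def
      proof (intro ballI impI)
        fix i j assume ij: "i \<in> ?I" "j \<in> ?I" "i \<noteq> j"
        have "i \<in> complex_vertices d \<C>" "j \<in> complex_vertices d \<C>"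
          using ij vertices_subset[OF C(1)] vertices_subset[OF D(1)] by blast+
        then have "d i j = s" using vertex_dist ij(3) by blast
        moreover have "i \<in> C \<union> D" "j \<in> C \<union> D" using ij VC WD by blast+
        ultimately show "dist (h i) (h j) = s" using h unfolding isometric_on_def by simp
      qed
      have sums: "sum ?a ?I = 1" "sum ?b ?I = 1"
        using C(5) D(5) I by (simp_all add: sum.If_cases Int_absorb1)
      have hp': "h p = (\<Sum>i\<in>?I. ?a i *\<^sub>R h i)"
        unfolding hp using I by (intro sum.mono_neutral_cong_left) auto
      have hq': "h q = (\<Sum>i\<in>?I. ?b i *\<^sub>R h i)"
        unfolding hq using I by (intro sum.mono_neutral_cong_left) auto
      have vI: "v \<in> ?I" using v(1) by blast
      have "s\<^sup>2 / 2 * (?a v - ?b v)\<^sup>2 \<le> (dist (h p) (h q))\<^sup>2"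
        by (rule equidistant_coeff_le[OF I vI eq _ hp' hq']) (simp only: sums)
      moreover have "dist (h p) (h q) = d p q" using h pC qD unfolding isometric_on_def by simp
      ultimately have le: "s\<^sup>2 / 2 * (a v)\<^sup>2 \<le> (d p q)\<^sup>2" using v(1) vW by simp
      have "1 / (real n + 1) \<le> a v" using v(2) by (simp add: field_simps)
      then have "(1 / (real n + 1))\<^sup>2 \<le> (a v)\<^sup>2" by (intro power_mono) auto
      then have "s\<^sup>2 / 2 * (1 / (real n + 1))\<^sup>2 \<le> s\<^sup>2 / 2 * (a v)\<^sup>2" by (intro mult_left_mono) auto
      moreover have "(s / (2 * (real n + 1)))\<^sup>2 = s\<^sup>2 / 4 * (1 / (real n + 1))\<^sup>2"
        by (simp only: power_divide power_mult_distrib) simp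
      moreover have "s\<^sup>2 / 4 * (1 / (real n + 1))\<^sup>2 \<le> s\<^sup>2 / 2 * (1 / (real n + 1))\<^sup>2"
        by (intro mult_right_mono) auto
      ultimately have "(s / (2 * (real n + 1)))\<^sup>2 \<le> (d p q)\<^sup>2" using le by linarith
      then have "s / (2 * (real n + 1)) \<le> d p q"
        by (rule power2_le_imp_le) (rule Metric_space.nonneg[OF metric])
      then show False using q(2) by simp
    qed
    then show "q \<in> open_star d \<C> v" unfolding open_star_def using D(1,2) by blast
  qed
qed

end

section \<open>From maps into simplicial complexes to coverings\<close>

lemma maps_to_simplicial_imp_nagata:
  assumes X: "Metric_space X d" and maps: "maps_to_simplicial_complexes TYPE('y) X d n"
  shows "nagata_property X d (int n)"
proof -
  obtain c where c: "c > 0" and ex: "\<forall>s>0. \<exists>(Y :: 'y set) dY \<C> f.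
        simplicial_complex Y dY \<C> \<and> complex_dim dY \<C> \<le> enat n \<and>
        finite_subcomplexes_regular s dY \<C> \<and>
        nonexpanding X d Y dY f \<and>
        (\<forall>y\<in>complex_vertices dY \<C>. ediam d (f -` open_star dY \<C> y \<inter> X) \<le> ennreal (c * s))"
    using maps unfolding maps_to_simplicial_complexes_def by blast
  \<comment> \<open>At edge length \<open>?k * s\<close> the Lebesgue number is \<open>2 * s\<close>, which exceeds \<open>s\<close>.\<close>
  let ?k = "4 * (real n + 1)"
  show ?thesis
    unfolding nagata_property_nat_iff
  proof (rule exI[of _ "c * ?k"], intro conjI allI impI)
    fix s :: real assume s: "s > 0"
    then have ks: "?k * s > 0" by simp
    obtain Y :: "'y set" and dY \<C> f where Y: "simplicial_complex Y dY \<C>" "complex_dim dY \<C> \<le> enat n"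
        "finite_subcomplexes_regular (?k * s) dY \<C>" "nonexpanding X d Y dY f"
        "\<forall>y\<in>complex_vertices dY \<C>. ediam d (f -` open_star dY \<C> y \<inter> X) \<le> ennreal (c * (?k * s))"
      using ex[rule_format, OF ks] by (elim exE conjE) (rule that)
    interpret Y: regular_complex Y dY \<C> "?k * s" n
      using Y(1-3) ks by unfold_locales (simp_all add: simplicial_complex_def)
    have f: "f ` X \<subseteq> Y" "\<And>x x'. x \<in> X \<Longrightarrow> x' \<in> X \<Longrightarrow> dY (f x) (f x') \<le> d x x'"
      using Y(4) by (simp_all add: nonexpanding_def)
    let ?V = "complex_vertices dY \<C>"
    define B where "B v = {x \<in> X. \<forall>q\<in>Y. dY (f x) q < 2 * s \<longrightarrow> q \<in> open_star dY \<C> v}" for v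
    have star: "f x' \<in> open_star dY \<C> v" if "x \<in> B v" "x' \<in> X" "d x x' \<le> s" for x x' v
      using that f(1) f(2)[of x x'] s unfolding B_def by auto
    have cov: "covering X (B ` ?V)"
      unfolding covering_def
    proof
      show "\<Union> (B ` ?V) \<subseteq> X" by (auto simp: B_def)
      show "X \<subseteq> \<Union> (B ` ?V)"
      proof
        fix x assume x: "x \<in> X"
        then have "f x \<in> Y" using f(1) by blast
        then obtain v where v: "v \<in> ?V" "\<And>q. q \<in> Y \<Longrightarrow> dY (f x) q < ?k * s / (2 * (real n + 1)) \<Longrightarrow> q \<in> open_star dY \<C> v"
          by (rule Y.lebesgue_number) (rule that)
        have "?k * s / (2 * (real n + 1)) = 2 * s" by (simp add: divide_simps)
        then have "x \<in> B v" using v(2) x by (simp add: B_def)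
        then show "x \<in> \<Union> (B ` ?V)" using v(1) by blast
      qed
    qed
    have bdd: "bounded_family d (c * ?k * s) (B ` ?V) (\<lambda>B. B)"
      unfolding bounded_family_def
    proof
      fix A assume "A \<in> B ` ?V"
      then obtain v where v: "v \<in> ?V" "A = B v" by auto
      have "A \<subseteq> f -` open_star dY \<C> v \<inter> X"
        using star[of _ v] Metric_space.mdist_zero[OF X] s unfolding v(2) by (auto simp: B_def)
      then have "ediam d A \<le> ediam d (f -` open_star dY \<C> v \<inter> X)" by (rule ediam_mono)
      also have "\<dots> \<le> ennreal (c * (?k * s))" using Y(5) v(1) by blast
      finally show "ediam d A \<le> ennreal (c * ?k * s)" by (simp add: mult.assoc)
    qed
    have mult: "multiplicity_at_scale X d s (B ` ?V) (\<lambda>B. B) \<le> enat (n + 1)"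
      unfolding multiplicity_at_scale_le_iff
    proof (intro allI impI)
      fix S assume S: "S \<subseteq> X" "ediam d S \<le> ennreal s"
      then have dS: "d x y \<le> s" if "x \<in> S" "y \<in> S" for x y
        using that s Metric_space.nonneg[OF X] by (simp add: ediam_le_iff)
      let ?A = "{A \<in> B ` ?V. A \<inter> S \<noteq> {}}"
      show "finite ?A \<and> card ?A \<le> n + 1"
      proof (cases "S = {}")
        case False
        then obtain x0 where x0: "x0 \<in> S" by blast
        let ?T = "{v \<in> ?V. f x0 \<in> open_star dY \<C> v}"
        have "?A \<subseteq> B ` ?T"
        proof
          fix A assume "A \<in> ?A"
          then obtain v x where v: "v \<in> ?V" "A = B v" "x \<in> B v" "x \<in> S" by blast
          then have "f x0 \<in> open_star dY \<C> v" using star[OF v(3)] x0 S(1) dS by blast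
          then show "A \<in> B ` ?T" using v by blast
        qed
        moreover have "f x0 \<in> Y" using x0 S(1) f(1) by blast
        note Y.star_card[OF this]
        ultimately show ?thesis
          by (meson card_image_le card_mono finite_imageI finite_subset order_trans)
      qed simp
    qed
    show "\<exists>\<B>. covering X \<B> \<and> bounded_family d (c * ?k * s) \<B> (\<lambda>B. B) \<and>
        multiplicity_at_scale X d s \<B> (\<lambda>B. B) \<le> enat (n + 1)"
      using cov bdd mult by blast
  qed (use c in simp)
qed

section \<open>Coordinates\<close>

definition coord :: "'i eucl \<Rightarrow> 'i \<Rightarrow> real" where
  "coord z i = Poly_Mapping.lookup (coords z) i"

definition unit :: "'i \<Rightarrow> 'i eucl" where
  "unit i = Eucl (Poly_Mapping.single i 1)"

definition supp :: "'i eucl \<Rightarrow> 'i set" where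
  "supp z = {i. coord z i \<noteq> 0}"

lemma supp_keys: "supp z = Poly_Mapping.keys (coords z)"
  by (auto simp: supp_def coord_def in_keys_iff)

lemma finite_supp: "finite (supp z)"
  by (simp add: supp_keys)

lemma coord_0: "coord 0 i = 0" and coord_add: "coord (x + y) i = coord x i + coord y i"
  and coord_diff: "coord (x - y) i = coord x i - coord y i" and coord_scaleR: "coord (c *\<^sub>R x) i = c * coord x i"
  by (simp_all add: coord_def zero_eucl.rep_eq plus_eucl.rep_eq minus_eucl.rep_eq scaleR_eucl.rep_eq
      lookup_add lookup_minus lookup_scaleR_poly_mapping)

lemma coord_unit: "coord (unit i) j = (if i = j then 1 else 0)"
  by (simp add: coord_def unit_def Eucl_inverse lookup_single when_def)

lemma coord_sum: "coord (\<Sum>a\<in>A. f a) i = (\<Sum>a\<in>A. coord (f a) i)"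
  by (induction A rule: infinite_finite_induct) (simp_all add: coord_0 coord_add)

lemmas coord_simps = coord_0 coord_add coord_diff coord_scaleR coord_unit coord_sum

lemma eucl_eqI: "(\<And>i. coord x i = coord y i) \<Longrightarrow> x = y"
  unfolding coord_def by (rule coords_inject[THEN iffD1], rule poly_mapping_eqI)

lemma coord_unit_sum:
  "finite V \<Longrightarrow> coord (\<Sum>v\<in>V. c v *\<^sub>R unit v) i = (if i \<in> V then c i else 0)"
  by (simp add: coord_simps if_distrib[of "\<lambda>x. _ * x"] cong: if_cong)

lemma eucl_expand:
  assumes "finite V" "supp z \<subseteq> V"
  shows "z = (\<Sum>v\<in>V. coord z v *\<^sub>R unit v)"
  using assms by (intro eucl_eqI) (auto simp: coord_unit_sum supp_def)

lemma inner_unit: "inner z (unit i) = coord z i"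
proof -
  have "inner (unit i) z = (\<Sum>j\<in>{i}. Poly_Mapping.lookup (coords (unit i)) j * Poly_Mapping.lookup (coords z) j)"
    by (rule inner_eucl_superset) (auto simp: coord_unit simp flip: supp_keys, simp add: supp_def coord_unit split: if_splits)
  also have "\<dots> = coord (unit i) i * coord z i" by (simp add: coord_def)
  finally show ?thesis by (simp add: inner_commute coord_unit)
qed

lemma norm_unit: "norm (unit i) = 1"
  by (simp add: norm_eq_sqrt_inner inner_unit coord_unit)

lemma coord_le_norm: "\<bar>coord z i\<bar> \<le> norm z"
  using Cauchy_Schwarz_ineq2[of z "unit i"] by (simp add: inner_unit norm_unit)

lemma norm_unit_sum:
  assumes "finite V" "inj_on \<iota> V"
  shows "(norm (\<Sum>v\<in>V. c v *\<^sub>R unit (\<iota> v)))\<^sup>2 = (\<Sum>v\<in>V. (c v)\<^sup>2)"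
proof -
  have "(norm (\<Sum>v\<in>V. c v *\<^sub>R unit (\<iota> v)))\<^sup>2 = (\<Sum>v\<in>V. c v * (\<Sum>w\<in>V. c w * (if \<iota> v = \<iota> w then 1 else 0)))"
    unfolding power2_norm_eq_inner inner_sum_left sum_distrib_left unfolding inner_sum_right
    by (intro sum.cong refl) (simp add: inner_unit coord_unit coord_scaleR)
  also have "\<dots> = (\<Sum>v\<in>V. c v * (\<Sum>w\<in>V. if w = v then c w else 0))"
    using assms(2) by (intro sum.cong refl arg_cong2[of _ _ _ _ "(*)"]) (auto dest: inj_onD)
  also have "\<dots> = (\<Sum>v\<in>V. (c v)\<^sup>2)" using assms(1) by (simp add: power2_eq_square)
  finally show ?thesis .
qed

lemma norm_le_sum_coord:
  assumes "finite V" "supp z \<subseteq> V"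
  shows "norm z \<le> (\<Sum>v\<in>V. \<bar>coord z v\<bar>)"
proof -
  have "norm z = norm (\<Sum>v\<in>V. coord z v *\<^sub>R unit v)" using eucl_expand[OF assms] by simp
  also have "\<dots> \<le> (\<Sum>v\<in>V. norm (coord z v *\<^sub>R unit v))" by (rule norm_sum)
  finally show ?thesis by (simp add: norm_unit)
qed

text \<open>A partial isometry between euclidean spaces with different index sets; with natural numbers as target it
  produces charts.\<close>

definition relabel :: "'i set \<Rightarrow> ('i \<Rightarrow> 'j) \<Rightarrow> 'i eucl \<Rightarrow> 'j eucl" where
  "relabel V \<iota> z = (\<Sum>v\<in>V. coord z v *\<^sub>R unit (\<iota> v))"

lemma linear_relabel: "linear (relabel V \<iota>)"
  by (rule linearI) (simp_all add: relabel_def coord_simps scaleR_add_left sum.distrib scaleR_sum_right)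

lemma relabel_unit: "finite V \<Longrightarrow> v \<in> V \<Longrightarrow> relabel V \<iota> (unit v) = unit (\<iota> v)"
  by (simp add: relabel_def coord_unit if_distrib[of "\<lambda>c. c *\<^sub>R _"] cong: if_cong)

lemma dist_relabel:
  assumes "finite V" "inj_on \<iota> V" "supp x \<subseteq> V" "supp y \<subseteq> V"
  shows "dist (relabel V \<iota> x) (relabel V \<iota> y) = dist x y"
proof -
  have "relabel V \<iota> x - relabel V \<iota> y = (\<Sum>v\<in>V. (coord x v - coord y v) *\<^sub>R unit (\<iota> v))"
    by (simp add: relabel_def scaleR_diff_left sum_subtractf)
  moreover have "x - y = (\<Sum>v\<in>V. (coord x v - coord y v) *\<^sub>R unit v)"
    using eucl_expand[OF assms(1,3)] eucl_expand[OF assms(1,4)] by (simp add: scaleR_diff_left sum_subtractf)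
  ultimately have "(norm (relabel V \<iota> x - relabel V \<iota> y))\<^sup>2 = (norm (x - y))\<^sup>2"
    using norm_unit_sum[OF assms(1,2), of "\<lambda>v. coord x v - coord y v"]
      norm_unit_sum[OF assms(1) inj_on_id2[of V], of "\<lambda>v. coord x v - coord y v"] by simp
  then show ?thesis unfolding dist_norm by (rule power2_eq_imp_eq) auto
qed

section \<open>Skeleta of regular simplices\<close>

text \<open>The regular simplex with vertices \<open>R e\<^sub>v\<close>, of edge length \<open>R \<surd>2\<close>; its points are the nonnegative functions on \<open>V\<close> with
  sum \<open>R\<close>.\<close>

definition simplex_on :: "real \<Rightarrow> 'i set \<Rightarrow> 'i eucl set" where
  "simplex_on R V = convex hull ((\<lambda>v. R *\<^sub>R unit v) ` V)"

definition skeleton :: "real \<Rightarrow> nat \<Rightarrow> 'i eucl set set" where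
  "skeleton R n = {simplex_on R V | V. finite V \<and> V \<noteq> {} \<and> card V \<le> n + 1}"

lemma equidistant_unit:
  assumes "0 < R" shows "equidistant (R * sqrt 2) I (\<lambda>v. R *\<^sub>R unit v)"
  unfolding equidistant_def
proof (intro ballI impI)
  fix i j :: 'a assume "i \<noteq> j"
  then have "(norm (unit i - unit j))\<^sup>2 = 2"
    by (simp add: power2_norm_eq_inner inner_diff inner_unit coord_simps)
  then have "norm (unit i - unit j) = sqrt 2" by (metis norm_ge_zero real_sqrt_unique)
  then show "dist (R *\<^sub>R unit i) (R *\<^sub>R unit j) = R * sqrt 2"
    using assms by (simp add: dist_norm flip: scaleR_diff_right)
qed

context
  fixes R :: real assumes R: "0 < R"
begin

lemma simplex_on_iff:
  assumes V: "finite V"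
  shows "z \<in> simplex_on R V \<longleftrightarrow> supp z \<subseteq> V \<and> (\<forall>v. 0 \<le> coord z v) \<and> (\<Sum>v\<in>V. coord z v) = R"
proof
  assume "z \<in> simplex_on R V"
  then obtain a where a: "z = (\<Sum>v\<in>V. a v *\<^sub>R (R *\<^sub>R unit v))" "\<forall>v\<in>V. 0 \<le> a v" "sum a V = 1"
    unfolding simplex_on_def convex_hull_image_finite[OF V] by (elim CollectE exE conjE) (rule that)
  have c: "coord z v = (if v \<in> V then a v * R else 0)" for v
    unfolding a(1) scaleR_scaleR by (rule coord_unit_sum[OF V])
  have "(\<Sum>v\<in>V. coord z v) = R" using a(3) by (simp add: c flip: sum_distrib_right)
  then show "supp z \<subseteq> V \<and> (\<forall>v. 0 \<le> coord z v) \<and> (\<Sum>v\<in>V. coord z v) = R"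
    using a(2) R by (auto simp: c supp_def)
next
  assume z: "supp z \<subseteq> V \<and> (\<forall>v. 0 \<le> coord z v) \<and> (\<Sum>v\<in>V. coord z v) = R"
  have "z = (\<Sum>v\<in>V. (coord z v / R) *\<^sub>R (R *\<^sub>R unit v))"
    using eucl_expand[OF V, of z] z R by simp
  moreover have "(\<Sum>v\<in>V. coord z v / R) = 1" using z R by (simp flip: sum_divide_distrib)
  ultimately show "z \<in> simplex_on R V"
    unfolding simplex_on_def convex_hull_image_finite[OF V] using z R
    by (intro CollectI exI[of _ "\<lambda>v. coord z v / R"]) simp
qed

lemma unit_in_simplex_on: "finite V \<Longrightarrow> R *\<^sub>R unit v \<in> simplex_on R V \<longleftrightarrow> v \<in> V"
  using R by (auto simp: simplex_on_iff coord_simps supp_def if_distrib[of "\<lambda>x. _ * x"] cong: if_cong)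

lemma simplex_on_inj:
  assumes "finite V" "finite W" "simplex_on R V = simplex_on R W"
  shows "V = W"
  using unit_in_simplex_on[OF assms(1)] unit_in_simplex_on[OF assms(2)] assms(3) by (intro set_eqI) simp

lemma simplex_on_Int:
  assumes "finite V" "finite W"
  shows "simplex_on R V \<inter> simplex_on R W = simplex_on R (V \<inter> W)"
proof -
  have "(\<Sum>v\<in>V. coord z v) = (\<Sum>v\<in>V \<inter> W. coord z v)" "(\<Sum>v\<in>W. coord z v) = (\<Sum>v\<in>V \<inter> W. coord z v)"
    if "supp z \<subseteq> V \<inter> W" for z
    using that assms by (auto intro!: sum.mono_neutral_right simp: supp_def)
  then show ?thesis using assms by (auto simp: simplex_on_iff)
qed

lemma Metric_space_dist: "Metric_space A (dist :: 'i::metric_space \<Rightarrow> _)"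
  by (rule Metric_space.subspace[OF Met_TC.Metric_space_axioms subset_UNIV])

context
  fixes V :: "'i set" assumes V: "finite V" "V \<noteq> {}"
begin

lemma simplex_on_embedding: "polytope_embedding dist (simplex_on R V) (\<lambda>x. x)"
  unfolding polytope_embedding_def isometric_on_def simplex_on_def
  using V by (intro conjI ballI refl exI[of _ "(\<lambda>v. R *\<^sub>R unit v) ` V"]) simp_all

text \<open>The chart relabels the vertices by natural numbers; the structure of the cell is computed with the identity
  embedding instead.\<close>

lemma simplex_on_cell: "convex_cell dist (simplex_on R V)"
proof -
  obtain \<iota> :: "'i \<Rightarrow> nat" where \<iota>: "inj_on \<iota> V" using V(1) finite_imp_inj_to_nat_seg by blast
  have "isometric_on dist (simplex_on R V) (relabel V \<iota>)"
    unfolding isometric_on_def using dist_relabel[OF V(1) \<iota>] simplex_on_iff[OF V(1)] by blast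
  moreover have "relabel V \<iota> ` simplex_on R V = convex hull (relabel V \<iota> ` (\<lambda>v. R *\<^sub>R unit v) ` V)"
    unfolding simplex_on_def by (rule convex_hull_linear_image[OF linear_relabel])
  ultimately have "cell_chart dist (simplex_on R V) (relabel V \<iota>)"
    unfolding cell_chart_iff polytope_embedding_def using V by (metis finite_imageI image_is_empty)
  then show ?thesis unfolding convex_cell_def using Metric_space_dist by blast
qed

lemma simplex_on_face_iff:
  "cell_face dist F (simplex_on R V) \<longleftrightarrow> (\<exists>W\<subseteq>V. W \<noteq> {} \<and> F = simplex_on R W)"
proof
  assume "cell_face dist F (simplex_on R V)"
  then have F: "F \<noteq> {}" "F face_of simplex_on R V"
    using cell_face_iff[OF simplex_on_cell simplex_on_embedding] by simp_all
  let ?W = "{v \<in> V. R *\<^sub>R unit v \<in> F}"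
  have "F = convex hull (F \<inter> (\<lambda>v. R *\<^sub>R unit v) ` V)"
    using F(2) V(1) unfolding simplex_on_def by (intro face_of_convex_hull_eq) auto
  moreover have "F \<inter> (\<lambda>v. R *\<^sub>R unit v) ` V = (\<lambda>v. R *\<^sub>R unit v) ` ?W" by blast
  ultimately have "F = simplex_on R ?W" unfolding simplex_on_def by simp
  moreover have "?W \<noteq> {}" using F(1) calculation unfolding simplex_on_def by (metis convex_hull_empty image_empty)
  ultimately show "\<exists>W\<subseteq>V. W \<noteq> {} \<and> F = simplex_on R W" by (intro exI[of _ ?W]) blast
next
  assume "\<exists>W\<subseteq>V. W \<noteq> {} \<and> F = simplex_on R W"
  then obtain W where W: "W \<subseteq> V" "W \<noteq> {}" "F = simplex_on R W" by blast
  have "F face_of simplex_on R V"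
    unfolding W(3) simplex_on_def
    using R by (intro equidistant_face[OF V(1) equidistant_unit[OF R] _ W(1)]) auto
  moreover have "F \<noteq> {}" unfolding W(3) simplex_on_def using W(2) by simp
  ultimately show "cell_face dist F (simplex_on R V)"
    using cell_face_iff[OF simplex_on_cell simplex_on_embedding] face_of_imp_subset by auto
qed

lemma simplex_on_vertices: "cell_vertices dist (simplex_on R V) = (\<lambda>v. R *\<^sub>R unit v) ` V"
proof
  show "cell_vertices dist (simplex_on R V) \<subseteq> (\<lambda>v. R *\<^sub>R unit v) ` V"
  proof
    fix x assume "x \<in> cell_vertices dist (simplex_on R V)"
    then obtain W where W: "W \<subseteq> V" "W \<noteq> {}" "{x} = simplex_on R W"
      unfolding cell_vertices_def simplex_on_face_iff by blast
    obtain v where "v \<in> W" using W(2) by blast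
    moreover have "finite W" using W(1) V(1) finite_subset by blast
    ultimately have "R *\<^sub>R unit v \<in> {x}" unfolding W(3) by (simp add: unit_in_simplex_on)
    then show "x \<in> (\<lambda>v. R *\<^sub>R unit v) ` V" using W(1) \<open>v \<in> W\<close> by blast
  qed
  show "(\<lambda>v. R *\<^sub>R unit v) ` V \<subseteq> cell_vertices dist (simplex_on R V)"
  proof
    fix x assume "x \<in> (\<lambda>v. R *\<^sub>R unit v) ` V"
    then obtain v where v: "v \<in> V" "x = R *\<^sub>R unit v" by (rule imageE)
    have "cell_face dist {x} (simplex_on R V)"
      unfolding simplex_on_face_iff using v by (intro exI[of _ "{v}"]) (simp add: simplex_on_def)
    then show "x \<in> cell_vertices dist (simplex_on R V)" by (simp add: cell_vertices_def)
  qed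
qed

lemma unit_inj: "inj_on (\<lambda>v. R *\<^sub>R unit v) A"
proof (rule inj_onI)
  fix v w assume "R *\<^sub>R unit v = R *\<^sub>R unit w"
  then have "coord (unit v) v = coord (unit w) v" using R by simp
  then show "v = w" by (simp add: coord_unit split: if_splits)
qed

lemma simplex_on_dim: "cell_dim dist (simplex_on R V) = card V - 1"
proof -
  obtain z0 where z0: "z0 \<in> V" using V(2) by blast
  let ?B = "(\<lambda>v. unit v - unit z0) ` (V - {z0})"
  let ?D = "{x - y | x y. x \<in> simplex_on R V \<and> y \<in> simplex_on R V}"
  have coordB: "coord (\<Sum>v\<in>V - {z0}. c v *\<^sub>R (unit v - unit z0)) i = c i" if "i \<in> V - {z0}" for i c
  proof -
    have "z0 \<noteq> i" using that by blast
    then have "coord (\<Sum>v\<in>V - {z0}. c v *\<^sub>R (unit v - unit z0)) i = (\<Sum>v\<in>V - {z0}. if v = i then c v else 0)"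
      unfolding coord_simps using that by (intro sum.cong refl) simp
    then show ?thesis using that V(1) by simp
  qed
  have injB: "inj_on (\<lambda>v. unit v - unit z0) (V - {z0})"
  proof (rule inj_onI)
    fix v w assume "unit v - unit z0 = (unit w - unit z0 :: 'i eucl)"
    then have "R *\<^sub>R unit v = R *\<^sub>R (unit w :: 'i eucl)" by simp
    then show "v = w" using inj_onD[OF unit_inj[of UNIV], of v w] by simp
  qed
  have "independent ?B"
  proof (rule independent_if_scalars_zero)
    show "finite ?B" using V(1) by simp
    fix f x assume sum: "(\<Sum>x\<in>?B. f x *\<^sub>R x) = 0" and x: "x \<in> ?B"
    obtain v where v: "v \<in> V - {z0}" "x = unit v - unit z0" using x by blast
    have "(\<Sum>v\<in>V - {z0}. f (unit v - unit z0) *\<^sub>R (unit v - unit z0)) = 0"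
      using sum by (simp add: sum.reindex[OF injB])
    then have "f (unit v - unit z0) = coord 0 v" using coordB[OF v(1), of "\<lambda>v. f (unit v - unit z0)"] by simp
    then show "f x = 0" using v(2) by (simp add: coord_0)
  qed
  moreover have BD: "?D \<subseteq> span ?B"
  proof
    fix z assume "z \<in> ?D"
    then obtain x y where xy: "z = x - y" "x \<in> simplex_on R V" "y \<in> simplex_on R V" by blast
    then have z: "supp z \<subseteq> V" "(\<Sum>v\<in>V. coord z v) = 0"
      using simplex_on_iff[OF V(1)] by (auto simp: coord_diff sum_subtractf supp_def subset_iff) (metis+)
    have "z = (\<Sum>v\<in>V. coord z v *\<^sub>R unit v) - (\<Sum>v\<in>V. coord z v) *\<^sub>R unit z0"
      using eucl_expand[OF V(1) z(1)] z(2) by simp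
    also have "\<dots> = (\<Sum>v\<in>V. coord z v *\<^sub>R (unit v - unit z0))"
      by (simp add: scaleR_diff_right sum_subtractf scaleR_sum_left)
    also have "\<dots> = (\<Sum>v\<in>V - {z0}. coord z v *\<^sub>R (unit v - unit z0))"
      using V(1) by (intro sum.mono_neutral_right) auto
    also have "\<dots> \<in> span ?B" by (intro span_sum span_scale span_base) auto
    finally show "z \<in> span ?B" .
  qed
  moreover have "?B \<subseteq> span ?D"
  proof
    fix x assume "x \<in> ?B"
    then obtain v where v: "v \<in> V" "x = unit v - unit z0" by blast
    have "R *\<^sub>R unit v - R *\<^sub>R unit z0 \<in> ?D" using v(1) z0 unit_in_simplex_on[OF V(1)] by blast
    then have "(1 / R) *\<^sub>R (R *\<^sub>R unit v - R *\<^sub>R unit z0) \<in> span ?D" by (intro span_scale span_base)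
    then show "x \<in> span ?D" using v(2) R by (simp add: scaleR_diff_right)
  qed
  ultimately have "dim ?D = card ?B"
    using real_vector.dim_eq_card[of ?B ?D] span_mono[OF BD] span_mono[of ?B "span ?D"] by (simp add: subset_antisym span_span)
  also have "\<dots> = card V - 1" using card_image[OF injB] V(1) z0 by simp
  finally show ?thesis using cell_dim_eq[OF simplex_on_cell simplex_on_embedding] by simp
qed

lemma simplex_on_euclidean: "euclidean_simplex dist (simplex_on R V)"
proof -
  have "card V > 0" using V by (simp add: card_gt_0_iff)
  then show ?thesis
    unfolding euclidean_simplex_def simplex_on_dim simplex_on_vertices card_image[OF unit_inj]
    using simplex_on_cell by simp
qed

lemma coord_barycenter: "coord (barycenter dist (simplex_on R V)) i = (if i \<in> V then R / card V else 0)"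
proof -
  have "barycenter dist (simplex_on R V) = (\<Sum>v\<in>V. (R / card V) *\<^sub>R unit v)"
    using barycenter_eq(2)[OF simplex_on_cell simplex_on_embedding]
    unfolding simplex_on_vertices card_image[OF unit_inj] by (simp add: sum.reindex[OF unit_inj])
  then show ?thesis using V(1) by (simp add: coord_unit_sum)
qed

end

lemma skeletonE:
  assumes "C \<in> skeleton R n"
  obtains V where "finite V" "V \<noteq> {}" "card V \<le> n + 1" "C = simplex_on R V"
  using assms unfolding skeleton_def by blast

lemma skeletonI: "finite V \<Longrightarrow> V \<noteq> {} \<Longrightarrow> card V \<le> n + 1 \<Longrightarrow> simplex_on R V \<in> skeleton R n"
  unfolding skeleton_def by blast

lemma skeleton_space: "z \<in> \<Union>(skeleton R n) \<longleftrightarrow>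
  card (supp z) \<le> n + 1 \<and> (\<forall>v. 0 \<le> coord z v) \<and> (\<Sum>v\<in>supp z. coord z v) = R"
proof
  assume "z \<in> \<Union>(skeleton R n)"
  then obtain V where V: "finite V" "card V \<le> n + 1" "z \<in> simplex_on R V" by (blast elim: skeletonE)
  then have z: "supp z \<subseteq> V" "\<forall>v. 0 \<le> coord z v" "(\<Sum>v\<in>V. coord z v) = R" using simplex_on_iff by blast+
  moreover have "(\<Sum>v\<in>V. coord z v) = (\<Sum>v\<in>supp z. coord z v)"
    using z(1) V(1) by (intro sum.mono_neutral_right) (auto simp: supp_def)
  ultimately show "card (supp z) \<le> n + 1 \<and> (\<forall>v. 0 \<le> coord z v) \<and> (\<Sum>v\<in>supp z. coord z v) = R"
    using card_mono[OF V(1) z(1)] V(2) by simp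
next
  assume z: "card (supp z) \<le> n + 1 \<and> (\<forall>v. 0 \<le> coord z v) \<and> (\<Sum>v\<in>supp z. coord z v) = R"
  then have "z \<in> simplex_on R (supp z)" using simplex_on_iff[OF finite_supp] by blast
  moreover have "supp z \<noteq> {}" using z R by auto
  ultimately show "z \<in> \<Union>(skeleton R n)" using z by (intro UnionI[OF skeletonI[OF finite_supp]]) simp_all
qed

lemma skeleton_complex: "simplicial_complex (\<Union>(skeleton R n)) dist (skeleton R n :: 'i eucl set set)"
  unfolding simplicial_complex_def polyhedral_complex_def
proof (intro conjI ballI allI impI)
  fix C :: "'i eucl set" assume "C \<in> skeleton R n"
  then obtain V where V: "finite V" "V \<noteq> {}" "card V \<le> n + 1" "C = simplex_on R V" by (rule skeletonE)
  show "convex_cell dist C" "euclidean_simplex dist C"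
    unfolding V(4) using simplex_on_cell[OF V(1,2)] simplex_on_euclidean[OF V(1,2)] .
  show "F \<in> skeleton R n" if "cell_face dist F C" for F
  proof -
    obtain W where W: "W \<subseteq> V" "W \<noteq> {}" "F = simplex_on R W"
      using \<open>cell_face dist F C\<close> unfolding V(4) simplex_on_face_iff[OF V(1,2)] by blast
    then show ?thesis
      using skeletonI[OF finite_subset[OF W(1) V(1)] W(2)] card_mono[OF V(1) W(1)] V(3) by simp
  qed
  fix D :: "'i eucl set" assume "D \<in> skeleton R n"
  then obtain W where W: "finite W" "W \<noteq> {}" "card W \<le> n + 1" "D = simplex_on R W" by (rule skeletonE)
  have Int: "C \<inter> D = simplex_on R (V \<inter> W)" unfolding V(4) W(4) using V(1) W(1) by (rule simplex_on_Int)
  show "C \<inter> D = {} \<or> cell_face dist (C \<inter> D) C \<and> cell_face dist (C \<inter> D) D"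
  proof (cases "V \<inter> W = {}")
    case True
    then show ?thesis unfolding Int by (simp add: simplex_on_def)
  next
    case False
    then have "cell_face dist (C \<inter> D) C" "cell_face dist (C \<inter> D) D"
      unfolding Int unfolding V(4) W(4) simplex_on_face_iff[OF V(1,2)] simplex_on_face_iff[OF W(1,2)] by blast+
    then show ?thesis by blast
  qed
qed (simp_all add: Metric_space_dist)

lemma skeleton_dim: "complex_dim dist (skeleton R n) \<le> enat n"
  unfolding complex_dim_def
proof (rule SUP_least)
  fix C :: "'i eucl set" assume "C \<in> skeleton R n"
  then obtain V where V: "finite V" "V \<noteq> {}" "card V \<le> n + 1" "C = simplex_on R V" by (rule skeletonE)
  show "enat (cell_dim dist C) \<le> enat n" unfolding V(4) simplex_on_dim[OF V(1,2)] using V(3) by simp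
qed

lemma simplex_on_regular: "finite V \<Longrightarrow> V \<noteq> {} \<Longrightarrow> regular_simplex (R * sqrt 2) (simplex_on R V)"
  unfolding regular_simplex_def
proof (intro conjI ballI impI)
  assume V: "finite V" "V \<noteq> {}"
  show "euclidean_simplex dist (simplex_on R V)" using V by (rule simplex_on_euclidean)
  fix x y assume "x \<in> cell_vertices dist (simplex_on R V)" "y \<in> cell_vertices dist (simplex_on R V)" and ne: "x \<noteq> y"
  then obtain i j where ij: "x = R *\<^sub>R unit i" "y = R *\<^sub>R unit j"
    unfolding simplex_on_vertices[OF V] by (elim imageE) (rule that)
  then have "i \<noteq> j" using ne by auto
  then show "dist x y = R * sqrt 2"
    using equidistant_unit[OF R, of "{i, j}"] unfolding ij by (simp add: equidistant_def)
qed

lemma relabel_simplex_on: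
  assumes U: "finite U" "V \<subseteq> U"
  shows "relabel U \<iota> ` simplex_on R V = simplex_on R (\<iota> ` V)"
proof -
  have "relabel U \<iota> (R *\<^sub>R unit v) = R *\<^sub>R unit (\<iota> v)" if "v \<in> V" for v
    using linear_scale[OF linear_relabel, of U \<iota> R "unit v"] relabel_unit[OF U(1), of v \<iota>] that U(2)
    by (simp add: subset_iff)
  then have "relabel U \<iota> ` (\<lambda>v. R *\<^sub>R unit v) ` V = (\<lambda>v. R *\<^sub>R unit v) ` \<iota> ` V"
    unfolding image_image by (rule image_cong[OF refl])
  then show ?thesis unfolding simplex_on_def convex_hull_linear_image[OF linear_relabel] by simp
qed

lemma skeleton_regular: "finite_subcomplexes_regular (R * sqrt 2) dist (skeleton R n :: 'i eucl set set)"
  unfolding finite_subcomplexes_regular_def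
proof (intro allI impI, elim conjE)
  fix \<D> :: "'i eucl set set" assume sub: "subcomplex dist (skeleton R n) \<D>" and fin: "finite \<D>"
  define S where "S = {V. finite V \<and> V \<noteq> {} \<and> simplex_on R V \<in> \<D>}"
  have S: "finite V" "V \<noteq> {}" "simplex_on R V \<in> \<D>" if "V \<in> S" for V using that by (simp_all add: S_def)
  have "inj_on (simplex_on R) S" using simplex_on_inj[OF S(1) S(1)] by (intro inj_onI)
  moreover have "simplex_on R ` S \<subseteq> \<D>" using S(3) by (rule image_subsetI)
  ultimately have "finite S" using fin by (meson finite_imageD finite_subset)
  define U where "U = \<Union>S"
  have U: "finite U" unfolding U_def using \<open>finite S\<close> S(1) by (rule finite_Union)
  have VU: "V \<subseteq> U" if "V \<in> S" for V unfolding U_def using that by (rule Union_upper)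
  have D: "\<D> = simplex_on R ` S"
  proof
    show "\<D> \<subseteq> simplex_on R ` S"
    proof
      fix C assume C: "C \<in> \<D>"
      then have "C \<in> skeleton R n" using sub by (auto simp: subcomplex_def)
      then obtain V where "finite V" "V \<noteq> {}" "C = simplex_on R V" by (rule skeletonE)
      then show "C \<in> simplex_on R ` S" using C by (simp add: S_def)
    qed
    show "simplex_on R ` S \<subseteq> \<D>" using S(3) by (rule image_subsetI)
  qed
  obtain \<iota> :: "'i \<Rightarrow> nat" where \<iota>: "inj_on \<iota> U" using U finite_imp_inj_to_nat_seg by blast
  \<comment> \<open>The additional vertex keeps the ambient simplex nonempty if the subcomplex is empty.\<close>
  define W where "W = insert 0 (\<iota> ` U)"
  have W: "finite W" "W \<noteq> {}" using U by (simp_all add: W_def)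
  define \<E> where "\<E> = (\<lambda>V. simplex_on R (\<iota> ` V)) ` S"
  have "subcomplex dist {F. cell_face dist F (simplex_on R W)} \<E>"
    unfolding subcomplex_def
  proof (intro conjI subsetI ballI allI impI)
    fix C assume "C \<in> \<E>"
    then obtain V where V: "V \<in> S" "C = simplex_on R (\<iota> ` V)" unfolding \<E>_def by (elim imageE) (rule that)
    have f: "finite (\<iota> ` V)" "\<iota> ` V \<noteq> {}" using S(1,2)[OF V(1)] by simp_all
    have "\<iota> ` V \<subseteq> W" using image_mono[OF VU[OF V(1)], of \<iota>] by (simp add: W_def subset_insertI2)
    then show "C \<in> {F. cell_face dist F (simplex_on R W)}"
      using f(2) unfolding V(2) mem_Collect_eq simplex_on_face_iff[OF W] by (intro exI[of _ "\<iota> ` V"]) simp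
    fix F assume F: "cell_face dist F C"
    obtain A where A: "A \<subseteq> \<iota> ` V" "A \<noteq> {}" "F = simplex_on R A"
      using F unfolding V(2) simplex_on_face_iff[OF f] by (elim exE conjE) (rule that)
    obtain V' where V': "V' \<subseteq> V" "A = \<iota> ` V'" using A(1) by (rule subset_imageE)
    have ne: "V' \<noteq> {}" using A(2) V'(2) by simp
    have "cell_face dist (simplex_on R V') (simplex_on R V)"
      unfolding simplex_on_face_iff[OF S(1,2)[OF V(1)]] using V'(1) ne by (intro exI[of _ V']) simp
    then have "simplex_on R V' \<in> \<D>" using sub S(3)[OF V(1)] unfolding subcomplex_def by blast
    then have "V' \<in> S" using ne finite_subset[OF V'(1) S(1)[OF V(1)]] by (simp add: S_def)
    then show "F \<in> \<E>" unfolding A(3) V'(2) \<E>_def by (rule imageI)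
  qed
  moreover have "isometric_spaces (\<Union>\<D>) dist (\<Union>\<E>) dist"
    unfolding isometric_spaces_def
  proof (intro exI[of _ "relabel U \<iota>"] conjI ballI)
    have supp: "supp z \<subseteq> U" if z: "z \<in> \<Union>\<D>" for z
    proof -
      obtain V where V: "V \<in> S" "z \<in> simplex_on R V" using z unfolding D by (elim UnionE imageE) simp
      then have "supp z \<subseteq> V" using simplex_on_iff[OF S(1)] by simp
      then show ?thesis using VU[OF V(1)] by (rule subset_trans)
    qed
    show iso: "dist (relabel U \<iota> x) (relabel U \<iota> y) = dist x y" if "x \<in> \<Union>\<D>" "y \<in> \<Union>\<D>" for x y
      using dist_relabel[OF U \<iota> supp[OF that(1)] supp[OF that(2)]] .
    have "relabel U \<iota> ` \<Union>\<D> = (\<Union>V\<in>S. relabel U \<iota> ` simplex_on R V)" unfolding D by (simp add: image_UN)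
    also have "\<dots> = \<Union>\<E>" unfolding \<E>_def by (simp add: relabel_simplex_on[OF U VU])
    finally have "relabel U \<iota> ` \<Union>\<D> = \<Union>\<E>" .
    moreover have "inj_on (relabel U \<iota>) (\<Union>\<D>)"
    proof (rule inj_onI)
      fix x y assume "x \<in> \<Union>\<D>" "y \<in> \<Union>\<D>" "relabel U \<iota> x = relabel U \<iota> y"
      then have "dist x y = 0" using iso[of x y] by simp
      then show "x = y" by simp
    qed
    ultimately show "bij_betw (relabel U \<iota>) (\<Union>\<D>) (\<Union>\<E>)" by (simp add: bij_betw_def)
  qed
  ultimately show "\<exists>\<Delta> \<E>. regular_simplex (R * sqrt 2) \<Delta> \<and> subcomplex dist {F. cell_face dist F \<Delta>} \<E> \<and>
      isometric_spaces (\<Union>\<D>) dist (\<Union>\<E>) dist"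
    by (intro exI[of _ "simplex_on R W"] exI[of _ \<E>] conjI simplex_on_regular[OF W])
qed

lemma skeleton_vertices: "complex_vertices dist (skeleton R n) \<subseteq> range (\<lambda>v. R *\<^sub>R unit v)"
  unfolding complex_vertices_def
proof (rule UN_least)
  fix C :: "'i eucl set" assume "C \<in> skeleton R n"
  then obtain V where V: "finite V" "V \<noteq> {}" "C = simplex_on R V" by (rule skeletonE)
  show "cell_vertices dist C \<subseteq> range (\<lambda>v. R *\<^sub>R unit v)"
    unfolding V(3) simplex_on_vertices[OF V(1,2)] by (rule image_mono[OF subset_UNIV])
qed

text \<open>Moving away from the vertex \<open>R e\<^sub>v\<close> through \<open>z\<close> stays inside the cell, so that \<open>e\<^sub>v\<close> has positive weight in \<open>z\<close>.\<close>

lemma skeleton_star: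
  assumes "z \<in> open_star dist (skeleton R n) (R *\<^sub>R unit v)"
  shows "0 < coord z v"
proof -
  obtain C where C: "C \<in> skeleton R n" "R *\<^sub>R unit v \<in> C" "z \<in> cell_int dist C"
    using assms unfolding open_star_def by blast
  obtain V where V: "finite V" "V \<noteq> {}" "C = simplex_on R V" using C(1) by (rule skeletonE)
  have "z \<in> rel_interior C"
    using C(3) cell_int_iff[OF simplex_on_cell[OF V(1,2)] simplex_on_embedding[OF V(1,2)]] V(3) by simp
  then obtain b t where b: "b \<in> C" "0 < t" "t < 1" "z = (1 - t) *\<^sub>R (R *\<^sub>R unit v) + t *\<^sub>R b"
    by (rule rel_interior_extends[OF _ C(2)])
  have "0 \<le> coord b v" using b(1) V simplex_on_iff by blast
  then have "0 \<le> t * coord b v" "0 < (1 - t) * R" using b(2,3) R by auto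
  then show ?thesis unfolding b(4) by (simp add: coord_simps)
qed

end

section \<open>Level sets and the barycentric subdivision of the skeleton\<close>

text \<open>The layer cake formula for a finitely supported function: subtracting the least positive value \<open>m\<close> from the
  support \<open>S\<close> removes at least one point from the support, and \<open>f\<close> is \<open>m\<close> times the indicator function of \<open>S\<close> plus the rest.
  The superlevel sets that occur form a chain, and they include every set on which the
  values exceed all others.\<close>

lemma level_decomposition:
  fixes f :: "'i \<Rightarrow> real"
  assumes "finite S" "S \<noteq> {}" "\<And>i. i \<in> S \<Longrightarrow> 0 < f i" "\<And>i. i \<notin> S \<Longrightarrow> f i = 0"
  shows "\<exists>\<V> a. finite \<V> \<and> subset.chain (Pow S - {{}}) \<V> \<and> S \<in> \<V> \<and> (\<forall>V\<in>\<V>. 0 < a V) \<and>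
    (\<forall>i. f i = (\<Sum>V\<in>\<V>. a V * (if i \<in> V then 1 else 0))) \<and>
    (\<forall>W. W \<noteq> {} \<and> W \<subseteq> S \<and> (\<forall>v\<in>W. \<forall>u. u \<notin> W \<longrightarrow> f u < f v) \<longrightarrow> W \<in> \<V>)"
  using assms
proof (induction "card S" arbitrary: S f rule: less_induct)
  case less
  define m where "m = Min (f ` S)"
  have m: "m \<in> f ` S" "\<And>i. i \<in> S \<Longrightarrow> m \<le> f i" using less.prems(1,2) by (auto simp: m_def)
  have mpos: "0 < m" using m(1) less.prems(3) by auto
  obtain i0 where i0: "i0 \<in> S" "f i0 = m" using m(1) by auto
  define S' where "S' = {i \<in> S. m < f i}"
  have S': "S' \<subseteq> S" "i0 \<notin> S'" "finite S'" using i0 less.prems(1) by (auto simp: S'_def)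
  have gapS': "W \<subseteq> S'" if W: "W \<subseteq> S" "W \<noteq> S" "\<forall>v\<in>W. \<forall>u. u \<notin> W \<longrightarrow> f u < f v" for W
  proof
    fix v assume v: "v \<in> W"
    obtain u where u: "u \<in> S" "u \<notin> W" using W(1,2) by blast
    then have "f u < f v" using W(3) v by blast
    then have "m < f v" using m(2)[OF u(1)] by linarith
    then show "v \<in> S'" using v W(1) by (auto simp: S'_def)
  qed
  show ?case
  proof (cases "S' = {}")
    case True
    then have eq: "f i = m" if "i \<in> S" for i using that m(2)[OF that] by (force simp: S'_def)
    show ?thesis
    proof (intro exI[of _ "{S}"] exI[of _ "\<lambda>_. m"] conjI allI impI)
      show "subset.chain (Pow S - {{}}) {S}" using less.prems(2) by (auto simp: subset.chain_def)
      show "f i = (\<Sum>V\<in>{S}. m * (if i \<in> V then 1 else 0))" for i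
        using eq[of i] less.prems(4)[of i] by simp
      fix W assume "W \<noteq> {} \<and> W \<subseteq> S \<and> (\<forall>v\<in>W. \<forall>u. u \<notin> W \<longrightarrow> f u < f v)"
      then show "W \<in> {S}" using gapS'[of W] True by blast
    qed (use mpos in auto)
  next
    case False
    define f' where "f' i = (if i \<in> S then f i - m else 0)" for i
    have cS: "card S' < card S" using S' i0(1) less.prems(1) by (intro psubset_card_mono) auto
    have pos': "0 < f' i" if "i \<in> S'" for i using that by (simp add: S'_def f'_def)
    have zero': "f' i = 0" if "i \<notin> S'" for i
    proof (cases "i \<in> S")
      case True
      then have "f i = m" using that m(2)[OF True] by (simp add: S'_def)
      then show ?thesis by (simp add: f'_def)
    qed (simp add: f'_def)
    have hyp: "\<exists>\<V> a. finite \<V> \<and> subset.chain (Pow S' - {{}}) \<V> \<and> S' \<in> \<V> \<and> (\<forall>V\<in>\<V>. 0 < a V) \<and>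
      (\<forall>i. f' i = (\<Sum>V\<in>\<V>. a V * (if i \<in> V then 1 else 0))) \<and>
      (\<forall>W. W \<noteq> {} \<and> W \<subseteq> S' \<and> (\<forall>v\<in>W. \<forall>u. u \<notin> W \<longrightarrow> f' u < f' v) \<longrightarrow> W \<in> \<V>)"
      using pos' zero' by (rule less.hyps[OF cS S'(3) False])
    obtain \<V> a where V: "finite \<V>" "subset.chain (Pow S' - {{}}) \<V>" "\<forall>V\<in>\<V>. 0 < a V"
      "\<forall>i. f' i = (\<Sum>V\<in>\<V>. a V * (if i \<in> V then 1 else 0))"
      "\<forall>W. W \<noteq> {} \<and> W \<subseteq> S' \<and> (\<forall>v\<in>W. \<forall>u. u \<notin> W \<longrightarrow> f' u < f' v) \<longrightarrow> W \<in> \<V>"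
      using hyp by (elim exE conjE) (rule that)
    have sub: "V \<subseteq> S'" "V \<noteq> {}" if "V \<in> \<V>" for V using V(2) that by (auto simp: subset.chain_def)
    have SnV: "S \<notin> \<V>" using sub(1) i0(1) S'(2) by blast
    let ?a = "a(S := m)"
    show ?thesis
    proof (intro exI[of _ "insert S \<V>"] exI[of _ ?a] conjI allI impI)
      show "subset.chain (Pow S - {{}}) (insert S \<V>)"
        unfolding subset_chain_def
      proof (intro conjI ballI)
        show "insert S \<V> \<subseteq> Pow S - {{}}" using sub S'(1) less.prems(2) by fastforce
        have "X \<subseteq> S" if "X \<in> \<V>" for X using sub(1)[OF that] S'(1) by (rule subset_trans)
        then show "X \<subseteq> Y \<or> Y \<subseteq> X" if "X \<in> insert S \<V>" "Y \<in> insert S \<V>" for X Y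
          using that V(2) unfolding subset_chain_def by (elim insertE) simp_all
      qed
      show "\<forall>V\<in>insert S \<V>. 0 < ?a V" using V(3) mpos by auto
      show "f i = (\<Sum>V\<in>insert S \<V>. ?a V * (if i \<in> V then 1 else 0))" for i
      proof -
        have "(\<Sum>V\<in>\<V>. ?a V * (if i \<in> V then 1 else 0)) = (\<Sum>V\<in>\<V>. a V * (if i \<in> V then 1 else 0))"
          using SnV by (intro sum.cong refl) auto
        also have "\<dots> = f' i" using V(4) by simp
        finally show ?thesis using SnV V(1) less.prems(4)[of i] by (simp add: f'_def)
      qed
      fix W assume W: "W \<noteq> {} \<and> W \<subseteq> S \<and> (\<forall>v\<in>W. \<forall>u. u \<notin> W \<longrightarrow> f u < f v)"
      show "W \<in> insert S \<V>"
      proof (cases "W = S")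
        case WS: False
        then have WS': "W \<subseteq> S'" using gapS'[of W] W by blast
        have lt: "\<forall>v\<in>W. \<forall>u. u \<notin> W \<longrightarrow> f' u < f' v"
        proof (intro ballI allI impI)
          fix v u assume "v \<in> W" "u \<notin> W"
          then have "f u < f v" "v \<in> S" "m < f v" using W WS' by (auto simp: S'_def)
          then show "f' u < f' v" by (simp add: f'_def)
        qed
        show ?thesis using V(5)[THEN spec, of W] W WS' lt by simp
      qed simp
    qed (use V(1) in auto)
  qed
qed

text \<open>Coefficients are inner products with dual vectors, hence Lipschitz functions of the point.\<close>

lemma rel_interior_of_dual_vectors:
  fixes f :: "'i \<Rightarrow> 'b::real_inner"
  assumes I: "finite I" and dual: "\<And>i. i \<in> I \<Longrightarrow> \<exists>g. \<forall>j\<in>I. inner (f j) g = (if j = i then 1 else 0)"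
    and a: "\<And>i. i \<in> I \<Longrightarrow> 0 < a i" "sum a I = 1" and p: "p = (\<Sum>i\<in>I. a i *\<^sub>R f i)"
  shows "p \<in> rel_interior (convex hull (f ` I))"
proof -
  obtain g where g: "\<And>i j. i \<in> I \<Longrightarrow> j \<in> I \<Longrightarrow> inner (f j) (g i) = (if j = i then 1 else 0)"
    using dual by metis
  have coeff: "inner (\<Sum>j\<in>I. c j *\<^sub>R f j) (g i) = c i" if "i \<in> I" for c i
    using that I by (simp add: inner_sum_left g if_distrib[of "\<lambda>x. _ * x"] cong: if_cong)
  let ?K = "1 + (\<Sum>i\<in>I. norm (g i))"
  show ?thesis
  proof (rule rel_interior_of_stable_coefficients[OF I a p])
    show "0 < ?K" by (simp add: add_pos_nonneg sum_nonneg)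
    fix i and c :: "'i \<Rightarrow> real" assume i: "i \<in> I"
    have gK: "norm (g i) \<le> ?K"
      using member_le_sum[of i I "\<lambda>i. norm (g i)"] i I by simp
    let ?z = "\<Sum>i\<in>I. c i *\<^sub>R f i"
    have "\<bar>a i - c i\<bar> = \<bar>inner (p - ?z) (g i)\<bar>"
      unfolding p inner_diff_left coeff[OF i] ..
    also have "\<dots> \<le> norm (p - ?z) * norm (g i)" by (rule Cauchy_Schwarz_ineq2)
    also have "\<dots> \<le> norm (p - ?z) * ?K" using gK by (rule mult_left_mono) simp
    finally show "\<bar>a i - c i\<bar> \<le> ?K * dist p ?z" by (simp only: dist_norm mult.commute)
  qed
qed

text \<open>Choose \<open>u\<close> in \<open>V\<close> but in no smaller member, and \<open>w\<close> outside \<open>V\<close> but in all larger members. Then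
  \<open>u \<in> U\<close> iff \<open>V \<subseteq> U\<close>, and \<open>w \<in> U\<close> iff \<open>V \<subset> U\<close>, so \<open>e\<^sub>u - e\<^sub>w\<close> detects the member \<open>V\<close>; if \<open>V\<close> is the largest, \<open>e\<^sub>u\<close> suffices.\<close>

lemma chain_dual:
  assumes fin: "finite \<V>" and ch: "subset.chain A \<V>" and ne: "{} \<notin> \<V>" and fV: "\<And>V. V \<in> \<V> \<Longrightarrow> finite V"
    and V: "V \<in> \<V>"
  shows "\<exists>g :: 'i eucl. \<forall>U\<in>\<V>. inner (\<Sum>v\<in>U. unit v) g = (if U = V then 1 else 0)"
proof -
  have tot: "U \<subseteq> W \<or> W \<subseteq> U" if "U \<in> \<V>" "W \<in> \<V>" for U W
    using ch that unfolding subset.chain_def by blast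
  have ind: "inner (\<Sum>v\<in>U. unit v) (unit i) = (if i \<in> U then 1 else 0)" if "U \<in> \<V>" for U and i :: 'i
    using fV[OF that] coord_unit_sum[of U "\<lambda>_. 1" i] by (simp add: inner_unit)
  let ?L = "{U \<in> \<V>. U \<subset> V}" and ?G = "{U \<in> \<V>. V \<subset> U}"
  have "\<exists>u\<in>V. u \<notin> \<Union>?L"
  proof (cases "?L = {}")
    case True
    then show ?thesis using ne V by (metis Union_empty all_not_in_conv empty_iff)
  next
    case False
    have "subset.chain A ?L" using ch by (auto simp: subset.chain_def)
    then have "\<Union>?L \<in> ?L" using False fin by (intro Union_in_chain) auto
    then show ?thesis by blast
  qed
  then obtain u where u: "u \<in> V" "\<And>U. U \<in> \<V> \<Longrightarrow> U \<subset> V \<Longrightarrow> u \<notin> U" by blast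
  have uiff: "u \<in> U \<longleftrightarrow> V \<subseteq> U" if "U \<in> \<V>" for U using u tot[OF that V] that by blast
  show ?thesis
  proof (cases "?G = {}")
    case True
    have "inner (\<Sum>v\<in>U. unit v) (unit u) = (if U = V then 1 else 0)" if "U \<in> \<V>" for U
    proof -
      have "u \<in> U \<longleftrightarrow> U = V" using uiff[OF that] True that by blast
      then show ?thesis unfolding ind[OF that] by simp
    qed
    then show ?thesis by blast
  next
    case False
    have "subset.chain A ?G" using ch by (auto simp: subset.chain_def)
    then have "\<Inter>?G \<in> ?G" using False fin by (intro Inter_in_chain) auto
    then have "V \<subset> \<Inter>?G" by (simp only: mem_Collect_eq)
    then have "\<exists>w. w \<in> \<Inter>?G - V" by (rule psubset_imp_ex_mem)
    then obtain w where "w \<in> \<Inter>?G - V" by (rule exE)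
    then have w: "w \<notin> V" "\<And>U. U \<in> \<V> \<Longrightarrow> V \<subset> U \<Longrightarrow> w \<in> U" by simp_all
    have "inner (\<Sum>v\<in>U. unit v) (unit u - unit w) = (if U = V then 1 else 0)" if "U \<in> \<V>" for U
    proof -
      have "w \<in> U \<longleftrightarrow> V \<subset> U" using w tot[OF that V] that by blast
      moreover have "U = V \<longleftrightarrow> V \<subseteq> U \<and> \<not> V \<subset> U" by blast
      ultimately show ?thesis unfolding inner_diff_right ind[OF that] uiff[OF that] by auto
    qed
    then show ?thesis by blast
  qed
qed

text \<open>The largest value is at least \<open>R / (n + 1)\<close>. Cut the interval below it into \<open>n + 1\<close> pieces of length
  \<open>R / (n + 1)\<^sup>2\<close>: the at most \<open>n\<close> other values miss one of them.\<close>

lemma value_gap: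
  fixes f :: "'i \<Rightarrow> real"
  assumes S: "finite S" "card S \<le> n + 1" and f: "\<And>i. 0 \<le> f i" "\<And>i. i \<notin> S \<Longrightarrow> f i = 0" and sum: "sum f S = R"
    and R: "0 < R"
  obtains W where "W \<noteq> {}" "W \<subseteq> S" "\<And>v. v \<in> W \<Longrightarrow> R / (real n + 1)\<^sup>2 \<le> f v"
    "\<And>v u. v \<in> W \<Longrightarrow> u \<notin> W \<Longrightarrow> f u + R / (real n + 1)\<^sup>2 \<le> f v"
proof -
  let ?g = "R / (real n + 1)\<^sup>2"
  have g: "0 < ?g" using R by simp
  have "\<exists>v\<in>S. R / (real n + 1) \<le> f v"
  proof (rule ccontr)
    assume "\<not> ?thesis"
    then have lt: "f v < R / (real n + 1)" if "v \<in> S" for v using that by (auto simp: not_le)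
    have "S \<noteq> {}" using sum R by auto
    then have "sum f S < (\<Sum>v\<in>S. R / (real n + 1))" using S(1) lt by (intro sum_strict_mono) auto
    also have "\<dots> = real (card S) * (R / (real n + 1))" by simp
    also have "\<dots> \<le> (real n + 1) * (R / (real n + 1))" using S(2) R by (intro mult_right_mono) auto
    also have "\<dots> = R" by simp
    finally show False using sum by simp
  qed
  then obtain x where x: "x \<in> S" "R / (real n + 1) \<le> f x" by blast
  have xg: "(real n + 1) * ?g \<le> f x"
    using x(2) by (simp add: power2_eq_square)
  \<comment> \<open>The number \<open>j\<close> of the piece \<open>((j - 1) g, j g]\<close> in which a value lies.\<close>
  let ?J = "(\<lambda>v. nat \<lceil>f v / ?g\<rceil>) ` (S - {x})"
  have "card ?J \<le> card (S - {x})" using S(1) by (intro card_image_le) auto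
  also have "\<dots> \<le> n" using S x(1) by simp
  finally have "card ?J < card {1..n + 1}" by simp
  then have "\<not> {1..n + 1} \<subseteq> ?J" using card_mono[of ?J "{1..n + 1}"] S(1) by auto
  then obtain j where j: "j \<in> {1..n + 1}" "j \<notin> ?J" by blast
  let ?W = "{v. real j * ?g \<le> f v}"
  have jg: "?g \<le> real j * ?g" using mult_right_mono[of 1 "real j" ?g] j(1) g by simp
  have "real j * ?g \<le> (real n + 1) * ?g" using j(1) g by (intro mult_right_mono) auto
  then have xW: "x \<in> ?W" using xg by simp
  have low: "f u \<le> (real j - 1) * ?g" if u: "u \<notin> ?W" for u
  proof (cases "u \<in> S")
    case True
    then have "u \<in> S - {x}" using u xW by blast
    then have neq: "nat \<lceil>f u / ?g\<rceil> \<noteq> j" using j(2) by blast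
    define t where "t = f u / ?g"
    have fu: "f u = t * ?g" using R by (simp add: t_def)
    have "f u < real j * ?g" using u by (simp only: mem_Collect_eq not_le)
    then have "t * ?g < real j * ?g" unfolding fu .
    then have "t < real j" using g by (simp only: mult_less_cancel_right_pos)
    then have "\<lceil>t\<rceil> \<le> int j" by (simp add: ceiling_le_iff)
    moreover have "0 \<le> t" unfolding t_def using f(1)[of u] g by (intro divide_nonneg_pos)
    then have "0 \<le> \<lceil>t\<rceil>" by simp
    ultimately have "\<lceil>t\<rceil> \<le> int j - 1" using neq unfolding t_def[symmetric] by linarith
    then have "t \<le> real_of_int (int j - 1)" by (simp only: ceiling_le_iff)
    then have "t \<le> real j - 1" by simp
    then show ?thesis unfolding fu using g by (intro mult_right_mono) simp_all
  next
    case False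
    have "0 \<le> (real j - 1) * ?g" using j(1) g by (intro mult_nonneg_nonneg) auto
    then show ?thesis using f(2)[OF False] by simp
  qed
  show thesis
  proof (rule that[of ?W])
    show "?W \<noteq> {}" using xW by blast
    show "?W \<subseteq> S"
    proof
      fix v assume "v \<in> ?W"
      then have "0 < f v" using jg g by auto
      then show "v \<in> S" using f(2)[of v] by fastforce
    qed
    show "?g \<le> f v" if "v \<in> ?W" for v using that jg by simp
    show "f u + ?g \<le> f v" if vu: "v \<in> ?W" "u \<notin> ?W" for v u
    proof -
      have "(real j - 1) * ?g + ?g = real j * ?g" by (simp only: left_diff_distrib mult_1_left diff_add_cancel)
      moreover have "real j * ?g \<le> f v" using vu(1) by (simp only: mem_Collect_eq)
      ultimately show ?thesis using low[OF vu(2)] by linarith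
    qed
  qed
qed

lemma (in poly_complex) barycenter_vertex:
  assumes F: "F \<in> \<C>"
  shows "barycenter d F \<in> complex_vertices d (barycentric_subdivision d \<C>)"
proof -
  let ?K = "cell_hull d F (barycenter d ` {F})"
  have "subset.chain {G. cell_face d G F} {F}"
    using cell_face_refl[OF cell[OF F]] by (auto simp: subset.chain_def)
  then have K: "?K \<in> barycentric_subdivision d \<C>" unfolding barycentric_subdivision_def using F by blast
  obtain \<phi> where \<phi>: "polytope_embedding d F \<phi>" "cell_chart d F \<phi>" using convex_cell_chart[OF cell[OF F]] .
  have "?K \<subseteq> {barycenter d F}"
  proof
    fix x assume "x \<in> ?K"
    then have "x \<in> F" "\<phi> x = \<phi> (barycenter d F)"
      using cell_hull_iff[OF cell[OF F] \<phi>(1), of "{barycenter d F}"] bary_mem[OF F] by simp_all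
    then show "x \<in> {barycenter d F}"
      using inj_onD[OF polytope_embedding_inj[OF cell[OF F] \<phi>(1)]] bary_mem[OF F] by simp
  qed
  moreover have "convex_cell d ?K" by (rule subdivision_cellE[OF K])
  then obtain v where v: "v \<in> cell_vertices d ?K"
    using cell_vertices_nonempty convex_cell_chart by (metis all_not_in_conv)
  moreover have "cell_vertices d ?K \<subseteq> ?K" unfolding cell_vertices_def using cell_face_subset by blast
  ultimately have "v = barycenter d F" by blast
  then show ?thesis unfolding complex_vertices_def using K v by blast
qed

context
  fixes R :: real and n :: nat
  assumes R: "0 < R"
begin

lemma poly_complex_skeleton: "poly_complex (\<Union>(skeleton R n)) dist (skeleton R n :: 'i eucl set set)"
  using skeleton_complex[OF R] unfolding simplicial_complex_def by unfold_locales blast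

lemma skeletonD:
  assumes "z \<in> \<Union>(skeleton R n)"
  shows "card (supp z) \<le> n + 1" "0 \<le> coord z v" "(\<Sum>v\<in>supp z. coord z v) = R"
  using skeleton_space[OF R, THEN iffD1, OF assms] by simp_all

text \<open>The barycenter of the face spanned by \<open>W\<close> is a member of the flag around \<open>q\<close> and thus enters \<open>q\<close> with positive
  weight.\<close>

lemma subdivision_star_support:
  fixes q :: "'i eucl"
  assumes W: "finite W" "W \<noteq> {}" "card W \<le> n + 1" and w: "w \<in> W"
    and q: "q \<in> open_star dist (barycentric_subdivision dist (skeleton R n)) (barycenter dist (simplex_on R W))"
  shows "0 < coord q w"
proof -
  interpret poly_complex "\<Union>(skeleton R n)" dist "skeleton R n :: 'i eucl set set" by (rule poly_complex_skeleton)
  have WC: "simplex_on R W \<in> skeleton R n" using skeletonI[OF R W] .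
  obtain \<F> where fl: "in_flag q \<F>" and WF: "simplex_on R W \<in> \<F>"
    using subdivision_star_flag[OF q WC] .
  obtain D where D: "D \<in> \<F>" "D \<in> skeleton R n" "\<And>F. F \<in> \<F> \<Longrightarrow> F \<subseteq> D" "\<And>F. F \<in> \<F> \<Longrightarrow> F \<in> skeleton R n" "finite \<F>" "q \<in> D"
    "\<And>\<phi>::'i eucl \<Rightarrow> nat eucl. cell_chart dist D \<phi> \<Longrightarrow> \<exists>a. flag_weights \<phi> \<F> q a"
    by (rule in_flagE[OF fl]) (rule that)
  obtain \<phi> where \<phi>: "polytope_embedding dist D \<phi>" "cell_chart dist D \<phi>" using convex_cell_chart[OF cell[OF D(2)]] .
  obtain a where a: "\<forall>F\<in>\<F>. 0 < a F" "sum a \<F> = 1" "\<phi> q = (\<Sum>F\<in>\<F>. a F *\<^sub>R \<phi> (barycenter dist F))"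
    using D(7)[OF \<phi>(2)] unfolding flag_weights_def by (elim exE conjE)
  have iso: "isometric_on dist D (\<lambda>x. x)" by (simp add: isometric_on_def)
  have bD: "barycenter dist F \<in> D" if "F \<in> \<F>" for F
    using bary_mem[OF D(4)[OF that]] D(3)[OF that] by (rule subsetD[rotated])
  have "q = (\<Sum>F\<in>\<F>. a F *\<^sub>R barycenter dist F)"
    using bD by (rule isometric_on_affine_combination[OF polytope_embedding_isometric[OF \<phi>(1)] iso D(6) _ a(2,3)])
  then have cq: "coord q w = (\<Sum>F\<in>\<F>. a F * coord (barycenter dist F) w)" by (simp add: coord_sum coord_scaleR)
  have nonneg: "0 \<le> coord (barycenter dist F) w" if "F \<in> \<F>" for F
  proof -
    have "barycenter dist F \<in> \<Union>(skeleton R n)" using bary_mem[OF D(4)[OF that]] D(4)[OF that] by blast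
    then show ?thesis by (rule skeletonD)
  qed
  have "0 < a (simplex_on R W) * coord (barycenter dist (simplex_on R W)) w"
    using a(1) WF w R W by (simp add: coord_barycenter[OF R W(1,2)] card_gt_0_iff)
  also have "\<dots> \<le> coord q w"
    unfolding cq using WF D(5) a(1) nonneg by (intro member_le_sum) (auto simp: less_imp_le)
  finally show ?thesis .
qed

text \<open>The level decomposition of the coordinates writes \<open>q\<close> as a positive combination of indicator functions of a
  chain of vertex sets, that is, of barycenters of a flag of faces, and \<open>W\<close> is in the chain. The dual vectors of the
  chain show that \<open>q\<close> is interior to the corresponding simplex of the subdivision.\<close>

lemma star_of_level_set:
  fixes q :: "'i eucl"
  assumes q: "q \<in> \<Union>(skeleton R n)" and W: "W \<noteq> {}" "W \<subseteq> supp q" "\<And>v u. v \<in> W \<Longrightarrow> u \<notin> W \<Longrightarrow> coord q u < coord q v"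
  shows "q \<in> open_star dist (barycentric_subdivision dist (skeleton R n)) (barycenter dist (simplex_on R W))"
proof -
  interpret poly_complex "\<Union>(skeleton R n)" dist "skeleton R n :: 'i eucl set set" by (rule poly_complex_skeleton)
  let ?S = "supp q"
  note qs = skeletonD[OF q]
  have Sne: "?S \<noteq> {}" using W(1,2) by blast
  have pos: "0 < coord q i" if "i \<in> ?S" for i using that qs(2) by (simp add: supp_def less_le)
  have zero: "coord q i = 0" if "i \<notin> ?S" for i using that by (simp add: supp_def)
  obtain \<V> a where V: "finite \<V>" "subset.chain (Pow ?S - {{}}) \<V>" "?S \<in> \<V>" "\<forall>V\<in>\<V>. 0 < a V"
    "\<forall>i. coord q i = (\<Sum>V\<in>\<V>. a V * (if i \<in> V then 1 else 0))"
    "\<forall>W. W \<noteq> {} \<and> W \<subseteq> ?S \<and> (\<forall>v\<in>W. \<forall>u. u \<notin> W \<longrightarrow> coord q u < coord q v) \<longrightarrow> W \<in> \<V>"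
  proof -
    have "\<exists>\<V> a. finite \<V> \<and> subset.chain (Pow ?S - {{}}) \<V> \<and> ?S \<in> \<V> \<and> (\<forall>V\<in>\<V>. 0 < a V) \<and>
      (\<forall>i. coord q i = (\<Sum>V\<in>\<V>. a V * (if i \<in> V then 1 else 0))) \<and>
      (\<forall>W. W \<noteq> {} \<and> W \<subseteq> ?S \<and> (\<forall>v\<in>W. \<forall>u. u \<notin> W \<longrightarrow> coord q u < coord q v) \<longrightarrow> W \<in> \<V>)"
      using pos zero by (rule level_decomposition[OF finite_supp Sne])
    then show thesis by (elim exE conjE) (rule that)
  qed
  have WV: "W \<in> \<V>" using V(6)[THEN spec, of W] W by simp
  have "V \<subseteq> ?S" "V \<noteq> {}" if "V \<in> \<V>" for V
    using V(2) that by (auto simp: subset.chain_def)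
  then have sub: "V \<subseteq> ?S" "V \<noteq> {}" "finite V" if "V \<in> \<V>" for V
    using that finite_subset[OF _ finite_supp[of q]] by simp_all
  let ?b = "\<lambda>V. barycenter dist (simplex_on R V)"
  have b: "?b V = (R / card V) *\<^sub>R (\<Sum>v\<in>V. unit v)" if "V \<in> \<V>" for V
    using sub[OF that] coord_unit_sum[of V "\<lambda>_. 1"]
    by (intro eucl_eqI) (simp add: coord_barycenter[OF R] coord_scaleR)
  have cardV: "0 < card V" if "V \<in> \<V>" for V using sub[OF that] by (simp add: card_gt_0_iff)
  \<comment> \<open>The barycenter is \<open>R / card V\<close> times the indicator function of \<open>V\<close>.\<close>
  define c where "c V = a V * card V / R" for V
  have c: "0 < c V" if "V \<in> \<V>" for V using that V(4) cardV R by (simp add: c_def)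
  have qc: "q = (\<Sum>V\<in>\<V>. c V *\<^sub>R ?b V)"
  proof (rule eucl_eqI)
    fix i
    have "coord (\<Sum>V\<in>\<V>. c V *\<^sub>R ?b V) i = (\<Sum>V\<in>\<V>. a V * (if i \<in> V then 1 else 0))"
      unfolding coord_sum coord_scaleR using sub cardV R
      by (intro sum.cong refl) (simp add: coord_barycenter[OF R] c_def)
    then show "coord q i = coord (\<Sum>V\<in>\<V>. c V *\<^sub>R ?b V) i" using V(5) by simp
  qed
  have csum: "sum c \<V> = 1"
  proof -
    have "R = (\<Sum>i\<in>?S. \<Sum>V\<in>\<V>. a V * (if i \<in> V then 1 else 0))" using qs(3) V(5) by simp
    also have "\<dots> = (\<Sum>V\<in>\<V>. \<Sum>i\<in>?S. a V * (if i \<in> V then 1 else 0))" by (rule sum.swap)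
    also have "\<dots> = (\<Sum>V\<in>\<V>. a V * card V)"
    proof (intro sum.cong refl)
      fix V assume "V \<in> \<V>"
      then have "?S \<inter> V = V" using sub(1) by blast
      then show "(\<Sum>i\<in>?S. a V * (if i \<in> V then 1 else 0)) = a V * card V"
        using finite_supp[of q] by (simp add: sum.If_cases flip: sum_distrib_left)
    qed
    finally have "(\<Sum>V\<in>\<V>. a V * card V) = R" by simp
    then show ?thesis using R by (simp add: c_def flip: sum_divide_distrib)
  qed
  have ri: "q \<in> rel_interior (convex hull (?b ` \<V>))"
  proof (rule rel_interior_of_dual_vectors[OF V(1) _ c csum qc])
    fix V assume VV: "V \<in> \<V>"
    obtain g where g: "\<forall>U\<in>\<V>. inner (\<Sum>v\<in>U. unit v) g = (if U = V then 1 else 0)"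
      using chain_dual[OF V(1,2) _ sub(3) VV] sub(2) by blast
    have "inner (?b U) ((card V / R) *\<^sub>R g) = (if U = V then 1 else 0)" if "U \<in> \<V>" for U
      using g that cardV[OF VV] R by (simp add: b)
    then show "\<exists>g. \<forall>U\<in>\<V>. inner (?b U) g = (if U = V then 1 else 0)" by blast
  qed
  let ?C = "simplex_on R ?S" and ?F = "simplex_on R ` \<V>"
  have C: "?C \<in> skeleton R n" using skeletonI[OF R finite_supp Sne qs(1)] .
  have faces: "cell_face dist (simplex_on R V) ?C" if "V \<in> \<V>" for V
    unfolding simplex_on_face_iff[OF R finite_supp Sne] using sub[OF that] by blast
  have mono: "simplex_on R V \<subseteq> simplex_on R U" if "V \<subseteq> U" for V U :: "'i set"
    unfolding simplex_on_def using that by (intro hull_mono image_mono)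
  have chF: "subset.chain {F. cell_face dist F ?C} ?F"
    unfolding subset_chain_def
  proof (intro conjI ballI)
    show "?F \<subseteq> {F. cell_face dist F ?C}" using faces by blast
    fix X Y assume "X \<in> ?F" "Y \<in> ?F"
    then obtain U V where "U \<in> \<V>" "V \<in> \<V>" "X = simplex_on R U" "Y = simplex_on R V" by blast
    moreover have "U \<subseteq> V \<or> V \<subseteq> U" using calculation(1,2) V(2) unfolding subset_chain_def by blast
    ultimately show "X \<subseteq> Y \<or> Y \<subseteq> X" using mono by blast
  qed
  let ?K = "cell_hull dist ?C (barycenter dist ` ?F)"
  have "?C \<in> ?F" using V(3) by blast
  then have K: "?K \<in> barycentric_subdivision dist (skeleton R n)"
    unfolding barycentric_subdivision_def using C chF by blast
  have bC: "barycenter dist ` ?F \<subseteq> ?C"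
    using faces cell_face_subset bary_mem face_mem[OF C] by blast
  note emb = simplex_on_embedding[OF R finite_supp Sne] and cellC = cell[OF C]
  have Kiff: "x \<in> ?K \<longleftrightarrow> x \<in> ?C \<and> x \<in> convex hull (?b ` \<V>)" for x
    using cell_hull_iff[OF cellC emb _ bC] V(1) by (simp add: image_image)
  have "convex hull (?b ` \<V>) \<subseteq> ?C"
    using bC by (intro hull_minimal) (auto simp: simplex_on_def image_image)
  then have Keq: "?K = convex hull (?b ` \<V>)" using Kiff by blast
  have cK: "convex_cell dist ?K" by (rule subdivision_cellE[OF K])
  have embK: "polytope_embedding dist ?K (\<lambda>x. x)"
    unfolding polytope_embedding_def isometric_on_def
  proof (intro conjI ballI refl exI[of _ "?b ` \<V>"])
    show "finite (?b ` \<V>)" "?b ` \<V> \<noteq> {}" using V(1,3) by auto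
    show "(\<lambda>x. x) ` ?K = convex hull (?b ` \<V>)" using Keq by simp
  qed
  have "q \<in> cell_int dist ?K"
    using cell_int_iff[OF cK embK] ri rel_interior_subset Keq by auto
  moreover have "?b W \<in> ?K" unfolding Keq using WV by (intro hull_inc) blast
  ultimately show ?thesis unfolding open_star_def using K by blast
qed

text \<open>The coordinates of a point move by less than \<open>s\<close> within the ball, and the gap is at least \<open>4 * s\<close>.\<close>

lemma skeleton_lebesgue:
  fixes p :: "'i eucl"
  assumes p: "p \<in> \<Union>(skeleton R n)" and s: "0 < s" "4 * (real n + 1)\<^sup>2 * s \<le> R"
  obtains z where "z \<in> complex_vertices dist (barycentric_subdivision dist (skeleton R n))"
    "Metric_space.mball (\<Union>(skeleton R n)) dist p s \<subseteq> open_star dist (barycentric_subdivision dist (skeleton R n)) z"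
proof -
  interpret poly_complex "\<Union>(skeleton R n)" dist "skeleton R n :: 'i eucl set set" by (rule poly_complex_skeleton)
  interpret M: Metric_space "\<Union>(skeleton R n) :: 'i eucl set" dist by (rule metric)
  note ps = skeletonD[OF p]
  have zero: "\<And>i. i \<notin> supp p \<Longrightarrow> coord p i = 0" by (simp add: supp_def)
  obtain W where W: "W \<noteq> {}" "W \<subseteq> supp p" "\<And>v. v \<in> W \<Longrightarrow> R / (real n + 1)\<^sup>2 \<le> coord p v"
    "\<And>v u. v \<in> W \<Longrightarrow> u \<notin> W \<Longrightarrow> coord p u + R / (real n + 1)\<^sup>2 \<le> coord p v"
    by (rule value_gap[OF finite_supp ps(1,2) zero ps(3) R]) (assumption, rule that)
  have g: "4 * s \<le> R / (real n + 1)\<^sup>2" using s(2) by (simp add: pos_le_divide_eq mult_ac)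
  have fW: "finite W" using W(2) finite_supp finite_subset by blast
  have "card W \<le> n + 1" using card_mono[OF finite_supp W(2)] ps(1) by simp
  then have "simplex_on R W \<in> skeleton R n" using skeletonI[OF R fW W(1)] by blast
  note vert = barycenter_vertex[OF this]
  show thesis
  proof (rule that[OF vert], rule subsetI)
    fix q assume "q \<in> M.mball p s"
    then have q: "q \<in> \<Union>(skeleton R n)" "dist p q < s" by simp_all
    have close: "\<bar>coord p i - coord q i\<bar> < s" for i
      using coord_le_norm[of "p - q" i] q(2) by (simp add: coord_diff dist_norm)
    show "q \<in> open_star dist (barycentric_subdivision dist (skeleton R n)) (barycenter dist (simplex_on R W))"
    proof (rule star_of_level_set[OF q(1) W(1)])
      show "W \<subseteq> supp q"
      proof
        fix v assume "v \<in> W"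
        then have "0 < coord q v" using W(3)[of v] close[of v] g s(1) by linarith
        then show "v \<in> supp q" by (simp add: supp_def)
      qed
      show "coord q u < coord q v" if "v \<in> W" "u \<notin> W" for v u
        using W(4)[OF that] close[of u] close[of v] g s(1) by linarith
    qed
  qed
qed

end

section \<open>From coverings to maps into skeleta\<close>

text \<open>The distance to the empty set counts as infinite, so the function of the empty set is 0.\<close>

definition bump :: "('a \<Rightarrow> 'a \<Rightarrow> real) \<Rightarrow> real \<Rightarrow> 'a set \<Rightarrow> 'a \<Rightarrow> real" where
  "bump d r B x = (if B = {} then 0 else max 0 (r - Inf (d x ` B)))"

context Metric_space
begin

lemma bump_nonneg: "0 \<le> bump d r B x"
  by (simp add: bump_def)

lemma bdd_below_dist: "bdd_below (d x ` B)"
  by (rule bdd_belowI[of _ 0]) auto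

lemma bump_member:
  assumes "x \<in> B" "B \<subseteq> M" shows "r \<le> bump d r B x"
proof -
  have "Inf (d x ` B) \<le> d x x" using assms(1) by (intro cInf_lower bdd_below_dist) blast
  moreover have "d x x = 0" using assms by auto
  ultimately show ?thesis using assms(1) unfolding bump_def by auto
qed

lemma bump_pos_near:
  assumes "0 < bump d r B x"
  obtains y where "y \<in> B" "d x y < r"
proof -
  have B: "B \<noteq> {}" "Inf (d x ` B) < r" using assms by (auto simp: bump_def split: if_splits)
  then obtain t where "t \<in> d x ` B" "t < r" using cInf_lessD[of "d x ` B" r] by blast
  then show thesis using that by blast
qed

lemma bump_lipschitz:
  assumes "x \<in> M" "y \<in> M" "B \<subseteq> M"
  shows "bump d r B x \<le> bump d r B y + d x y"
proof (cases "B = {}")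
  case False
  have "Inf (d y ` B) - d x y \<le> Inf (d x ` B)"
  proof (rule cInf_greatest)
    show "d x ` B \<noteq> {}" using False by simp
    fix t assume "t \<in> d x ` B"
    then obtain b where b: "b \<in> B" "t = d x b" by blast
    have "Inf (d y ` B) \<le> d y b" using b by (intro cInf_lower bdd_below_dist) blast
    also have "\<dots> \<le> d y x + d x b" using assms b by (intro triangle) auto
    finally show "Inf (d y ` B) - d x y \<le> t" using b(2) commute[of x y] by simp
  qed
  then show ?thesis using False nonneg[of x y] by (simp add: bump_def max_def)
qed (simp add: bump_def)

text \<open>Writing \<open>\<sigma>\<^sub>B\<close> for the bumps and \<open>\<tau>\<close> for their sum, the identity
  \<open>\<sigma>\<^sub>B(x)/\<tau>(x) - \<sigma>\<^sub>B(y)/\<tau>(y) = (\<sigma>\<^sub>B(x) - \<sigma>\<^sub>B(y) + \<sigma>\<^sub>B(y)/\<tau>(y) (\<tau>(y) - \<tau>(x))) / \<tau>(x)\<close>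
  bounds the change of each coordinate by \<open>R (2n + 3) d(x,y) / (r/2)\<close>. At most \<open>2 (n + 1)\<close> coordinates change, which
  explains the value of \<open>r\<close>.\<close>

lemma covering_imp_map_to_skeleton:
  assumes cov: "covering M \<B>" and bdd: "bounded_family d D \<B> (\<lambda>B. B)" and D: "0 \<le> D"
    and mult: "multiplicity_at_scale M d r \<B> (\<lambda>B. B) \<le> enat (n + 1)"
    and R: "0 < R" and r: "r = R * (4 * (real n + 1) * (2 * real n + 3))"
  obtains f :: "'a \<Rightarrow> 'a set eucl" where "\<And>x. x \<in> M \<Longrightarrow> f x \<in> \<Union>(skeleton R n)"
    "\<And>x y. x \<in> M \<Longrightarrow> y \<in> M \<Longrightarrow> dist (f x) (f y) \<le> d x y"
    "\<And>x y B. x \<in> M \<Longrightarrow> y \<in> M \<Longrightarrow> 0 < coord (f x) B \<Longrightarrow> 0 < coord (f y) B \<Longrightarrow> d x y \<le> D + r"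
proof -
  let ?\<sigma> = "bump d (r / 2)"
  have rpos: "0 < r" unfolding r using R by (intro mult_pos_pos) auto
  have BM: "B \<subseteq> M" if "B \<in> \<B>" for B using cov that by (auto simp: covering_def)
  define J where "J x = {B \<in> \<B>. 0 < ?\<sigma> B x}" for x
  have J: "finite (J x) \<and> card (J x) \<le> n + 1" if x: "x \<in> M" for x
  proof -
    \<comment> \<open>Points of the nearby members that are close to \<open>x\<close> form a set of diameter at most \<open>r\<close> that meets all of them.\<close>
    have "\<forall>B\<in>J x. \<exists>y. y \<in> B \<and> d x y < r / 2"
    proof
      fix B assume "B \<in> J x"
      then have "0 < ?\<sigma> B x" by (simp add: J_def)
      then obtain y where "y \<in> B" "d x y < r / 2" by (rule bump_pos_near)
      then show "\<exists>y. y \<in> B \<and> d x y < r / 2" by blast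
    qed
    then obtain y where y: "\<And>B. B \<in> J x \<Longrightarrow> y B \<in> B \<and> d x (y B) < r / 2" by metis
    have yM: "y B \<in> M" if "B \<in> J x" for B using y[OF that] BM that by (auto simp: J_def)
    have "d (y B) (y C) \<le> r" if "B \<in> J x" "C \<in> J x" for B C
      using triangle[OF yM[OF that(1)] x yM[OF that(2)]] y[OF that(1)] y[OF that(2)] commute[of x "y B"] by simp
    then have "ediam d (y ` J x) \<le> ennreal r"
      using rpos by (subst ediam_le_iff) (auto simp: less_imp_le)
    moreover have "y ` J x \<subseteq> M" using yM by blast
    ultimately have fin: "finite {B \<in> \<B>. B \<inter> y ` J x \<noteq> {}}" "card {B \<in> \<B>. B \<inter> y ` J x \<noteq> {}} \<le> n + 1"
      using mult unfolding multiplicity_at_scale_le_iff by simp_all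
    have "J x \<subseteq> {B \<in> \<B>. B \<inter> y ` J x \<noteq> {}}"
    proof
      fix B assume B: "B \<in> J x"
      then have "y B \<in> B \<inter> y ` J x" using y by blast
      then show "B \<in> {B \<in> \<B>. B \<inter> y ` J x \<noteq> {}}" using B by (auto simp: J_def)
    qed
    then show ?thesis using fin card_mono finite_subset by (meson order_trans)
  qed
  define \<tau> where "\<tau> x = (\<Sum>B\<in>J x. ?\<sigma> B x)" for x
  have tau_superset: "\<tau> x = (\<Sum>B\<in>U. ?\<sigma> B x)" if "J x \<subseteq> U" "finite U" "U \<subseteq> \<B>" for x U
    unfolding \<tau>_def using that by (intro sum.mono_neutral_left) (auto simp: J_def not_less intro: antisym bump_nonneg)
  have tau: "r / 2 \<le> \<tau> x" if x: "x \<in> M" for x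
  proof -
    obtain B where B: "B \<in> \<B>" "x \<in> B" using cov x by (auto simp: covering_def)
    have le: "r / 2 \<le> ?\<sigma> B x" using bump_member[OF B(2) BM[OF B(1)]] .
    then have "B \<in> J x" using B(1) rpos by (simp add: J_def)
    then have "?\<sigma> B x \<le> \<tau> x" unfolding \<tau>_def using J[OF x] by (intro member_le_sum bump_nonneg) auto
    then show ?thesis using le by simp
  qed
  have tau_pos: "0 < \<tau> x" if "x \<in> M" for x using tau[OF that] rpos by linarith
  have sig_le: "?\<sigma> B x \<le> \<tau> x" if "x \<in> M" "B \<in> \<B>" for x B
  proof (cases "B \<in> J x")
    case True
    then show ?thesis unfolding \<tau>_def using J[OF that(1)] by (intro member_le_sum bump_nonneg) auto
  next
    case False
    then have "?\<sigma> B x \<le> 0" using that(2) by (simp add: J_def)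
    then show ?thesis using tau_pos[OF that(1)] by simp
  qed
  define f where "f x = (\<Sum>B\<in>J x. (R * ?\<sigma> B x / \<tau> x) *\<^sub>R unit B)" for x
  have coordf: "coord (f x) B = (if B \<in> J x then R * ?\<sigma> B x / \<tau> x else 0)" if "x \<in> M" for x B
    unfolding f_def using J[OF that] by (intro coord_unit_sum) simp
  have coordf': "coord (f x) B = R * ?\<sigma> B x / \<tau> x" if "x \<in> M" "B \<in> \<B>" for x B
    using coordf[OF that(1)] that(2) bump_nonneg[of "r/2" B x] by (auto simp: J_def)
  have suppf: "supp (f x) \<subseteq> J x" if "x \<in> M" for x by (auto simp: supp_def coordf[OF that])
  show thesis
  proof (rule that[of f])
    show "f x \<in> \<Union>(skeleton R n)" if x: "x \<in> M" for x
      unfolding skeleton_space[OF R]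
    proof (intro conjI allI)
      show "card (supp (f x)) \<le> n + 1" using card_mono[OF _ suppf[OF x]] J[OF x] by force
      show "0 \<le> coord (f x) B" for B
        using R tau_pos[OF x] bump_nonneg[of "r/2" B x] by (simp add: coordf[OF x])
      have "(\<Sum>B\<in>supp (f x). coord (f x) B) = (\<Sum>B\<in>J x. coord (f x) B)"
        using suppf[OF x] J[OF x] by (intro sum.mono_neutral_left) (auto simp: supp_def)
      also have "\<dots> = R * \<tau> x / \<tau> x"
        by (simp add: coordf[OF x] \<tau>_def sum_distrib_left sum_divide_distrib)
      finally show "(\<Sum>B\<in>supp (f x). coord (f x) B) = R" using tau_pos[OF x] by simp
    qed
    show "d x y \<le> D + r" if xy: "x \<in> M" "y \<in> M" and pos: "0 < coord (f x) B" "0 < coord (f y) B" for x y B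
    proof -
      have B: "B \<in> \<B>" "0 < ?\<sigma> B x" "0 < ?\<sigma> B y"
        using pos by (auto simp: coordf[OF xy(1)] coordf[OF xy(2)] J_def split: if_splits)
      obtain b where b: "b \<in> B" "d x b < r / 2" using bump_pos_near[OF B(2)] .
      obtain b' where b': "b' \<in> B" "d y b' < r / 2" using bump_pos_near[OF B(3)] .
      have bM: "b \<in> M" "b' \<in> M" using b b' BM[OF B(1)] by auto
      have "ediam d B \<le> ennreal D" using bdd B(1) by (simp add: bounded_family_def)
      then have "d b b' \<le> D" using b(1) b'(1) D by (simp add: ediam_le_iff)
      then show ?thesis
        using triangle[OF xy(1) bM(1) xy(2)] triangle[OF bM(1) bM(2) xy(2)] b(2) b'(2) commute[of y b'] by linarith
    qed
    show "dist (f x) (f y) \<le> d x y" if xy: "x \<in> M" "y \<in> M" for x y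
    proof -
      let ?U = "J x \<union> J y" and ?N = "2 * (real n + 1)"
      have U: "finite ?U" "?U \<subseteq> \<B>" using J xy by (auto simp: J_def)
      have "card ?U \<le> card (J x) + card (J y)" by (rule card_Un_le)
      also have "\<dots> \<le> (n + 1) + (n + 1)" using J[OF xy(1)] J[OF xy(2)] by (intro add_mono) simp_all
      finally have "real (card ?U) \<le> real ((n + 1) + (n + 1))" by (simp only: of_nat_le_iff)
      then have cU: "real (card ?U) \<le> ?N" by simp
      have sig: "\<bar>?\<sigma> B x - ?\<sigma> B y\<bar> \<le> d x y" if "B \<in> ?U" for B
      proof -
        have "B \<subseteq> M" using that U(2) BM by blast
        then have "?\<sigma> B x \<le> ?\<sigma> B y + d x y" "?\<sigma> B y \<le> ?\<sigma> B x + d y x"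
          using bump_lipschitz xy by blast+
        then show ?thesis using commute[of x y] by linarith
      qed
      have "\<bar>\<tau> x - \<tau> y\<bar> = \<bar>\<Sum>B\<in>?U. ?\<sigma> B x - ?\<sigma> B y\<bar>"
        using tau_superset[of x ?U] tau_superset[of y ?U] U by (simp add: sum_subtractf)
      also have "\<dots> \<le> (\<Sum>B\<in>?U. \<bar>?\<sigma> B x - ?\<sigma> B y\<bar>)" by (rule sum_abs)
      also have "\<dots> \<le> (\<Sum>B\<in>?U. d x y)" using sig by (rule sum_mono)
      also have "\<dots> = card ?U * d x y" by simp
      also have "\<dots> \<le> ?N * d x y" using cU by (intro mult_right_mono) auto
      finally have taudiff: "\<bar>\<tau> x - \<tau> y\<bar> \<le> ?N * d x y" .
      have coorddiff: "\<bar>coord (f x - f y) B\<bar> \<le> R * ((1 + ?N) * d x y) / (r / 2)" if B: "B \<in> ?U" for B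
      proof -
        have BB: "B \<in> \<B>" using B U(2) by blast
        have tx: "0 < \<tau> x" and ty: "0 < \<tau> y" using tau_pos xy by auto
        have "coord (f x - f y) B = R * (?\<sigma> B x / \<tau> x - ?\<sigma> B y / \<tau> y)"
          unfolding coord_diff coordf'[OF xy(1) BB] coordf'[OF xy(2) BB] by (simp add: right_diff_distrib)
        also have "?\<sigma> B x / \<tau> x - ?\<sigma> B y / \<tau> y = ((?\<sigma> B x - ?\<sigma> B y) + (?\<sigma> B y / \<tau> y) * (\<tau> y - \<tau> x)) / \<tau> x"
          using tx ty by (simp add: field_simps)
        finally have eq: "coord (f x - f y) B = R * (((?\<sigma> B x - ?\<sigma> B y) + (?\<sigma> B y / \<tau> y) * (\<tau> y - \<tau> x)) / \<tau> x)" .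
        have q: "0 \<le> ?\<sigma> B y / \<tau> y" "?\<sigma> B y / \<tau> y \<le> 1"
          using ty bump_nonneg[of "r/2" B y] sig_le[OF xy(2) BB] by simp_all
        have "\<bar>(?\<sigma> B y / \<tau> y) * (\<tau> y - \<tau> x)\<bar> = (?\<sigma> B y / \<tau> y) * \<bar>\<tau> x - \<tau> y\<bar>"
          unfolding abs_mult abs_of_nonneg[OF q(1)] abs_minus_commute[of "\<tau> y" "\<tau> x"] ..
        also have "\<dots> \<le> 1 * (?N * d x y)" using q taudiff by (intro mult_mono) auto
        finally have "\<bar>?\<sigma> B x - ?\<sigma> B y\<bar> + \<bar>(?\<sigma> B y / \<tau> y) * (\<tau> y - \<tau> x)\<bar> \<le> d x y + 1 * (?N * d x y)"
          using sig[OF B] by (rule add_mono[rotated])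
        also have "\<dots> = (1 + ?N) * d x y" by (simp only: distrib_right mult_1)
        finally have "\<bar>(?\<sigma> B x - ?\<sigma> B y) + (?\<sigma> B y / \<tau> y) * (\<tau> y - \<tau> x)\<bar> \<le> (1 + ?N) * d x y"
          by (rule order_trans[OF abs_triangle_ineq])
        then have "\<bar>(?\<sigma> B x - ?\<sigma> B y) + (?\<sigma> B y / \<tau> y) * (\<tau> y - \<tau> x)\<bar> / \<tau> x \<le> ((1 + ?N) * d x y) / (r / 2)"
          using tau[OF xy(1)] rpos by (intro frac_le) auto
        then have "R * (\<bar>(?\<sigma> B x - ?\<sigma> B y) + (?\<sigma> B y / \<tau> y) * (\<tau> y - \<tau> x)\<bar> / \<tau> x) \<le> R * (((1 + ?N) * d x y) / (r / 2))"
          using R by (intro mult_left_mono) auto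
        then show ?thesis unfolding eq abs_mult abs_divide using R tx by simp
      qed
      have "supp (f x - f y) \<subseteq> supp (f x) \<union> supp (f y)" by (auto simp: supp_def coord_diff)
      also have "\<dots> \<subseteq> ?U" using suppf[OF xy(1)] suppf[OF xy(2)] by (rule Un_mono)
      finally have "dist (f x) (f y) \<le> (\<Sum>B\<in>?U. \<bar>coord (f x - f y) B\<bar>)"
        unfolding dist_norm by (rule norm_le_sum_coord[OF U(1)])
      also have "\<dots> \<le> (\<Sum>B\<in>?U. R * ((1 + ?N) * d x y) / (r / 2))" using coorddiff by (rule sum_mono)
      also have "\<dots> = card ?U * (R * ((1 + ?N) * d x y) / (r / 2))" by simp
      also have "\<dots> \<le> ?N * (R * ((1 + ?N) * d x y) / (r / 2))"
        using cU R rpos by (intro mult_right_mono) auto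
      also have "\<dots> = d x y"
      proof -
        have "?N * (R * (1 + ?N)) * 2 = r" unfolding r by (simp add: algebra_simps)
        moreover have "?N * (R * ((1 + ?N) * d x y) / (r / 2)) = (?N * (R * (1 + ?N)) * 2) * d x y / r" by simp
        ultimately show ?thesis using rpos by simp
      qed
      finally show ?thesis .
    qed
  qed
qed

end

lemma ediam_leI: "(\<And>x y. x \<in> B \<Longrightarrow> y \<in> B \<Longrightarrow> d x y \<le> D) \<Longrightarrow> ediam d B \<le> ennreal D"
  unfolding ediam_def by (rule SUP_least) (auto intro: ennreal_leI)

text \<open>The sets \<open>S\<close> stand for the open stars, of vertices or of barycenters, in which a fixed coordinate is positive.\<close>

lemma nagata_imp_maps_to_skeleta:
  fixes X :: "'a set"
  assumes X: "Metric_space X d" and "nagata_property X d (int n)"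
  obtains c where "c > 0" "\<And>R. 0 < R \<Longrightarrow> \<exists>f :: 'a \<Rightarrow> 'a set eucl. nonexpanding X d (\<Union>(skeleton R n)) dist f \<and>
      (\<forall>S B. (\<forall>z\<in>S. 0 < coord z B) \<longrightarrow> ediam d (f -` S \<inter> X) \<le> ennreal (c * R))"
proof -
  obtain c where c: "c > 0" and cov: "\<forall>s>0. \<exists>\<B>. covering X \<B> \<and> bounded_family d (c * s) \<B> (\<lambda>B. B) \<and>
        multiplicity_at_scale X d s \<B> (\<lambda>B. B) \<le> enat (n + 1)"
    using assms(2) unfolding nagata_property_nat_iff by (elim exE conjE)
  let ?k = "4 * (real n + 1) * (2 * real n + 3)"
  have k: "0 < ?k" by (intro mult_pos_pos) auto
  show thesis
  proof (rule that[of "(c + 1) * ?k"])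
    show "0 < (c + 1) * ?k" using c k by (intro mult_pos_pos) auto
    fix R :: real assume R: "0 < R"
    have r: "0 < R * ?k" using R k by (rule mult_pos_pos)
    then obtain \<B> where B: "covering X \<B>" "bounded_family d (c * (R * ?k)) \<B> (\<lambda>B. B)"
      "multiplicity_at_scale X d (R * ?k) \<B> (\<lambda>B. B) \<le> enat (n + 1)"
      using cov[rule_format, OF r] by (elim exE conjE) (rule that)
    have D: "0 \<le> c * (R * ?k)" using c r by simp
    obtain f :: "'a \<Rightarrow> 'a set eucl" where f: "\<And>x. x \<in> X \<Longrightarrow> f x \<in> \<Union>(skeleton R n)"
      "\<And>x y. x \<in> X \<Longrightarrow> y \<in> X \<Longrightarrow> dist (f x) (f y) \<le> d x y"
      "\<And>x y B. x \<in> X \<Longrightarrow> y \<in> X \<Longrightarrow> 0 < coord (f x) B \<Longrightarrow> 0 < coord (f y) B \<Longrightarrow> d x y \<le> c * (R * ?k) + R * ?k"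
      by (rule Metric_space.covering_imp_map_to_skeleton[OF X B(1,2) D B(3) R refl]) (rule that)
    have "nonexpanding X d (\<Union>(skeleton R n)) dist f"
      unfolding nonexpanding_def using f(1,2) by (intro conjI image_subsetI ballI)
    moreover have "ediam d (f -` S \<inter> X) \<le> ennreal ((c + 1) * ?k * R)" if "\<forall>z\<in>S. 0 < coord z B" for S B
    proof (rule ediam_leI)
      fix x y assume "x \<in> f -` S \<inter> X" "y \<in> f -` S \<inter> X"
      then have "d x y \<le> c * (R * ?k) + R * ?k" using that by (intro f(3)[of x y B]) auto
      moreover have "(c + 1) * ?k * R = c * (R * ?k) + R * ?k" by (simp add: algebra_simps)
      ultimately show "d x y \<le> (c + 1) * ?k * R" by simp
    qed
    ultimately show "\<exists>f :: 'a \<Rightarrow> 'a set eucl. nonexpanding X d (\<Union>(skeleton R n)) dist f \<and>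
      (\<forall>S B. (\<forall>z\<in>S. 0 < coord z B) \<longrightarrow> ediam d (f -` S \<inter> X) \<le> ennreal ((c + 1) * ?k * R))" by blast
  qed
qed

lemma nagata_imp_maps_to_simplicial:
  fixes X :: "'a set"
  assumes X: "Metric_space X d" and N: "nagata_property X d (int n)"
  shows "maps_to_simplicial_complexes TYPE('a set eucl) X d n"
proof -
  obtain c where c: "c > 0" and maps: "\<And>R. 0 < R \<Longrightarrow> \<exists>f :: 'a \<Rightarrow> 'a set eucl. nonexpanding X d (\<Union>(skeleton R n)) dist f \<and>
      (\<forall>S B. (\<forall>z\<in>S. 0 < coord z B) \<longrightarrow> ediam d (f -` S \<inter> X) \<le> ennreal (c * R))"
    by (rule nagata_imp_maps_to_skeleta[OF X N]) (rule that)
  show ?thesis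
    unfolding maps_to_simplicial_complexes_def
  proof (rule exI[of _ "c / sqrt 2"], intro conjI allI impI)
    fix s :: real assume s: "s > 0"
    define R where "R = s / sqrt 2"
    have R: "0 < R" "R * sqrt 2 = s" using s by (simp_all add: R_def)
    obtain f :: "'a \<Rightarrow> 'a set eucl" where f: "nonexpanding X d (\<Union>(skeleton R n)) dist f"
      "\<forall>S B. (\<forall>z\<in>S. 0 < coord z B) \<longrightarrow> ediam d (f -` S \<inter> X) \<le> ennreal (c * R)"
      using maps[OF R(1)] by (elim exE conjE) (rule that)
    have "ediam d (f -` open_star dist (skeleton R n) y \<inter> X) \<le> ennreal (c / sqrt 2 * s)"
      if y: "y \<in> complex_vertices dist (skeleton R n)" for y
    proof -
      obtain B where B: "y = R *\<^sub>R unit B" using y skeleton_vertices[OF R(1)] by blast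
      have "\<forall>z\<in>open_star dist (skeleton R n) y. 0 < coord z B"
        unfolding B using skeleton_star[OF R(1)] by (rule ballI)
      then have "ediam d (f -` open_star dist (skeleton R n) y \<inter> X) \<le> ennreal (c * R)"
        by (rule f(2)[THEN spec, THEN spec, THEN mp])
      then show ?thesis by (simp add: R_def)
    qed
    then show "\<exists>(Y :: 'a set eucl set) dY \<C> f.
        simplicial_complex Y dY \<C> \<and> complex_dim dY \<C> \<le> enat n \<and> finite_subcomplexes_regular s dY \<C> \<and>
        nonexpanding X d Y dY f \<and>
        (\<forall>y\<in>complex_vertices dY \<C>. ediam d (f -` open_star dY \<C> y \<inter> X) \<le> ennreal (c / sqrt 2 * s))"
      using skeleton_complex[OF R(1)] skeleton_dim[OF R(1)] skeleton_regular[OF R(1)] f(1) unfolding R(2)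
      by (intro exI[of _ "\<Union>(skeleton R n)"] exI[of _ dist] exI[of _ "skeleton R n"] exI[of _ f] conjI ballI)
  qed (use c in simp)
qed

lemma nagata_imp_maps_to_polyhedral:
  fixes X :: "'a set"
  assumes X: "Metric_space X d" and N: "nagata_property X d (int n)"
  shows "maps_to_polyhedral_complexes TYPE('a set eucl) X d n"
proof -
  obtain c where c: "c > 0" and maps: "\<And>R. 0 < R \<Longrightarrow> \<exists>f :: 'a \<Rightarrow> 'a set eucl. nonexpanding X d (\<Union>(skeleton R n)) dist f \<and>
      (\<forall>S B. (\<forall>z\<in>S. 0 < coord z B) \<longrightarrow> ediam d (f -` S \<inter> X) \<le> ennreal (c * R))"
    by (rule nagata_imp_maps_to_skeleta[OF X N]) (rule that)
  \<comment> \<open>The size for which the Lebesgue number of \<open>skeleton_lebesgue\<close> is \<open>s\<close>.\<close>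
  let ?k = "4 * (real n + 1)\<^sup>2"
  have k: "0 < ?k" by simp
  show ?thesis
    unfolding maps_to_polyhedral_complexes_def Let_def
  proof (rule exI[of _ "c * ?k"], intro conjI allI impI)
    fix s :: real assume s: "s > 0"
    define R where "R = ?k * s"
    have R: "0 < R" unfolding R_def using k s by (rule mult_pos_pos)
    obtain f :: "'a \<Rightarrow> 'a set eucl" where f: "nonexpanding X d (\<Union>(skeleton R n)) dist f"
      "\<forall>S B. (\<forall>z\<in>S. 0 < coord z B) \<longrightarrow> ediam d (f -` S \<inter> X) \<le> ennreal (c * R)"
      using maps[OF R] by (elim exE conjE) (rule that)
    let ?C1 = "barycentric_subdivision dist (skeleton R n) :: 'a set eucl set set"
    interpret P: poly_complex "\<Union>(skeleton R n)" dist "skeleton R n :: 'a set eucl set set"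
      by (rule poly_complex_skeleton[OF R])
    have diam: "ediam d (f -` open_star dist ?C1 z \<inter> X) \<le> ennreal (c * ?k * s)" if z: "z \<in> complex_vertices dist ?C1" for z
    proof -
      obtain F where F: "F \<in> skeleton R n" "z = barycenter dist F" by (rule P.subdivision_vertex[OF z])
      obtain W where W: "finite W" "W \<noteq> {}" "card W \<le> n + 1" "F = simplex_on R W" by (rule skeletonE[OF R F(1)])
      obtain w where w: "w \<in> W" using W(2) by blast
      have "\<forall>q\<in>open_star dist ?C1 z. 0 < coord q w"
        unfolding F(2) W(4) using subdivision_star_support[OF R W(1-3) w] by (rule ballI)
      then have "ediam d (f -` open_star dist ?C1 z \<inter> X) \<le> ennreal (c * R)"
        by (rule f(2)[THEN spec, THEN spec, THEN mp])
      then show ?thesis by (simp add: R_def mult.assoc)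
    qed
    have leb: "\<exists>z\<in>complex_vertices dist ?C1. Metric_space.mball (\<Union>(skeleton R n)) dist p s \<subseteq> open_star dist ?C1 z"
      if p: "p \<in> \<Union>(skeleton R n)" for p
    proof -
      have "4 * (real n + 1)\<^sup>2 * s \<le> R" by (simp add: R_def)
      then obtain z where "z \<in> complex_vertices dist ?C1"
        "Metric_space.mball (\<Union>(skeleton R n)) dist p s \<subseteq> open_star dist ?C1 z"
        by (rule skeleton_lebesgue[OF R p s]) (rule that)
      then show ?thesis by (rule bexI[rotated])
    qed
    show "\<exists>(Z :: 'a set eucl set) dZ \<C> g. polyhedral_complex Z dZ \<C> \<and> complex_dim dZ \<C> \<le> enat n \<and>
        ((\<forall>p\<in>Z. \<exists>z\<in>complex_vertices dZ (barycentric_subdivision dZ \<C>).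
             Metric_space.mball Z dZ p s \<subseteq> open_star dZ (barycentric_subdivision dZ \<C>) z) \<and>
         (\<forall>z\<in>complex_vertices dZ (barycentric_subdivision dZ \<C>).
             ediam d (g -` open_star dZ (barycentric_subdivision dZ \<C>) z \<inter> X) \<le> ennreal (c * ?k * s))) \<and>
        nonexpanding X d Z dZ g"
      by (intro exI[of _ "\<Union>(skeleton R n)"] exI[of _ dist] exI[of _ "skeleton R n"] exI[of _ f] conjI ballI
          P.complex skeleton_dim[OF R] leb diam f(1))
  qed (use c k in \<open>simp add: mult_pos_pos\<close>)
qed

theorem proposition2p5:
  fixes X :: "'a set" and d :: "'a \<Rightarrow> 'a \<Rightarrow> real" and n :: nat
  assumes "Metric_space X d"
  shows "(nagata_dim X d \<le> ereal (real n) \<longleftrightarrow> nagata_property X d (int n)) \<and>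
         (nagata_dim X d \<le> ereal (real n) \<longleftrightarrow>
            maps_to_simplicial_complexes TYPE('a set eucl) X d n) \<and>
         (nagata_dim X d \<le> ereal (real n) \<longleftrightarrow>
            maps_to_polyhedral_complexes TYPE('a set eucl) X d n) \<and>
         (nagata_dim X d \<le> ereal (real n) \<longleftrightarrow> separated_coverings X d n) \<and>
         (maps_to_simplicial_complexes TYPE('y) X d n \<longrightarrow> nagata_dim X d \<le> ereal (real n)) \<and>
         (maps_to_polyhedral_complexes TYPE('z) X d n \<longrightarrow> nagata_dim X d \<le> ereal (real n))"
  unfolding nagata_dim_le_iff
proof (intro conjI iffI impI refl)
  assume N: "nagata_property X d (int n)"
  show "maps_to_simplicial_complexes TYPE('a set eucl) X d n"
    using assms N by (rule nagata_imp_maps_to_simplicial)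
  show "maps_to_polyhedral_complexes TYPE('a set eucl) X d n"
    using assms N by (rule nagata_imp_maps_to_polyhedral)
  then show "separated_coverings X d n"
    by (rule maps_to_polyhedral_imp_separated[OF assms])
next
  show "nagata_property X d (int n)" if "maps_to_simplicial_complexes TYPE('a set eucl) X d n"
    using assms that by (rule maps_to_simplicial_imp_nagata)
  show "nagata_property X d (int n)" if "maps_to_simplicial_complexes TYPE('y) X d n"
    using assms that by (rule maps_to_simplicial_imp_nagata)
  show "nagata_property X d (int n)" if "maps_to_polyhedral_complexes TYPE('a set eucl) X d n"
    by (rule separated_coverings_imp_nagata[OF maps_to_polyhedral_imp_separated[OF assms that]])
  show "nagata_property X d (int n)" if "maps_to_polyhedral_complexes TYPE('z) X d n"
    by (rule separated_coverings_imp_nagata[OF maps_to_polyhedral_imp_separated[OF assms that]])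
  show "nagata_property X d (int n)" if "separated_coverings X d n"
    using that by (rule separated_coverings_imp_nagata)
qed

end
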